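(* Let $K\subset\mathbb{R}$ be a Cantor set. Any finitely generated nilpotent subgroup of $\mathfrak{diff}^{1+Lip}(K)$ is virtually abelian.
   Context: A Cantor set is a (nonempty) compact totally disconnected set each of whose points is an accumulation point. For a Cantor set $K\subset\mathbb{R}$, $\mathfrak{diff}^{1+Lip}(K)$ is the group (under composition) of homeomorphisms $f$ of $K$ such that for every $x\in K$ there exist an open interval $I\subset\mathbb{R}$ containing $x$ and a $C^1$-diffeomorphism $\tilde f:I\to\tilde f(I)\subset\mathbb{R}$ with $\log|\tilde f'|$ Lipschitz continuous on $I$ and $\tilde f_{|I\cap K}=f_{|I\cap K}$. A group is virtually abelian if it contains an abelian subgroup of finite index. *)

theory Defs
  imports "HOL-Analysis.Analysis" "HOL-Algebra.Generated_Groups" "HOL-Algebra.Bij"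
begin

section \<open>Finitely generated, nilpotent and virtually abelian groups\<close>

definition finitely_generated_group :: "('a, 'b) monoid_scheme \<Rightarrow> bool" where
  "finitely_generated_group G \<longleftrightarrow>
     (\<exists>S. finite S \<and> S \<subseteq> carrier G \<and> generate G S = carrier G)"

primrec lower_central_series :: "('a, 'b) monoid_scheme \<Rightarrow> nat \<Rightarrow> 'a set" where
  "lower_central_series G 0 = carrier G"
| "lower_central_series G (Suc n) =
     generate G {a \<otimes>\<^bsub>G\<^esub> b \<otimes>\<^bsub>G\<^esub> inv\<^bsub>G\<^esub> a \<otimes>\<^bsub>G\<^esub> inv\<^bsub>G\<^esub> b | a b.
                 a \<in> lower_central_series G n \<and> b \<in> carrier G}"

definition nilpotent_group :: "('a, 'b) monoid_scheme \<Rightarrow> bool" where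
  "nilpotent_group G \<longleftrightarrow> (\<exists>n. lower_central_series G n = {\<one>\<^bsub>G\<^esub>})"

definition virtually_abelian_group :: "('a, 'b) monoid_scheme \<Rightarrow> bool" where
  "virtually_abelian_group G \<longleftrightarrow>
     (\<exists>A. subgroup A G \<and> comm_group (G\<lparr>carrier := A\<rparr>) \<and> finite (rcosets\<^bsub>G\<^esub> A))"


section \<open>Cantor sets and their diffeomorphism groups\<close>

definition Cantor_set :: "'a::topological_space set \<Rightarrow> bool" where
  "Cantor_set K \<longleftrightarrow> K \<noteq> {} \<and> compact K \<and>
     (\<forall>x\<in>K. connected_component_set K x = {x}) \<and> (\<forall>x\<in>K. x islimpt K)"

definition C1_diffeomorphism :: "real set \<Rightarrow> real set \<Rightarrow> (real \<Rightarrow> real) \<Rightarrow> bool" where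
  "C1_diffeomorphism I J f \<longleftrightarrow> open I \<and> open J \<and> f C1_differentiable_on I \<and>
     (\<exists>g. homeomorphism I J f g \<and> g C1_differentiable_on J)"

text \<open>A self-map of \<open>K\<close> is represented by the function that is \<open>undefined\<close> outside \<open>K\<close>,
  as in \<^const>\<open>Bij\<close>, so that equality of functions is equality on \<open>K\<close>. Neither \<open>f\<close> nor its
  local extensions are required to preserve the order.\<close>

definition Diff_1Lip :: "real set \<Rightarrow> (real \<Rightarrow> real) set" where
  "Diff_1Lip K = {f \<in> extensional K. (\<exists>g. homeomorphism K K f g) \<and>
     (\<forall>x\<in>K. \<exists>I h. open I \<and> is_interval I \<and> x \<in> I \<and> C1_diffeomorphism I (h ` I) h \<and>
        (\<exists>L. L-lipschitz_on I (\<lambda>t. ln \<bar>deriv h t\<bar>)) \<and> (\<forall>t \<in> I \<inter> K. h t = f t))}"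

definition Diff_1Lip_group :: "real set \<Rightarrow> (real \<Rightarrow> real) monoid" where
  "Diff_1Lip_group K = (BijGroup K)\<lparr>carrier := Diff_1Lip K\<rparr>"


subsection \<open>The diffeomorphisms form a group\<close>

lemma C1_diffeomorphismI:
  fixes f D :: "real \<Rightarrow> real"
  assumes I: "open I" and D: "\<And>x. x \<in> I \<Longrightarrow> (f has_real_derivative D x) (at x)"
    and cD: "continuous_on I D" and nz: "\<And>x. x \<in> I \<Longrightarrow> D x \<noteq> 0" and inj: "inj_on f I"
  shows "C1_diffeomorphism I (f ` I) f"
proof -
  have cf: "continuous_on I f"
    using D by (meson DERIV_isCont continuous_at_imp_continuous_on)
  have oJ: "open (f ` I)"
    using invariance_of_domain[OF cf I inj] .
  obtain g where g: "homeomorphism I (f ` I) f g"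
    using invariance_of_domain_homeomorphism[OF I cf _ inj] by blast
  have gf: "\<And>x. x \<in> I \<Longrightarrow> g (f x) = x" and cg: "continuous_on (f ` I) g"
    using g by (auto simp: homeomorphism_def)
  have Dg: "(g has_real_derivative inverse (D (g y))) (at y)" if y: "y \<in> f ` I" for y
  proof (rule has_field_derivative_inverse_basic)
    show "(f has_real_derivative D (g y)) (at (g y))" "D (g y) \<noteq> 0"
      using y gf D nz by auto
    show "isCont g y"
      using cg oJ y continuous_on_eq_continuous_at by blast
    show "\<And>z. z \<in> f ` I \<Longrightarrow> f (g z) = z" using gf by auto
  qed (use oJ y in auto)
  have "continuous_on (f ` I) (\<lambda>y. inverse (D (g y)))"
  proof (intro continuous_on_inverse)
    show "continuous_on (f ` I) (\<lambda>y. D (g y))"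
      by (rule continuous_on_compose2[OF cD cg]) (use gf in auto)
    show "\<forall>y\<in>f ` I. D (g y) \<noteq> 0" using gf nz by auto
  qed
  hence "g C1_differentiable_on f ` I"
    using Dg unfolding C1_differentiable_on_def has_real_derivative_iff_has_vector_derivative
    by (intro exI[of _ "\<lambda>y. inverse (D (g y))"] conjI ballI)
  moreover have "f C1_differentiable_on I"
    using D cD unfolding C1_differentiable_on_def has_real_derivative_iff_has_vector_derivative
    by (intro exI[of _ D] conjI ballI)
  ultimately show ?thesis
    using I oJ g unfolding C1_diffeomorphism_def by blast
qed

lemma C1_diffeomorphismD:
  assumes "C1_diffeomorphism I J f"
  shows "open I" "open J" "f ` I = J" "inj_on f I" "continuous_on I (deriv f)"
    and "\<And>x. x \<in> I \<Longrightarrow> (f has_real_derivative deriv f x) (at x)"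
    and "\<And>x. x \<in> I \<Longrightarrow> deriv f x \<noteq> 0"
proof -
  obtain D E g where I: "open I" and J: "open J" and g: "homeomorphism I J f g"
    and D: "\<And>x. x \<in> I \<Longrightarrow> (f has_real_derivative D x) (at x)" and cD: "continuous_on I D"
    and E: "\<And>x. x \<in> J \<Longrightarrow> (g has_real_derivative E x) (at x)"
    using assms unfolding C1_diffeomorphism_def C1_differentiable_on_def
      has_real_derivative_iff_has_vector_derivative by blast
  have D_eq: "deriv f x = D x" if "x \<in> I" for x
    using D that DERIV_imp_deriv by blast
  show "open I" "open J" by fact+
  show "f ` I = J" using g by (simp add: homeomorphism_def)
  show "inj_on f I" using g by (metis homeomorphism_def inj_on_inverseI)
  show "continuous_on I (deriv f)" using cD D_eq by (simp cong: continuous_on_cong)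
  show "(f has_real_derivative deriv f x) (at x)" if "x \<in> I" for x using D D_eq that by simp
  show "deriv f x \<noteq> 0" if x: "x \<in> I" for x
  proof -
    have "f x \<in> J" using g x by (auto simp: homeomorphism_def)
    hence "((g \<circ> f) has_real_derivative E (f x) * D x) (at x)"
      using DERIV_chain[OF E D] x by blast
    moreover have "((g \<circ> f) has_real_derivative 1) (at x)"
    proof (rule has_field_derivative_transform_within_open[OF _ I x])
      show "((\<lambda>x. x) has_real_derivative 1) (at x)" by (rule DERIV_ident)
      show "\<And>y. y \<in> I \<Longrightarrow> y = (g \<circ> f) y" using g by (auto simp: homeomorphism_def)
    qed
    ultimately have "E (f x) * D x = 1" by (rule DERIV_unique)
    thus ?thesis using D_eq x by auto
  qed
qed

lemma C1_imp_lipschitz_ball: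
  fixes f :: "real \<Rightarrow> real"
  assumes "\<And>x. x \<in> cball a e \<Longrightarrow> (f has_real_derivative D x) (at x)"
    and "continuous_on (cball a e) D"
  obtains B where "B-lipschitz_on (ball a e) f"
proof -
  have "bounded (D ` cball a e)"
    by (intro compact_imp_bounded compact_continuous_image assms compact_cball)
  then obtain B where B: "B > 0" "\<And>x. x \<in> cball a e \<Longrightarrow> norm (D x) \<le> B"
    unfolding bounded_pos by auto
  have "norm (f x - f y) \<le> B * norm (x - y)" if "x \<in> ball a e" "y \<in> ball a e" for x y
    by (rule field_differentiable_bound[of "cball a e" f D])
       (use that B assms(1) in \<open>auto intro: DERIV_subset\<close>)
  hence "B-lipschitz_on (ball a e) f"
    using B by (intro lipschitz_onI) (auto simp: dist_norm)
  thus ?thesis using that by blast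
qed

lemma is_interval_ball_real: "is_interval (ball (a::real) e)"
  by (simp add: is_interval_connected_1)

lemma Diff_1Lip_homeomorphism:
  assumes "f \<in> Diff_1Lip K" obtains g where "homeomorphism K K f g"
  using assms unfolding Diff_1Lip_def mem_Collect_eq by blast

lemma Diff_1Lip_local:
  assumes "f \<in> Diff_1Lip K" "x \<in> K"
  obtains I h L where "x \<in> I" "C1_diffeomorphism I (h ` I) h"
    "L-lipschitz_on I (\<lambda>t. ln \<bar>deriv h t\<bar>)" "\<forall>t \<in> I \<inter> K. h t = f t"
  using assms unfolding Diff_1Lip_def mem_Collect_eq by blast

lemma Diff_1Lip_imp_Bij: "f \<in> Diff_1Lip K \<Longrightarrow> f \<in> Bij K"
  by (auto simp: Diff_1Lip_def Bij_def homeomorphism_def bij_betw_def intro: inj_on_inverseI)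

lemma id_in_Diff_1Lip: "(\<lambda>x\<in>K. x) \<in> Diff_1Lip K"
proof -
  have hom: "(\<lambda>x\<in>K. x) \<in> extensional K" "homeomorphism K K (\<lambda>x\<in>K. x) (\<lambda>x. x)"
    by (auto simp: homeomorphism_def cong: continuous_on_cong)
  have "C1_diffeomorphism UNIV ((\<lambda>t. t) ` UNIV) (\<lambda>t. t)"
    by (rule C1_diffeomorphismI[where D = "\<lambda>_. 1"]) auto
  moreover have "0-lipschitz_on UNIV (\<lambda>t. ln \<bar>deriv (\<lambda>t::real. t) t\<bar>)"
    by (simp add: lipschitz_on_def)
  ultimately have "\<exists>I h. open I \<and> is_interval I \<and> x \<in> I \<and> C1_diffeomorphism I (h ` I) h \<and>
        (\<exists>L. L-lipschitz_on I (\<lambda>t. ln \<bar>deriv h t\<bar>)) \<and> (\<forall>t \<in> I \<inter> K. h t = (\<lambda>x\<in>K. x) t)"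
    for x
    by (intro exI[of _ UNIV] exI[of _ "\<lambda>t. t"] conjI) (blast | simp)+
  thus ?thesis
    using hom unfolding Diff_1Lip_def mem_Collect_eq by blast
qed

lemma compose_in_Diff_1Lip:
  assumes f: "f \<in> Diff_1Lip K" and g: "g \<in> Diff_1Lip K"
  shows "compose K g f \<in> Diff_1Lip K"
proof -
  obtain f' g' where f': "homeomorphism K K f f'" and g': "homeomorphism K K g g'"
    using f g by (meson Diff_1Lip_homeomorphism)
  have "homeomorphism K K (g \<circ> f) (f' \<circ> g')"
    using homeomorphism_compose[OF f' g'] .
  hence hom: "homeomorphism K K (compose K g f) (f' \<circ> g')"
    by (rule homeomorphism_cong) (auto simp: compose_def)
  have "\<exists>I h. open I \<and> is_interval I \<and> x \<in> I \<and> C1_diffeomorphism I (h ` I) h \<and>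
        (\<exists>L. L-lipschitz_on I (\<lambda>t. ln \<bar>deriv h t\<bar>)) \<and> (\<forall>t \<in> I \<inter> K. h t = compose K g f t)"
    if x: "x \<in> K" for x
  proof -
    have fx: "f x \<in> K" using f' x by (auto simp: homeomorphism_def)
    obtain I h L where I: "x \<in> I" "C1_diffeomorphism I (h ` I) h"
        "L-lipschitz_on I (\<lambda>t. ln \<bar>deriv h t\<bar>)" "\<forall>t \<in> I \<inter> K. h t = f t"
      using f x by (rule Diff_1Lip_local)
    obtain J k M where J: "f x \<in> J" "C1_diffeomorphism J (k ` J) k"
        "M-lipschitz_on J (\<lambda>t. ln \<bar>deriv k t\<bar>)" "\<forall>t \<in> J \<inter> K. k t = g t"
      using g fx by (rule Diff_1Lip_local)
    note h = C1_diffeomorphismD[OF I(2)]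
    note k = C1_diffeomorphismD[OF J(2)]
    have ch: "continuous_on I h"
      using h(6) by (meson DERIV_isCont continuous_at_imp_continuous_on)
    have "open (I \<inter> h -` J)"
      by (rule continuous_open_preimage[OF ch h(1) k(1)])
    moreover have "x \<in> I \<inter> h -` J" using I J x by auto
    ultimately obtain e where e: "e > 0" "cball x e \<subseteq> I \<inter> h -` J"
      using open_contains_cball by blast
    let ?B = "ball x e"
    have B: "?B \<subseteq> I" "\<And>t. t \<in> ?B \<Longrightarrow> h t \<in> J" "?B \<subseteq> cball x e"
      using e(2) ball_subset_cball[of x e] by blast+
    obtain N where N: "N-lipschitz_on ?B h"
      by (rule C1_imp_lipschitz_ball[of x e h "deriv h"])
         (use h e continuous_on_subset[OF h(5)] in auto)
    let ?D = "\<lambda>t. deriv k (h t) * deriv h t"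
    have D: "((k \<circ> h) has_real_derivative ?D t) (at t)" if "t \<in> ?B" for t
      using DERIV_chain[OF k(6) h(6)] that B by blast
    have "C1_diffeomorphism ?B ((k \<circ> h) ` ?B) (k \<circ> h)"
    proof (rule C1_diffeomorphismI[OF _ D])
      show "continuous_on ?B ?D"
        by (intro continuous_intros continuous_on_compose2[OF k(5)]
              continuous_on_subset[OF h(5)] continuous_on_subset[OF ch]) (use B in auto)
      show "?D t \<noteq> 0" if "t \<in> ?B" for t using h(7) k(7) B that by auto
      show "inj_on (k \<circ> h) ?B"
        using B by (intro comp_inj_on inj_on_subset[OF h(4)] inj_on_subset[OF k(4)]) auto
    qed auto
    moreover have "(M * N + L)-lipschitz_on ?B (\<lambda>t. ln \<bar>deriv (k \<circ> h) t\<bar>)"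
    proof (rule lipschitz_on_transform)
      show "(M * N + L)-lipschitz_on ?B (\<lambda>t. ln \<bar>deriv k (h t)\<bar> + ln \<bar>deriv h t\<bar>)"
        by (intro lipschitz_on_add lipschitz_on_compose2[OF N] lipschitz_on_subset[OF I(3)]
              lipschitz_on_subset[OF J(3)]) (use B in auto)
      fix t assume t: "t \<in> ?B"
      show "ln \<bar>deriv (k \<circ> h) t\<bar> = ln \<bar>deriv k (h t)\<bar> + ln \<bar>deriv h t\<bar>"
        using DERIV_imp_deriv[OF D[OF t]] h(7) k(7) B t by (simp add: abs_mult ln_mult subset_iff)
    qed
    moreover have "(k \<circ> h) t = compose K g f t" if "t \<in> ?B \<inter> K" for t
    proof -
      have "h t = f t" "f t \<in> K" "h t \<in> J"
        using that I(4) B f' by (auto simp: homeomorphism_def)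
      thus ?thesis using that J(4) by (simp add: compose_def)
    qed
    ultimately show ?thesis
      using e is_interval_ball_real[of x e]
      by (intro exI[of _ ?B] exI[of _ "k \<circ> h"]) auto
  qed
  thus ?thesis
    using hom compose_extensional unfolding Diff_1Lip_def mem_Collect_eq by blast
qed

lemma inverse_in_Diff_1Lip:
  assumes f: "f \<in> Diff_1Lip K"
  shows "restrict (inv_into K f) K \<in> Diff_1Lip K"
proof -
  let ?f' = "restrict (inv_into K f) K"
  obtain g where g: "homeomorphism K K f g"
    using f by (rule Diff_1Lip_homeomorphism)
  have f'_g: "?f' y = g y" if "y \<in> K" for y
    using that g by (simp add: homeomorphism_def)
      (metis imageI inj_on_inverseI inv_into_f_eq)
  have hom: "homeomorphism K K ?f' f"
    using homeomorphism_cong[OF homeomorphism_symD[OF g], where f' = ?f' and g' = f] f'_g by auto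
  have "\<exists>I h. open I \<and> is_interval I \<and> y \<in> I \<and> C1_diffeomorphism I (h ` I) h \<and>
        (\<exists>L. L-lipschitz_on I (\<lambda>t. ln \<bar>deriv h t\<bar>)) \<and> (\<forall>t \<in> I \<inter> K. h t = ?f' t)"
    if y: "y \<in> K" for y
  proof -
    have gy: "g y \<in> K" "f (g y) = y" using g y by (auto simp: homeomorphism_def)
    obtain I h L where I: "g y \<in> I" "C1_diffeomorphism I (h ` I) h"
        "L-lipschitz_on I (\<lambda>t. ln \<bar>deriv h t\<bar>)" "\<forall>t \<in> I \<inter> K. h t = f t"
      using f gy(1) by (rule Diff_1Lip_local)
    note h = C1_diffeomorphismD[OF I(2)]
    obtain k where k: "homeomorphism I (h ` I) h k" "C1_diffeomorphism (h ` I) I k"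
      using I(2) homeomorphism_symD unfolding C1_diffeomorphism_def by blast
    note k' = C1_diffeomorphismD[OF k(2)]
    have kh: "\<And>t. t \<in> I \<Longrightarrow> k (h t) = t" using k(1) by (auto simp: homeomorphism_def)
    have "continuous_on K g" using g by (auto simp: homeomorphism_def)
    then obtain U where U: "open U" "U \<inter> K = g -` I \<inter> K"
      using h(1) continuous_on_open_invariant[THEN iffD1, rule_format, of K g I] by blast
    have "y \<in> U \<inter> h ` I" using U y I gy by force
    moreover have "open (U \<inter> h ` I)" using U h by auto
    ultimately obtain e where e: "e > 0" "cball y e \<subseteq> U \<inter> h ` I"
      using open_contains_cball by blast
    let ?B = "ball y e"
    have B: "?B \<subseteq> h ` I" "?B \<subseteq> U" "?B \<subseteq> cball y e" using e(2) by auto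
    obtain N where N: "N-lipschitz_on ?B k"
      by (rule C1_imp_lipschitz_ball[of y e k "deriv k"])
         (use k' e continuous_on_subset[OF k'(5)] in auto)
    have "C1_diffeomorphism ?B (k ` ?B) k"
      by (rule C1_diffeomorphismI[OF _ k'(6) continuous_on_subset[OF k'(5)] k'(7)
            inj_on_subset[OF k'(4)]]) (use B in auto)
    moreover have "(L * N)-lipschitz_on ?B (\<lambda>t. ln \<bar>deriv k t\<bar>)"
    proof (rule lipschitz_on_transform)
      show "(L * N)-lipschitz_on ?B (\<lambda>t. - ln \<bar>deriv h (k t)\<bar>)"
      proof (intro lipschitz_on_minus
            lipschitz_on_compose2[OF N, where g = "\<lambda>s. ln \<bar>deriv h s\<bar>"])
        show "L-lipschitz_on (k ` ?B) (\<lambda>s. ln \<bar>deriv h s\<bar>)"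
          by (rule lipschitz_on_subset[OF I(3)]) (use B kh in auto)
      qed
      fix t assume t: "t \<in> ?B"
      then obtain s where s: "s \<in> I" "t = h s" using B by auto
      have "(k \<circ> h has_real_derivative deriv k t * deriv h s) (at s)"
        using DERIV_chain[OF k'(6) h(6)] s by blast
      moreover have "((k \<circ> h) has_real_derivative 1) (at s)"
        by (rule has_field_derivative_transform_within_open[OF DERIV_ident h(1) s(1)])
           (simp add: kh)
      ultimately have "deriv k t * deriv h s = 1" by (rule DERIV_unique)
      hence "deriv k t = inverse (deriv h s)" using h(7) s by (simp add: field_simps)
      thus "ln \<bar>deriv k t\<bar> = - ln \<bar>deriv h (k t)\<bar>"
        using s kh h(7) by (simp add: ln_inverse)
    qed
    moreover have "k t = ?f' t" if "t \<in> ?B \<inter> K" for t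
    proof -
      have t: "t \<in> K" "g t \<in> I" "g t \<in> K" "f (g t) = t"
        using that B U g by (auto simp: homeomorphism_def)
      hence "k t = g t" using I(4) kh by (metis IntI)
      thus ?thesis using f'_g t by simp
    qed
    ultimately show ?thesis
      using e is_interval_ball_real[of y e]
      by (intro exI[of _ ?B] exI[of _ k]) auto
  qed
  thus ?thesis
    using hom restrict_extensional unfolding Diff_1Lip_def mem_Collect_eq by blast
qed

proposition subgroup_Diff_1Lip: "subgroup (Diff_1Lip K) (BijGroup K)"
proof
  show "Diff_1Lip K \<subseteq> carrier (BijGroup K)"
    using Diff_1Lip_imp_Bij by (auto simp: BijGroup_def)
  show "g \<otimes>\<^bsub>BijGroup K\<^esub> f \<in> Diff_1Lip K" if "g \<in> Diff_1Lip K" "f \<in> Diff_1Lip K" for f g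
    using that compose_in_Diff_1Lip Diff_1Lip_imp_Bij by (auto simp: BijGroup_def)
  show "\<one>\<^bsub>BijGroup K\<^esub> \<in> Diff_1Lip K"
    using id_in_Diff_1Lip by (simp add: BijGroup_def)
  show "inv\<^bsub>BijGroup K\<^esub> f \<in> Diff_1Lip K" if "f \<in> Diff_1Lip K" for f
    using that inverse_in_Diff_1Lip Diff_1Lip_imp_Bij by (simp add: inv_BijGroup)
qed

corollary group_Diff_1Lip: "group (Diff_1Lip_group K)"
  unfolding Diff_1Lip_group_def
  by (rule group.subgroup_imp_group[OF group_BijGroup subgroup_Diff_1Lip])

end

theory Submission
  imports Defs "HOL-Library.Transitive_Closure_Table"
begin

text \<open>
  Let \<open>H\<close> be the nilpotent group. Every minimal closed \<open>H\<close>-invariant set is finite: in an infinite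
  one, some complementary gap has infinitely many images under the group, and these have finite total
  length, so that the Lipschitz condition on the logarithmic derivative bounds the distortion along
  them and makes some elements contract a fixed neighbourhood of an endpoint of the gap as strongly as
  desired. By minimality one gets two elements mapping that neighbourhood into disjoint parts of itself,
  hence a free semigroup, which a nilpotent group does not contain.

  Let \<open>c = [a, b]\<close> be central in \<open>H\<close>. At a point \<open>p\<close> of a finite orbit suitable powers of \<open>a\<close>, \<open>b\<close>,
  \<open>c\<close> fix \<open>p\<close>, preserve the order near \<open>p\<close> and still satisfy such a commutator relation. An argument
  like that of Plante and Thurston, using Kopell's lemma, shows that this power of \<open>c\<close> is the identity
  near \<open>p\<close>. The points near which no power of \<open>c\<close> is trivial form a closed invariant set without
  finite orbit, which is therefore empty; by compactness \<open>c\<close> has finite order. In a finitely generated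
  nilpotent group all of whose central commutators have finite order the centre has finite index.
\<close>

section \<open>Bounded distortion on the Cantor set\<close>

text \<open>Elements of the group need not preserve the order and come with different local
  extensions, so only two uniform facts at a small scale \<open>e\<close> are kept: monotonicity,
  and a bound \<open>exp (L * length)\<close> for the ratio of two difference quotients between
  points of \<open>K\<close>. Such bounds multiply along a word and stay under control if the
  successive intervals are disjoint. This serves for the gaps of a minimal set and again for the
  fundamental domains in Kopell's lemma. Nothing is known above scale \<open>e\<close>, so gaps can
  be followed only while they remain small.

  The germ argument opposes two growth rates: \<open>a ^^ n\<close> and \<open>b ^^ n\<close>
  displace points by a number of iterates of \<open>c\<close> linear in \<open>n\<close>, whereas
  exchanging them costs \<open>c ^^ (n * n)\<close>. It requires \<open>a\<close> and
  \<open>b\<close> to fix the left end of an interval free of fixed points of \<open>c\<close>;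
  Kopell's lemma is what forces this. Since \<open>K\<close> is disconnected, intermediate value
  arguments are replaced by suprema and monotonicity.\<close>

text \<open>These two notions only refer to the points of \<open>K\<close>, so that the local extensions can be
  forgotten once they are established.\<close>

definition bounded_distortion :: "real set \<Rightarrow> real \<Rightarrow> real \<Rightarrow> (real \<Rightarrow> real) \<Rightarrow> bool" where
  "bounded_distortion K e L f \<longleftrightarrow>
     (\<forall>s t. t - s \<le> e \<longrightarrow> (\<forall>x\<in>K \<inter> {s..t}. \<forall>y\<in>K \<inter> {s..t}. \<forall>u\<in>K \<inter> {s..t}. \<forall>v\<in>K \<inter> {s..t}.
        \<bar>f x - f y\<bar> * \<bar>u - v\<bar> \<le> exp (L * (t - s)) * (\<bar>f u - f v\<bar> * \<bar>x - y\<bar>)))"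

definition locally_monotone :: "real set \<Rightarrow> real \<Rightarrow> (real \<Rightarrow> real) \<Rightarrow> bool" where
  "locally_monotone K e f \<longleftrightarrow>
     (\<forall>s t. t - s \<le> e \<longrightarrow> strict_mono_on (K \<inter> {s..t}) f \<or> strict_antimono_on (K \<inter> {s..t}) f)"

lemma bounded_distortionD:
  assumes "bounded_distortion K e L f" "t - s \<le> e"
    and "x \<in> K" "y \<in> K" "u \<in> K" "v \<in> K" "x \<in> {s..t}" "y \<in> {s..t}" "u \<in> {s..t}" "v \<in> {s..t}"
  shows "\<bar>f x - f y\<bar> * \<bar>u - v\<bar> \<le> exp (L * (t - s)) * (\<bar>f u - f v\<bar> * \<bar>x - y\<bar>)"
  using assms unfolding bounded_distortion_def by blast

lemma bounded_distortion_mono: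
  assumes "bounded_distortion K e L f" "e' \<le> e" "L \<le> L'" "M \<subseteq> K"
  shows "bounded_distortion M e' L' f"
  unfolding bounded_distortion_def
proof (intro allI impI ballI)
  fix s t x y u v assume st: "t - s \<le> e'"
    and pts: "x \<in> M \<inter> {s..t}" "y \<in> M \<inter> {s..t}" "u \<in> M \<inter> {s..t}" "v \<in> M \<inter> {s..t}"
  have "\<bar>f x - f y\<bar> * \<bar>u - v\<bar> \<le> exp (L * (t - s)) * (\<bar>f u - f v\<bar> * \<bar>x - y\<bar>)"
    by (rule bounded_distortionD[OF assms(1)]) (use st pts assms in auto)
  also have "\<dots> \<le> exp (L' * (t - s)) * (\<bar>f u - f v\<bar> * \<bar>x - y\<bar>)"
    using pts assms(3) by (intro mult_right_mono) (auto intro: mult_right_mono)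
  finally show "\<bar>f x - f y\<bar> * \<bar>u - v\<bar> \<le> exp (L' * (t - s)) * (\<bar>f u - f v\<bar> * \<bar>x - y\<bar>)" .
qed

lemma locally_monotone_mono:
  assumes "locally_monotone K e f" "e' \<le> e" "M \<subseteq> K"
  shows "locally_monotone M e' f"
  unfolding locally_monotone_def
proof (intro allI impI)
  fix s t assume "t - s \<le> e'"
  hence "strict_mono_on (K \<inter> {s..t}) f \<or> strict_antimono_on (K \<inter> {s..t}) f"
    using assms unfolding locally_monotone_def by force
  moreover have "M \<inter> {s..t} \<subseteq> K \<inter> {s..t}" using assms by auto
  ultimately show "strict_mono_on (M \<inter> {s..t}) f \<or> strict_antimono_on (M \<inter> {s..t}) f"
    using monotone_on_subset by blast
qed

lemma C1_diffeomorphism_monotone: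
  fixes h :: "real \<Rightarrow> real"
  assumes I: "is_interval I" and h: "C1_diffeomorphism I (h ` I) h"
  shows "strict_mono_on I h \<or> strict_antimono_on I h"
proof -
  note D = C1_diffeomorphismD[OF h]
  have "continuous_on I h"
    using D(6) by (meson DERIV_isCont continuous_at_imp_continuous_on)
  thus ?thesis using injective_eq_monotone_map[OF I] D(4) by auto
qed

text \<open>By the mean value theorem both difference quotients are derivatives at points of
  \<open>{s..t}\<close>, and their logarithms differ by at most \<open>L * (t - s)\<close>. The
  cross-multiplied form also covers equal points.\<close>

lemma C1_diffeomorphism_distortion:
  fixes h :: "real \<Rightarrow> real"
  assumes h: "C1_diffeomorphism I (h ` I) h"
    and L: "L-lipschitz_on I (\<lambda>t. ln \<bar>deriv h t\<bar>)"
    and st: "{s..t} \<subseteq> I"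
    and pts: "x \<in> {s..t}" "y \<in> {s..t}" "u \<in> {s..t}" "v \<in> {s..t}"
  shows "\<bar>h x - h y\<bar> * \<bar>u - v\<bar> \<le> exp (L * (t - s)) * (\<bar>h u - h v\<bar> * \<bar>x - y\<bar>)"
proof -
  note D = C1_diffeomorphismD[OF h]
  have slope: "\<exists>z\<in>{s..t}. \<bar>h a - h b\<bar> = \<bar>deriv h z\<bar> * \<bar>a - b\<bar>" if "a \<in> {s..t}" "b \<in> {s..t}" for a b
  proof -
    have *: "\<exists>z\<in>{s..t}. \<bar>h a - h b\<bar> = \<bar>deriv h z\<bar> * \<bar>a - b\<bar>"
      if ab: "a < b" "a \<in> {s..t}" "b \<in> {s..t}" for a b
    proof -
      have "\<exists>z. z > a \<and> z < b \<and> h b - h a = (b - a) * deriv h z"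
        by (rule MVT2[OF ab(1)]) (use ab st in \<open>auto intro!: D(6)\<close>)
      then obtain z where "z > a" "z < b" "h b - h a = (b - a) * deriv h z" by blast
      thus ?thesis using ab
        by (intro bexI[of _ z]) (auto simp: abs_mult abs_minus_commute[of "h a"] abs_minus_commute[of a])
    qed
    consider "a < b" | "a = b" | "b < a" by linarith
    thus ?thesis
    proof cases
      case 1 thus ?thesis using * that by blast
    next
      case 2 thus ?thesis using that by auto
    next
      case 3 thus ?thesis using *[of b a] that by (simp add: abs_minus_commute)
    qed
  qed
  obtain z w where z: "z \<in> {s..t}" "\<bar>h x - h y\<bar> = \<bar>deriv h z\<bar> * \<bar>x - y\<bar>"
    and w: "w \<in> {s..t}" "\<bar>h u - h v\<bar> = \<bar>deriv h w\<bar> * \<bar>u - v\<bar>"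
    using slope pts by meson
  have nz: "\<bar>deriv h z\<bar> > 0" "\<bar>deriv h w\<bar> > 0" using D(7) z w st by auto
  have L0: "L \<ge> 0" using L by (simp add: lipschitz_on_def)
  have "dist (ln \<bar>deriv h z\<bar>) (ln \<bar>deriv h w\<bar>) \<le> L * dist z w"
    by (rule lipschitz_onD[OF L]) (use z w st in auto)
  also have "\<dots> \<le> L * (t - s)"
    using z w L0 by (intro mult_left_mono) (auto simp: dist_real_def)
  finally have "ln \<bar>deriv h z\<bar> \<le> L * (t - s) + ln \<bar>deriv h w\<bar>" by (simp add: dist_real_def)
  hence "\<bar>deriv h z\<bar> \<le> exp (L * (t - s)) * \<bar>deriv h w\<bar>"
    using nz by (metis exp_add exp_le_cancel_iff exp_ln)
  hence "\<bar>deriv h z\<bar> * (\<bar>x - y\<bar> * \<bar>u - v\<bar>) \<le> exp (L * (t - s)) * \<bar>deriv h w\<bar> * (\<bar>x - y\<bar> * \<bar>u - v\<bar>)"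
    by (intro mult_right_mono) auto
  thus ?thesis unfolding z(2) w(2) by (simp add: mult_ac)
qed

text \<open>A finite subcover by charts has a largest Lipschitz constant, and its Lebesgue number
  \<open>e\<close> ensures that an interval of length at most \<open>e/2\<close> that meets
  \<open>K\<close> lies in a single chart.\<close>

lemma Diff_1Lip_bounded_distortion:
  assumes K: "compact K" and f: "f \<in> Diff_1Lip K"
  shows "\<exists>e>0. \<exists>L. bounded_distortion K e L f \<and> locally_monotone K e f"
proof -
  have "\<forall>x. \<exists>(I::real set) (h::real \<Rightarrow> real) L. x \<in> K \<longrightarrow> open I \<and> is_interval I \<and> x \<in> I \<and> C1_diffeomorphism I (h ` I) h \<and>
        L-lipschitz_on I (\<lambda>t. ln \<bar>deriv h t\<bar>) \<and> (\<forall>t \<in> I \<inter> K. h t = f t)"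
    using f unfolding Diff_1Lip_def mem_Collect_eq by blast
  from this[unfolded choice_iff] obtain I :: "real \<Rightarrow> real set" and h :: "real \<Rightarrow> real \<Rightarrow> real" and L :: "real \<Rightarrow> real"
    where ch: "\<And>x. x \<in> K \<Longrightarrow> open (I x) \<and> is_interval (I x) \<and> x \<in> I x \<and>
      C1_diffeomorphism (I x) (h x ` I x) (h x) \<and>
      (L x)-lipschitz_on (I x) (\<lambda>t. ln \<bar>deriv (h x) t\<bar>) \<and> (\<forall>t \<in> I x \<inter> K. h x t = f t)"
    by blast
  obtain F where F: "F \<subseteq> K" "finite F" "K \<subseteq> (\<Union>x\<in>F. I x)"
    using compactE_image[OF K, of K I] ch by blast
  show ?thesis
  proof (cases "K = {}")
    case True
    thus ?thesis by (intro exI[of _ 1]) (auto simp: bounded_distortion_def locally_monotone_def monotone_on_def)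
  next
    case False
    obtain e where e: "e > 0" "\<And>x. x \<in> K \<Longrightarrow> \<exists>G\<in>I ` F. ball x e \<subseteq> G"
    proof (rule Heine_Borel_lemma[OF K, of "I ` F"])
      show "open G" if "G \<in> I ` F" for G using that F ch by blast
    qed (use F in auto)
    define L0 where "L0 = Max (L ` F)"
    have chart: "\<exists>z\<in>F. {s..t} \<subseteq> I z" if x: "x \<in> K" "x \<in> {s..t}" "t - s \<le> e/2" for s t x
    proof -
      obtain z where "z \<in> F" "ball x e \<subseteq> I z" using e(2)[OF x(1)] by blast
      moreover have "{s..t} \<subseteq> ball x e" using e(1) x(2,3) by (auto simp: dist_real_def)
      ultimately show ?thesis by blast
    qed
    have "bounded_distortion K (e/2) L0 f"
      unfolding bounded_distortion_def
    proof (intro allI impI ballI)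
      fix s t x y u v assume st: "t - s \<le> e/2"
        and pts: "x \<in> K \<inter> {s..t}" "y \<in> K \<inter> {s..t}" "u \<in> K \<inter> {s..t}" "v \<in> K \<inter> {s..t}"
      obtain z where z: "z \<in> F" "{s..t} \<subseteq> I z" using chart st pts by blast
      have zK: "z \<in> K" using z F by auto
      have eq: "h z w = f w" if "w \<in> K \<inter> {s..t}" for w using ch[OF zK] z that by blast
      have "\<bar>h z x - h z y\<bar> * \<bar>u - v\<bar> \<le> exp (L z * (t - s)) * (\<bar>h z u - h z v\<bar> * \<bar>x - y\<bar>)"
        by (rule C1_diffeomorphism_distortion[where I = "I z"]) (use ch[OF zK] z pts in auto)
      also have "\<dots> \<le> exp (L0 * (t - s)) * (\<bar>h z u - h z v\<bar> * \<bar>x - y\<bar>)"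
        using pts z F unfolding L0_def
        by (intro mult_right_mono) (auto intro!: mult_right_mono Max_ge)
      finally show "\<bar>f x - f y\<bar> * \<bar>u - v\<bar> \<le> exp (L0 * (t - s)) * (\<bar>f u - f v\<bar> * \<bar>x - y\<bar>)"
        using eq pts by simp
    qed
    moreover have "locally_monotone K (e/2) f"
      unfolding locally_monotone_def
    proof (intro allI impI)
      fix s t assume st: "t - s \<le> e/2"
      show "strict_mono_on (K \<inter> {s..t}) f \<or> strict_antimono_on (K \<inter> {s..t}) f"
      proof (cases "K \<inter> {s..t} = {}")
        case False
        then obtain z where z: "z \<in> F" "{s..t} \<subseteq> I z" using chart st by blast
        have zK: "z \<in> K" using z F by auto
        have eq: "h z w = f w" if "w \<in> K \<inter> {s..t}" for w using ch[OF zK] z that by blast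
        have "strict_mono_on (I z) (h z) \<or> strict_antimono_on (I z) (h z)"
          using ch[OF zK] by (intro C1_diffeomorphism_monotone) auto
        hence "strict_mono_on (K \<inter> {s..t}) (h z) \<or> strict_antimono_on (K \<inter> {s..t}) (h z)"
          using z(2) monotone_on_subset[of "I z" _ _ "h z" "K \<inter> {s..t}"] by blast
        thus ?thesis using eq by (simp add: monotone_on_def)
      qed (auto simp: monotone_on_def)
    qed
    ultimately show ?thesis using e by (intro exI[of _ "e/2"]) auto
  qed
qed

lemma Diff_1Lip_uniform_bounded_distortion:
  assumes K: "compact K" and S: "finite S" "S \<subseteq> Diff_1Lip K"
  shows "\<exists>e>0. \<exists>L\<ge>0. \<forall>f\<in>S. bounded_distortion K e L f \<and> locally_monotone K e f"
  using S
proof (induction S rule: finite_induct)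
  case (insert f S)
  then obtain e L where e: "e > 0" "L \<ge> 0" "\<forall>f\<in>S. bounded_distortion K e L f \<and> locally_monotone K e f"
    by auto
  obtain e' L' where e': "e' > 0" "bounded_distortion K e' L' f" "locally_monotone K e' f"
    using Diff_1Lip_bounded_distortion[OF K] insert by blast
  show ?case
    by (rule exI[of _ "min e e'"], rule conjI, use e e' in simp, rule exI[of _ "max L L'"])
       (use e e' in \<open>auto intro: bounded_distortion_mono locally_monotone_mono\<close>)
qed (auto intro!: exI[of _ 1])

section \<open>Contractions on an interval and Kopell's lemma\<close>

lemma funpow_in_carrier: "f ` K \<subseteq> K \<Longrightarrow> x \<in> K \<Longrightarrow> (f ^^ n) x \<in> K"
  by (induction n) auto

lemma commute_funpow:
  assumes "f ` K \<subseteq> K" "\<And>x. x \<in> K \<Longrightarrow> f (g x) = g (f x)" "x \<in> K"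
  shows "(f ^^ n) (g x) = g ((f ^^ n) x)"
  using assms funpow_in_carrier[of f K] by (induction n) auto

lemma commute_funpow_funpow:
  assumes "f ` K \<subseteq> K" "g ` K \<subseteq> K" "\<And>x. x \<in> K \<Longrightarrow> f (g x) = g (f x)" "x \<in> K"
  shows "(f ^^ n) ((g ^^ m) x) = (g ^^ m) ((f ^^ n) x)"
proof (rule commute_funpow[of f K])
  show "f ((g ^^ m) y) = (g ^^ m) (f y)" if "y \<in> K" for y
    using commute_funpow[of g K f y m] assms that by simp
qed (use assms in auto)

text \<open>Moving one \<open>a\<close> past one \<open>b\<close> costs one factor \<open>c\<close>,
  which commutes with both; there are \<open>n * m\<close> such exchanges.\<close>

lemma commutator_funpow:
  assumes maps: "a ` K \<subseteq> K" "b ` K \<subseteq> K" "c ` K \<subseteq> K"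
    and ac: "\<And>x. x \<in> K \<Longrightarrow> c (a x) = a (c x)" and bc: "\<And>x. x \<in> K \<Longrightarrow> c (b x) = b (c x)"
    and ab: "\<And>x. x \<in> K \<Longrightarrow> a (b x) = c (b (a x))" and x: "x \<in> K"
  shows "(a ^^ n) ((b ^^ m) x) = (c ^^ (n * m)) ((b ^^ m) ((a ^^ n) x))"
proof -
  note K = funpow_in_carrier[OF maps(1)] funpow_in_carrier[OF maps(2)] funpow_in_carrier[OF maps(3)]
  have aK: "y \<in> K \<Longrightarrow> a y \<in> K" "y \<in> K \<Longrightarrow> b y \<in> K" "y \<in> K \<Longrightarrow> c y \<in> K" for y using maps by auto
  have 1: "a ((b ^^ m) y) = (c ^^ m) ((b ^^ m) (a y))" if y: "y \<in> K" for y
  proof (induction m)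
    case (Suc m)
    have "a ((b ^^ Suc m) y) = c (b (a ((b ^^ m) y)))" using ab K y by simp
    also have "\<dots> = c (b ((c ^^ m) ((b ^^ m) (a y))))" using Suc by simp
    also have "b ((c ^^ m) ((b ^^ m) (a y))) = (c ^^ m) (b ((b ^^ m) (a y)))"
      using commute_funpow[of c K b "(b ^^ m) (a y)" m] maps bc K aK y by auto
    finally show ?case by simp
  qed simp
  show ?thesis
  proof (induction n)
    case (Suc n)
    have "(a ^^ Suc n) ((b ^^ m) x) = a ((c ^^ (n * m)) ((b ^^ m) ((a ^^ n) x)))" using Suc by simp
    also have "\<dots> = (c ^^ (n * m)) (a ((b ^^ m) ((a ^^ n) x)))"
      using commute_funpow[of c K a "(b ^^ m) ((a ^^ n) x)" "n * m"] maps ac K x by simp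
    also have "\<dots> = (c ^^ (n * m)) ((c ^^ m) ((b ^^ m) (a ((a ^^ n) x))))"
      using 1 K x by simp
    also have "\<dots> = (c ^^ (Suc n * m)) ((b ^^ m) ((a ^^ Suc n) x))"
      by (metis add.commute comp_apply funpow.simps(2) funpow_add mult_Suc)
    finally show ?case .
  qed simp
qed

lemma iterates_limit:
  fixes f :: "real \<Rightarrow> real"
  assumes K: "closed K" "f ` K \<subseteq> K" "continuous_on K f" and x: "x \<in> K"
    and lo: "\<And>n. lo \<le> (f ^^ n) x" and dec: "\<And>n. (f ^^ Suc n) x \<le> (f ^^ n) x"
  obtains l where "l \<in> K" "lo \<le> l" "\<And>n. l \<le> (f ^^ n) x" "f l = l" "(\<lambda>n. (f ^^ n) x) \<longlonglongrightarrow> l"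
proof -
  have dec': "decseq (\<lambda>n. (f ^^ n) x)" using dec by (intro decseq_SucI)
  obtain l where l: "(\<lambda>n. (f ^^ n) x) \<longlonglongrightarrow> l" "\<And>n. l \<le> (f ^^ n) x"
    using decseq_convergent[OF dec', of lo] lo by blast
  have "l \<in> K"
    using closed_sequentially[OF K(1) _ l(1)] funpow_in_carrier[OF K(2) x] by blast
  moreover have "lo \<le> l" using LIMSEQ_le_const[OF l(1)] lo by blast
  moreover have "(\<lambda>n. f ((f ^^ n) x)) \<longlonglongrightarrow> f l"
    by (rule continuous_on_tendsto_compose[OF K(3) l(1) \<open>l \<in> K\<close>])
       (use funpow_in_carrier[OF K(2) x] in auto)
  hence "(\<lambda>n. (f ^^ Suc n) x) \<longlonglongrightarrow> f l" by simp
  hence "f l = l" using LIMSEQ_unique LIMSEQ_Suc[OF l(1)] by blast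
  ultimately show ?thesis using that l by blast
qed

section \<open>One-sided contractions and the maps commuting with them\<close>

locale contraction =
  fixes K :: "real set" and f :: "real \<Rightarrow> real" and u v :: real
  assumes closed: "closed K" and maps: "f ` K \<subseteq> K" and cont: "continuous_on K f"
    and uK: "u \<in> K" and vK: "v \<in> K" and uv: "u < v"
    and mono: "strict_mono_on (K \<inter> {u..v}) f" and fixpoint: "f u = u"
    and less: "\<And>x. x \<in> K \<Longrightarrow> u < x \<Longrightarrow> x \<le> v \<Longrightarrow> f x < x"
begin

lemma maps_interval:
  assumes "x \<in> K" "u < x" "x \<le> v"
  shows "f x \<in> K" "u < f x" "f x < x" "f x \<le> v"
proof -
  show "f x \<in> K" "f x < x" "f x \<le> v" using assms maps less[of x] by auto
  show "u < f x" using strict_mono_onD[OF mono, of u x] assms uK fixpoint by auto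
qed

lemma iterates_interval:
  assumes "x \<in> K" "u < x" "x \<le> v"
  shows "(f ^^ n) x \<in> K" "u < (f ^^ n) x" "(f ^^ n) x \<le> v" "(f ^^ Suc n) x < (f ^^ n) x"
proof -
  have "(f ^^ n) x \<in> K \<and> u < (f ^^ n) x \<and> (f ^^ n) x \<le> v"
    using assms maps_interval by (induction n) auto
  thus "(f ^^ n) x \<in> K" "u < (f ^^ n) x" "(f ^^ n) x \<le> v" "(f ^^ Suc n) x < (f ^^ n) x"
    using maps_interval[of "(f ^^ n) x"] by auto
qed

lemma iterates_strict_antimono:
  assumes "x \<in> K" "u < x" "x \<le> v" "m < n"
  shows "(f ^^ n) x < (f ^^ m) x"
  using lift_Suc_mono_less[of "\<lambda>n. - (f ^^ n) x" m n] iterates_interval[OF assms(1-3)] assms(4) by auto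

lemma iterates_mono:
  assumes "x \<in> K" "y \<in> K" "u < x" "x \<le> y" "y \<le> v"
  shows "(f ^^ n) x \<le> (f ^^ n) y"
proof (induction n)
  case (Suc n)
  thus ?case
    using Suc iterates_interval[of x n] iterates_interval[of y n] assms
      strict_mono_on_leD[OF mono, of "(f ^^ n) x" "(f ^^ n) y"] by auto
qed (use assms in auto)

lemma iterates_tendsto:
  assumes "x \<in> K" "u < x" "x \<le> v"
  shows "(\<lambda>n. (f ^^ n) x) \<longlonglongrightarrow> u"
proof -
  obtain l where l: "l \<in> K" "u \<le> l" "\<And>n. l \<le> (f ^^ n) x" "f l = l" "(\<lambda>n. (f ^^ n) x) \<longlonglongrightarrow> l"
  proof (rule iterates_limit[OF closed maps cont assms(1), of u])
    show "u \<le> (f ^^ n) x" "(f ^^ Suc n) x \<le> (f ^^ n) x" for n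
      using iterates_interval(2,4)[OF assms, of n] by linarith+
  qed blast
  have "l \<le> v" using l(3)[of 0] assms by simp
  hence "l = u" using less[of l] l by force
  thus ?thesis using l by simp
qed

lemma fundamental_domain:
  assumes x: "x \<in> K" "u < x" "x \<le> v"
  obtains j where "(f ^^ Suc j) v < x" "x \<le> (f ^^ j) v"
proof -
  have "\<forall>\<^sub>F n in sequentially. (f ^^ n) v < x"
    using order_tendstoD(2)[OF iterates_tendsto[OF vK uv order_refl] x(2)] by simp
  then obtain n where n: "(f ^^ n) v < x" by (auto simp: eventually_sequentially)
  define m where "m = (LEAST n. (f ^^ n) v < x)"
  have m: "(f ^^ m) v < x" unfolding m_def by (rule LeastI[of _ n]) (rule n)
  moreover have "m \<noteq> 0"
  proof
    assume "m = 0" thus False using m x by simp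
  qed
  then obtain j where "m = Suc j" using not0_implies_Suc by blast
  moreover from this have "\<not> (f ^^ j) v < x" unfolding m_def by (intro not_less_Least) auto
  ultimately show ?thesis using that by simp
qed

lemma contraction_iterate: "contraction K f u ((f ^^ n) v)"
proof
  show "strict_mono_on (K \<inter> {u..(f ^^ n) v}) f"
    using iterates_interval[OF vK uv, of n] by (intro monotone_on_subset[OF mono]) auto
qed (use closed maps cont uK fixpoint iterates_interval[OF vK uv, of n] less in auto)

text \<open>The orbit of \<open>v\<close> tends to \<open>u\<close>, which \<open>g\<close> fixes,
  so for large \<open>i\<close> both \<open>g ((f ^^ i) v) < f v\<close> and
  \<open>(f ^^ i) v < g v\<close>. Commutation with \<open>f\<close> carries these two inequalities
  at \<open>v\<close> to every fundamental domain; one further power of \<open>f\<close> absorbs the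
  position of \<open>x\<close> within its domain. The last conclusion says how far \<open>g\<close>
  may push a point away from \<open>u\<close>, so that the estimate can be applied
  repeatedly.\<close>

lemma centralizer_displacement:
  assumes g: "g ` K \<subseteq> K" "continuous_on K g" "g u = u"
    and w: "v \<le> w" "g v \<le> w"
    and mono_g: "strict_mono_on (K \<inter> {u..w}) g" and mono_f: "strict_mono_on (K \<inter> {u..w}) f"
    and comm: "\<And>x. x \<in> K \<Longrightarrow> f (g x) = g (f x)"
  obtains Q0 where "\<And>Q x. Q \<ge> Q0 \<Longrightarrow> x \<in> K \<Longrightarrow> u < x \<Longrightarrow> x \<le> v \<Longrightarrow> u < g x \<and> (f ^^ Q) x \<le> g x \<and> (f ^^ Q) (g x) \<le> x"
    and "\<And>Q k x. Q \<ge> Q0 \<Longrightarrow> x \<in> K \<Longrightarrow> u < x \<Longrightarrow> x \<le> (f ^^ (k + Q)) v \<Longrightarrow> g x \<le> (f ^^ k) v"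
proof -
  note it = iterates_interval[OF vK uv order_refl]
  have g_le: "g x \<le> g y" if "x \<in> K" "y \<in> K" "u \<le> x" "x \<le> y" "y \<le> v" for x y
    using strict_mono_on_leD[OF mono_g, of x y] that w by auto
  have g_gt: "u < g x" if "x \<in> K" "u < x" "x \<le> v" for x
    using strict_mono_onD[OF mono_g, of u x] that w g uK by auto
  have comm_it: "(f ^^ i) (g x) = g ((f ^^ i) x)" if "x \<in> K" for x i
    using maps comm that by (rule commute_funpow)
  have gK: "x \<in> K \<Longrightarrow> g x \<in> K" for x using g by auto
  \<comment> \<open>The point \<open>g y\<close> may exceed \<open>v\<close>, where \<open>f\<close>
    is not known to contract. Writing \<open>(f ^^ i) (g y)\<close> as \<open>g ((f ^^ i) y)\<close>
    keeps it below \<open>g v\<close>, hence in the range up to \<open>w\<close> on which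
    \<open>f\<close> is monotone.\<close>
  have f_pow: "(f ^^ i) x \<le> (f ^^ i) (g y) \<and> u \<le> (f ^^ i) x"
    if xy: "x \<in> K" "y \<in> K" "u \<le> x" "x \<le> g y" "u < y" "y \<le> v" for x y i
  proof (induction i)
    case (Suc i)
    let ?X = "(f ^^ i) x" and ?Y = "(f ^^ i) (g y)"
    have "?Y = g ((f ^^ i) y)" by (rule comm_it) fact
    also have "\<dots> \<le> g v" using iterates_interval[OF xy(2,5,6), of i] vK by (intro g_le) auto
    finally have *: "?X \<in> K \<inter> {u..w}" "?Y \<in> K \<inter> {u..w}"
      using Suc w xy funpow_in_carrier[OF maps] gK by auto
    have "f ?X \<le> f ?Y" using strict_mono_on_leD[OF mono_f *] Suc by blast
    moreover have "f u \<le> f ?X" using strict_mono_on_leD[OF mono_f, of u] * uK by auto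
    ultimately show ?case using fixpoint by simp
  qed (use that in simp)
  have "(\<lambda>i. g ((f ^^ i) v)) \<longlonglongrightarrow> g u"
    by (rule continuous_on_tendsto_compose[OF g(2) iterates_tendsto[OF vK uv order_refl]]) (use uK it in auto)
  hence "\<forall>\<^sub>F i in sequentially. g ((f ^^ i) v) < f v"
    using order_tendstoD(2)[of _ u] maps_interval[OF vK uv order_refl] g(3) by auto
  moreover have "\<forall>\<^sub>F i in sequentially. (f ^^ i) v < g v"
    using order_tendstoD(2)[OF iterates_tendsto[OF vK uv order_refl]] g_gt[OF vK uv order_refl] by auto
  ultimately have "\<forall>\<^sub>F i in sequentially. g ((f ^^ i) v) < f v \<and> (f ^^ i) v < g v"
    by (rule eventually_conj)
  then obtain Q1 where Q1: "\<And>i. i \<ge> Q1 \<Longrightarrow> g ((f ^^ i) v) < f v" "\<And>i. i \<ge> Q1 \<Longrightarrow> (f ^^ i) v < g v"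
    unfolding eventually_sequentially by blast
  show ?thesis
  proof
    fix Q x assume Q: "Suc Q1 \<le> Q" and x: "x \<in> K" "u < x" "x \<le> v"
    obtain j where j: "(f ^^ Suc j) v < x" "x \<le> (f ^^ j) v" using fundamental_domain[OF x] .
    obtain Q' where Q': "Q = Suc Q'" "Q1 \<le> Q'" using Q by (cases Q) auto
    have "(f ^^ Q) x \<le> (f ^^ Q) ((f ^^ j) v)"
      using iterates_mono[of x "(f ^^ j) v"] x j it by auto
    also have "\<dots> = (f ^^ Suc j) ((f ^^ Q') v)"
      unfolding Q'(1) by (metis add.commute add_Suc add_Suc_right comp_apply funpow_add)
    also have "\<dots> \<le> (f ^^ Suc j) (g v)"
      using f_pow[of "(f ^^ Q') v" v "Suc j"] it[of Q'] Q1(2)[OF Q'(2)] vK uv by simp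
    also have "\<dots> = g ((f ^^ Suc j) v)" by (rule comm_it) (rule vK)
    also have "\<dots> \<le> g x" using j x it(1-3)[of "Suc j"] by (intro g_le) auto
    finally have 1: "(f ^^ Q) x \<le> g x" .
    have "(f ^^ Q) (g x) \<le> (f ^^ Q) (g ((f ^^ j) v))"
      using f_pow[of "g x" "(f ^^ j) v" Q] g_le[of x "(f ^^ j) v"] g_gt[OF x] x j it[of j] gK by auto
    also have "\<dots> = g ((f ^^ Q) ((f ^^ j) v))" by (rule comm_it[OF it(1)])
    also have "(f ^^ Q) ((f ^^ j) v) = (f ^^ j) ((f ^^ Q) v)"
      by (metis add.commute comp_apply funpow_add)
    also have "g ((f ^^ j) ((f ^^ Q) v)) = (f ^^ j) (g ((f ^^ Q) v))"
      by (rule comm_it[OF it(1), symmetric])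
    also have "\<dots> \<le> (f ^^ j) (f v)"
    proof (rule iterates_mono)
      show "g ((f ^^ Q) v) \<in> K" "f v \<in> K" "u < g ((f ^^ Q) v)" "f v \<le> v"
        using it gK g_gt maps_interval[OF vK uv order_refl] by auto
      show "g ((f ^^ Q) v) \<le> f v" using Q1(1)[of Q] Q by auto
    qed
    also have "\<dots> = (f ^^ Suc j) v" by (simp add: funpow_swap1)
    also have "\<dots> < x" by fact
    finally have 2: "(f ^^ Q) (g x) \<le> x" by simp
    show "u < g x \<and> (f ^^ Q) x \<le> g x \<and> (f ^^ Q) (g x) \<le> x" using 1 2 g_gt x by blast
  next
    fix Q k x assume Q: "Suc Q1 \<le> Q" and x: "x \<in> K" "u < x" "x \<le> (f ^^ (k + Q)) v"
    have "g x \<le> g ((f ^^ (k + Q)) v)" using x it[of "k + Q"] by (intro g_le) auto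
    also have "\<dots> = (f ^^ k) (g ((f ^^ Q) v))" using comm_it[OF it(1), of k Q] by (simp add: funpow_add)
    also have "\<dots> \<le> (f ^^ k) v"
    proof (rule iterates_mono)
      show "g ((f ^^ Q) v) \<in> K" "u < g ((f ^^ Q) v)" using it gK g_gt by auto
      show "g ((f ^^ Q) v) \<le> v" using Q1(1)[of Q] Q maps_interval[OF vK uv order_refl] by simp
    qed (use vK in auto)
    finally show "g x \<le> (f ^^ k) v" .
  qed
qed

text \<open>Since \<open>a\<close> and \<open>b\<close> move points at most as far as \<open>f ^^ Q\<close>, the word \<open>a ^^ n \<circ> b ^^ n\<close>
  moves them at most as far as \<open>f ^^ (2 * n * Q)\<close>, whereas \<open>a ^^ n \<circ> b ^^ n\<close> and
  \<open>b ^^ n \<circ> a ^^ n\<close> differ by \<open>f ^^ n\<^sup>2\<close>.\<close>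

lemma not_central_commutator:
  assumes a: "a ` K \<subseteq> K" "continuous_on K a" "a u = u" "a v \<le> w" "strict_mono_on (K \<inter> {u..w}) a"
    and b: "b ` K \<subseteq> K" "continuous_on K b" "b u = u" "b v \<le> w" "strict_mono_on (K \<inter> {u..w}) b"
    and w: "v \<le> w" and mono_f: "strict_mono_on (K \<inter> {u..w}) f"
    and comm: "\<And>x. x \<in> K \<Longrightarrow> f (a x) = a (f x)" "\<And>x. x \<in> K \<Longrightarrow> f (b x) = b (f x)"
    and ab: "\<And>x. x \<in> K \<Longrightarrow> a (b x) = f (b (a x))"
  shows False
proof -
  obtain Qa where Qa:
      "\<And>Q x. Q \<ge> Qa \<Longrightarrow> x \<in> K \<Longrightarrow> u < x \<Longrightarrow> x \<le> v \<Longrightarrow> u < a x \<and> (f ^^ Q) x \<le> a x \<and> (f ^^ Q) (a x) \<le> x"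
      "\<And>Q k x. Q \<ge> Qa \<Longrightarrow> x \<in> K \<Longrightarrow> u < x \<Longrightarrow> x \<le> (f ^^ (k + Q)) v \<Longrightarrow> a x \<le> (f ^^ k) v"
    using centralizer_displacement[OF a(1-3) w a(4,5) mono_f comm(1)] by metis
  obtain Qb where Qb:
      "\<And>Q x. Q \<ge> Qb \<Longrightarrow> x \<in> K \<Longrightarrow> u < x \<Longrightarrow> x \<le> v \<Longrightarrow> u < b x \<and> (f ^^ Q) x \<le> b x \<and> (f ^^ Q) (b x) \<le> x"
      "\<And>Q k x. Q \<ge> Qb \<Longrightarrow> x \<in> K \<Longrightarrow> u < x \<Longrightarrow> x \<le> (f ^^ (k + Q)) v \<Longrightarrow> b x \<le> (f ^^ k) v"
    using centralizer_displacement[OF b(1-3) w b(4,5) mono_f comm(2)] by metis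
  define Q where "Q = max 1 (max Qa Qb)"
  have Q: "Q \<ge> 1" "Q \<ge> Qa" "Q \<ge> Qb" unfolding Q_def by auto
  note it = iterates_interval[OF vK uv order_refl]
  \<comment> \<open>Each application of \<open>g\<close> may use up \<open>Q\<close> levels of the
    orbit of \<open>v\<close>; the assumption on \<open>y\<close> reserves \<open>i * Q\<close> of
    them, and \<open>k\<close> levels remain for the word applied afterwards.\<close>
  have pow: "(g ^^ i) y \<in> K \<and> u < (g ^^ i) y \<and> (g ^^ i) y \<le> (f ^^ k) v \<and>
      (f ^^ (i * Q)) y \<le> (g ^^ i) y \<and> (f ^^ (i * Q)) ((g ^^ i) y) \<le> y"
    if y: "y \<in> K" "u < y" "y \<le> (f ^^ (k + i * Q)) v" and g: "g \<in> {a, b}" for g y i k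
    using y(3)
  proof (induction i arbitrary: k)
    case 0 thus ?case using y by simp
  next
    case (Suc i)
    let ?y = "(g ^^ i) y"
    have IH: "?y \<in> K" "u < ?y" "?y \<le> (f ^^ (k + Q)) v" "(f ^^ (i * Q)) y \<le> ?y" "(f ^^ (i * Q)) ?y \<le> y"
      using Suc.IH[of "k + Q"] Suc.prems by (auto simp: algebra_simps)
    have yv: "?y \<le> v" "y \<le> v" using IH(3) it(3)[of "k + Q"] Suc.prems it(3)[of "k + Suc i * Q"] by linarith+
    have g1: "u < g ?y" "(f ^^ Q) ?y \<le> g ?y" "(f ^^ Q) (g ?y) \<le> ?y"
      using g Qa(1)[OF Q(2) IH(1,2) yv(1)] Qb(1)[OF Q(3) IH(1,2) yv(1)] by auto
    have g2: "g ?y \<le> (f ^^ k) v"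
      using g Qa(2)[OF Q(2) IH(1-3)] Qb(2)[OF Q(3) IH(1-3)] by auto
    have gK: "g ?y \<in> K" using g a(1) b(1) IH(1) by auto
    have "(f ^^ (Suc i * Q)) y = (f ^^ Q) ((f ^^ (i * Q)) y)" by (simp add: funpow_add)
    also have "\<dots> \<le> (f ^^ Q) ?y"
      using iterates_interval[OF y(1,2) yv(2), of "i * Q"] IH yv by (intro iterates_mono) auto
    also have "\<dots> \<le> g ?y" by fact
    finally have 1: "(f ^^ (Suc i * Q)) y \<le> g ?y" .
    have gv: "g ?y \<le> v" using g2 it(3)[of k] by linarith
    have "(f ^^ (Suc i * Q)) (g ?y) = (f ^^ (i * Q)) ((f ^^ Q) (g ?y))" by (metis add.commute comp_apply funpow_add mult_Suc)
    also have "\<dots> \<le> (f ^^ (i * Q)) ?y"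
      using iterates_interval[OF gK g1(1) gv, of Q] g1 IH yv by (intro iterates_mono) auto
    also have "\<dots> \<le> y" by fact
    finally have 2: "(f ^^ (Suc i * Q)) (g ?y) \<le> y" .
    show ?case using 1 2 g1 g2 gK by simp
  qed
  \<comment> \<open>Below, \<open>(f ^^ (2 * n * Q)) y\<close> is bounded by
    \<open>(f ^^ (n * n)) ?z\<close>, and \<open>(f ^^ (2 * n * Q)) ?z\<close> by \<open>y\<close>.
    So a contradiction arises once \<open>n * n\<close> exceeds \<open>4 * n * Q\<close>. With
    \<open>n = 5 * Q\<close> the two sides are 25 and 20 times \<open>Q * Q\<close>, which leaves 15
    against 10 after the second bound is used.\<close>
  define n where "n = 5 * Q"
  \<comment> \<open>Starting this deep in the orbit of \<open>v\<close> leaves room for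
    \<open>2 * n\<close> letters \<open>a\<close> and \<open>b\<close> without passing
    \<open>v\<close>.\<close>
  define y where "y = (f ^^ (n * Q + n * Q)) v"
  have y: "y \<in> K" "u < y" "y \<le> v" "y \<le> (f ^^ (n * Q + n * Q)) v" unfolding y_def using it by auto
  have yb: "(b ^^ n) y \<in> K" "u < (b ^^ n) y" "(b ^^ n) y \<le> (f ^^ (0 + n * Q)) v" "(f ^^ (n * Q)) y \<le> (b ^^ n) y"
    using pow[OF y(1,2,4), of b] by auto
  have yab: "(f ^^ (n * Q)) ((b ^^ n) y) \<le> (a ^^ n) ((b ^^ n) y)"
    using pow[OF yb(1-3), of a] by auto
  have ya: "(a ^^ n) y \<in> K" "u < (a ^^ n) y" "(a ^^ n) y \<le> (f ^^ (0 + n * Q)) v" "(f ^^ (n * Q)) ((a ^^ n) y) \<le> y"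
    using pow[OF y(1,2,4), of a] by auto
  let ?z = "(b ^^ n) ((a ^^ n) y)"
  have yba: "?z \<in> K" "u < ?z" "?z \<le> v" "(f ^^ (n * Q)) ?z \<le> (a ^^ n) y"
    using pow[OF ya(1-3), of b] by auto
  have av: "(a ^^ n) y \<le> v" "(b ^^ n) y \<le> v" using ya(3) yb(3) it(3)[of "0 + n * Q"] by linarith+
  have "(f ^^ (n * Q + n * Q)) ?z = (f ^^ (n * Q)) ((f ^^ (n * Q)) ?z)" by (simp add: funpow_add)
  also have "\<dots> \<le> (f ^^ (n * Q)) ((a ^^ n) y)"
    using iterates_interval[OF yba(1-3), of "n * Q"] yba ya av by (intro iterates_mono) auto
  also have "\<dots> \<le> y" by fact
  finally have z: "(f ^^ (n * Q + n * Q)) ?z \<le> y" .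
  have "(f ^^ (n * Q + n * Q)) y = (f ^^ (n * Q)) ((f ^^ (n * Q)) y)" by (simp add: funpow_add)
  also have "\<dots> \<le> (f ^^ (n * Q)) ((b ^^ n) y)"
    using iterates_interval[OF y(1-3), of "n * Q"] yb av by (intro iterates_mono) auto
  also have "\<dots> \<le> (a ^^ n) ((b ^^ n) y)" by fact
  also have "\<dots> = (f ^^ (n * n)) ?z"
    by (rule commutator_funpow[OF a(1) b(1) maps comm ab y(1)])
  also have "n * n = 15 * Q * Q + (n * Q + n * Q)" by (simp add: n_def)
  also have "(f ^^ (15 * Q * Q + (n * Q + n * Q))) ?z = (f ^^ (15 * Q * Q)) ((f ^^ (n * Q + n * Q)) ?z)"
    by (simp only: funpow_add comp_apply)
  also have "\<dots> \<le> (f ^^ (15 * Q * Q)) y"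
    using iterates_interval[OF yba(1-3), of "n * Q + n * Q"] z y by (intro iterates_mono) auto
  also have "\<dots> < (f ^^ (n * Q + n * Q)) y"
    using Q(1) by (intro iterates_strict_antimono y) (simp add: n_def)
  finally show False by simp
qed

end

section \<open>Distortion of iterates and Kopell's lemma\<close>

context contraction
begin

text \<open>The intervals from \<open>(f ^^ Suc n) v\<close> to \<open>(f ^^ n) v\<close> are
  consecutive, so the product of the one-step constants telescopes to
  \<open>exp (L * (v - (f ^^ n) v))\<close>, which is bounded independently of
  \<open>n\<close>.\<close>

lemma iterates_bounded_distortion:
  assumes dist: "bounded_distortion K e L f" and e: "v - u \<le> e" and L: "L \<ge> 0"
    and pts: "x \<in> K \<inter> {f v..v}" "y \<in> K \<inter> {f v..v}" "x' \<in> K \<inter> {f v..v}" "y' \<in> K \<inter> {f v..v}"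
  shows "\<bar>(f ^^ n) x - (f ^^ n) y\<bar> * \<bar>x' - y'\<bar>
          \<le> exp (L * (v - u)) * (\<bar>(f ^^ n) x' - (f ^^ n) y'\<bar> * \<bar>x - y\<bar>)"
proof -
  have fv: "u < f v" "f v \<in> K" "f v \<le> v" using maps_interval[OF vK uv order_refl] by auto
  note it = iterates_interval[OF vK uv order_refl]
  have range: "(f ^^ n) w \<in> K" "(f ^^ n) w \<in> {(f ^^ Suc n) v..(f ^^ n) v}" if "w \<in> K \<inter> {f v..v}" for w n
  proof -
    show "(f ^^ n) w \<in> K" using that maps by (intro funpow_in_carrier) auto
    have "(f ^^ n) (f v) \<le> (f ^^ n) w" "(f ^^ n) w \<le> (f ^^ n) v"
      using that fv vK by (auto intro!: iterates_mono)
    thus "(f ^^ n) w \<in> {(f ^^ Suc n) v..(f ^^ n) v}" by (simp add: funpow_swap1)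
  qed
  have "\<bar>(f ^^ n) x - (f ^^ n) y\<bar> * \<bar>x' - y'\<bar>
          \<le> exp (L * (v - (f ^^ n) v)) * (\<bar>(f ^^ n) x' - (f ^^ n) y'\<bar> * \<bar>x - y\<bar>)"
  proof (induction n)
    case (Suc n)
    define Y W Y' W' where defs: "Y = \<bar>(f ^^ n) x - (f ^^ n) y\<bar>" "W = \<bar>(f ^^ n) x' - (f ^^ n) y'\<bar>"
      "Y' = \<bar>(f ^^ Suc n) x - (f ^^ Suc n) y\<bar>" "W' = \<bar>(f ^^ Suc n) x' - (f ^^ Suc n) y'\<bar>"
    define d where "d = (f ^^ n) v - (f ^^ Suc n) v"
    have step: "Y' * W \<le> exp (L * d) * (W' * Y)"
      unfolding defs d_def funpow.simps comp_apply
      by (rule bounded_distortionD[OF dist])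
         (use range(1)[OF pts(1), of n] range(1)[OF pts(2), of n] range(1)[OF pts(3), of n] range(1)[OF pts(4), of n]
              range(2)[OF pts(1), of n] range(2)[OF pts(2), of n] range(2)[OF pts(3), of n] range(2)[OF pts(4), of n]
              it[of n] it[of "Suc n"] e in auto)
    have nonneg: "W \<ge> 0" "Y' \<ge> 0" "W' \<ge> 0" "Y \<ge> 0" unfolding defs by auto
    have "Y' * \<bar>x' - y'\<bar> \<le> exp (L * (v - (f ^^ Suc n) v)) * (W' * \<bar>x - y\<bar>)"
    proof (cases "W = 0")
      \<comment> \<open>The other case divides by \<open>W\<close>. As the iterates are injective on
        the fundamental domain, \<open>W\<close> vanishes only for \<open>x' = y'\<close>.\<close>
      case True
      have "x' = y'"
      proof (rule ccontr)
        have lt: "(f ^^ n) w < (f ^^ n) w'" if "w \<in> K \<inter> {f v..v}" "w' \<in> K \<inter> {f v..v}" "w < w'" for w w'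
        proof (induction n)
          case (Suc n)
          thus ?case
            using strict_mono_onD[OF mono, of "(f ^^ n) w" "(f ^^ n) w'"] that fv
              iterates_interval[of w n] iterates_interval[of w' n] by auto
        qed (use that in simp)
        assume "x' \<noteq> y'"
        hence "x' < y' \<or> y' < x'" by linarith
        thus False using lt[OF pts(3,4)] lt[OF pts(4,3)] True unfolding defs by auto
      qed
      thus ?thesis using nonneg by simp
    next
      case False
      hence W: "W > 0" using nonneg by simp
      have "(Y' * \<bar>x' - y'\<bar>) * W = (Y' * W) * \<bar>x' - y'\<bar>" by simp
      also have "\<dots> \<le> exp (L * d) * (W' * Y) * \<bar>x' - y'\<bar>"
        by (intro mult_right_mono step) auto
      also have "\<dots> = exp (L * d) * W' * (Y * \<bar>x' - y'\<bar>)" by simp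
      also have "\<dots> \<le> exp (L * d) * W' * (exp (L * (v - (f ^^ n) v)) * (W * \<bar>x - y\<bar>))"
        using Suc.IH nonneg unfolding defs(1,2)[symmetric] by (intro mult_left_mono) auto
      also have "\<dots> = (exp (L * d) * exp (L * (v - (f ^^ n) v)) * (W' * \<bar>x - y\<bar>)) * W" by simp
      also have "exp (L * d) * exp (L * (v - (f ^^ n) v)) = exp (L * (v - (f ^^ Suc n) v))"
        unfolding exp_add[symmetric] d_def by (simp add: algebra_simps)
      finally show ?thesis using W by simp
    qed
    thus ?case unfolding defs .
  qed simp
  also have "\<dots> \<le> exp (L * (v - u)) * (\<bar>(f ^^ n) x' - (f ^^ n) y'\<bar> * \<bar>x - y\<bar>)"
    using it[of n] L by (intro mult_right_mono) (auto intro: mult_left_mono)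
  finally show ?thesis .
qed

text \<open>Transporting \<open>x\<close> and \<open>g x\<close> close to \<open>u\<close> by iterates of \<open>f\<close>, where the slope of \<open>g\<close> is
  almost 1, shows that the iterates of \<open>g\<close> cannot bring the consecutive points of the monotone
  bounded orbit of \<open>x\<close> together.\<close>

lemma Kopell_fundamental_domain:
  assumes dist: "bounded_distortion K e L f" "bounded_distortion K e L g" and e: "v - u \<le> e" and L: "L \<ge> 0"
    and g: "g ` K \<subseteq> K" "continuous_on K g" "strict_mono_on (K \<inter> {u..v}) g" "g v = v"
    and comm: "\<And>x. x \<in> K \<Longrightarrow> f (g x) = g (f x)"
    and x: "x \<in> K" "f v \<le> x" "x \<le> v"
  shows "g x = x"
proof -
  have fv: "u < f v" "f v \<in> K" "f v < v" "f v \<le> v" using maps_interval[OF vK uv order_refl] by auto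
  note it = iterates_interval[OF vK uv order_refl]
  have lim: "(\<lambda>n. (f ^^ n) v) \<longlonglongrightarrow> u" by (rule iterates_tendsto[OF vK uv order_refl])
  have gfix: "g ((f ^^ n) v) = (f ^^ n) v" for n
    using commute_funpow[of f K g v n, OF maps comm vK] g(4) by simp
  have "(\<lambda>n. g ((f ^^ n) v)) \<longlonglongrightarrow> g u"
    by (rule continuous_on_tendsto_compose[OF g(2) lim]) (use uK it in auto)
  hence gu: "g u = u" using LIMSEQ_unique lim unfolding gfix by blast
  have inv: "(g ^^ j) y \<in> K \<inter> {lo..hi}"
    if "y \<in> K \<inter> {lo..hi}" "lo \<in> K \<inter> {u..v}" "hi \<in> K \<inter> {u..v}" "g lo = lo" "g hi = hi" for lo hi y j
  proof (induction j)
    case (Suc j)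
    thus ?case
      using strict_mono_on_leD[OF g(3), of lo "(g ^^ j) y"] strict_mono_on_leD[OF g(3), of "(g ^^ j) y" hi]
        that g(1) by auto
  qed (use that in simp)
  define X where "X j = (g ^^ j) x" for j
  have X: "X j \<in> K \<inter> {f v..v}" for j
    unfolding X_def using inv[of x "f v" v j] x fv vK uv gfix[of 1] gfix[of 0] by auto
  define C where "C = exp (L * (v - u))"
  have C: "C > 0" unfolding C_def by simp
  \<comment> \<open>The constant must not depend on \<open>j\<close>. For each \<open>j\<close> the
    depth \<open>n\<close> is chosen so large that the slope defect \<open>E\<close> of
    \<open>g\<close> near \<open>u\<close> satisfies \<open>E ^ j < 2\<close>. One factor
    \<open>C\<close> pays for going down by \<open>f ^^ n\<close>, the other for coming
    back.\<close>
  have lower: "\<bar>X 0 - X 1\<bar> \<le> 2 * C\<^sup>2 * \<bar>X j - X (Suc j)\<bar>" for j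
  proof -
    have "(\<lambda>n. exp (L * ((f ^^ n) v - u)) ^ j) \<longlonglongrightarrow> exp (L * (u - u)) ^ j"
      by (intro tendsto_intros lim)
    hence "\<forall>\<^sub>F n in sequentially. exp (L * ((f ^^ n) v - u)) ^ j < 2"
      by (intro order_tendstoD(2)[of _ 1]) auto
    then obtain n where n: "exp (L * ((f ^^ n) v - u)) ^ j < 2" by (auto simp: eventually_sequentially)
    define t where "t = (f ^^ n) v"
    have t: "t \<in> K" "u < t" "t \<le> v" "g t = t" unfolding t_def using it gfix by auto
    define E where "E = exp (L * (t - u))"
    have E: "E > 0" "E ^ j < 2" using n unfolding E_def t_def by auto
    \<comment> \<open>Since \<open>g\<close> fixes \<open>u\<close> and \<open>t\<close>, its mean
      slope between them is 1, so bounded distortion makes every slope of \<open>g\<close> on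
      \<open>K\<close> between them at least \<open>1 / E\<close>.\<close>
    have near: "\<bar>y - y'\<bar> \<le> E * \<bar>g y - g y'\<bar>" if "y \<in> K \<inter> {u..t}" "y' \<in> K \<inter> {u..t}" for y y'
    proof -
      have "\<bar>g t - g u\<bar> * \<bar>y - y'\<bar> \<le> E * (\<bar>g y - g y'\<bar> * \<bar>t - u\<bar>)"
        unfolding E_def by (rule bounded_distortionD[OF dist(2)]) (use that t uK e in auto)
      hence "(t - u) * \<bar>y - y'\<bar> \<le> (t - u) * (E * \<bar>g y - g y'\<bar>)" using t gu by (simp add: mult_ac)
      thus ?thesis using t by simp
    qed
    have near_it: "\<bar>y - y'\<bar> \<le> E ^ i * \<bar>(g ^^ i) y - (g ^^ i) y'\<bar>"
      if y: "y \<in> K \<inter> {u..t}" "y' \<in> K \<inter> {u..t}" for y y' i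
    proof (induction i)
      case (Suc i)
      have in_ut: "(g ^^ i) y \<in> K \<inter> {u..t}" "(g ^^ i) y' \<in> K \<inter> {u..t}"
        using inv[of _ u t i] y t uK gu by auto
      note Suc.IH
      also have "E ^ i * \<bar>(g ^^ i) y - (g ^^ i) y'\<bar> \<le> E ^ i * (E * \<bar>g ((g ^^ i) y) - g ((g ^^ i) y')\<bar>)"
        using near[OF in_ut] E by (intro mult_left_mono) auto
      finally show ?case by (simp add: mult_ac)
    qed simp
    define A B where "A = \<bar>(f ^^ n) v - (f ^^ n) (f v)\<bar>" and "B = \<bar>v - f v\<bar>"
    have AB: "A > 0" "B > 0"
      using it(4)[of n] fv unfolding A_def B_def by (auto simp: funpow_swap1)
    have fn: "(f ^^ n) y \<in> K \<inter> {u..t}" if "y \<in> K \<inter> {f v..v}" for y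
      using that iterates_interval(1,2)[of y n] iterates_mono[of y v n] fv vK unfolding t_def by auto
    have vv: "v \<in> K \<inter> {f v..v}" "f v \<in> K \<inter> {f v..v}" using fv vK by auto
    have gf: "(g ^^ j) ((f ^^ n) y) = (f ^^ n) ((g ^^ j) y)" if "y \<in> K" for y
      using commute_funpow_funpow[of f K g y n j, OF maps g(1) comm that] by simp
    have Xj: "X (i + j) = (g ^^ j) (X i)" for i unfolding X_def by (metis add.commute comp_apply funpow_add)
    have "A * \<bar>X 0 - X 1\<bar> \<le> C * (\<bar>(f ^^ n) (X 0) - (f ^^ n) (X 1)\<bar> * B)"
      unfolding A_def B_def C_def by (rule iterates_bounded_distortion[OF dist(1) e L vv X X])
    also have "\<dots> \<le> C * ((2 * \<bar>(f ^^ n) (X j) - (f ^^ n) (X (Suc j))\<bar>) * B)"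
    proof (intro mult_left_mono mult_right_mono)
      have "\<bar>(f ^^ n) (X 0) - (f ^^ n) (X 1)\<bar> \<le> E ^ j * \<bar>(g ^^ j) ((f ^^ n) (X 0)) - (g ^^ j) ((f ^^ n) (X 1))\<bar>"
        by (rule near_it[OF fn[OF X] fn[OF X]])
      also have "\<dots> \<le> 2 * \<bar>(g ^^ j) ((f ^^ n) (X 0)) - (g ^^ j) ((f ^^ n) (X 1))\<bar>"
        using E by (intro mult_right_mono) auto
      also have "(g ^^ j) ((f ^^ n) (X 0)) = (f ^^ n) (X j)" using gf[of "X 0"] Xj[of 0] X by simp
      also have "(g ^^ j) ((f ^^ n) (X 1)) = (f ^^ n) (X (Suc j))" using gf[of "X 1"] Xj[of 1] X by simp
      finally show "\<bar>(f ^^ n) (X 0) - (f ^^ n) (X 1)\<bar> \<le> 2 * \<bar>(f ^^ n) (X j) - (f ^^ n) (X (Suc j))\<bar>" .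
    qed (use C AB in auto)
    also have "\<dots> = 2 * C * (\<bar>(f ^^ n) (X j) - (f ^^ n) (X (Suc j))\<bar> * B)" by simp
    also have "\<dots> \<le> 2 * C * (C * (A * \<bar>X j - X (Suc j)\<bar>))"
      unfolding A_def B_def using C
      by (intro mult_left_mono) (auto simp: C_def intro!: iterates_bounded_distortion[OF dist(1) e L X X vv])
    also have "\<dots> = A * (2 * C\<^sup>2 * \<bar>X j - X (Suc j)\<bar>)" by (simp add: power2_eq_square)
    finally show ?thesis using AB by simp
  qed
  have "monoseq X"
  proof (cases "g x \<le> x")
    case True
    have "X (Suc j) \<le> X j" for j
    proof (induction j)
      case (Suc j)
      thus ?case using strict_mono_on_leD[OF g(3), of "X (Suc j)" "X j"] X[of j] X[of "Suc j"] fv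
        by (auto simp: X_def)
    qed (use True in \<open>simp add: X_def\<close>)
    thus ?thesis by (simp add: monoseq_Suc)
  next
    case False
    have "X j \<le> X (Suc j)" for j
    proof (induction j)
      case (Suc j)
      thus ?case using strict_mono_on_leD[OF g(3), of "X j" "X (Suc j)"] X[of j] X[of "Suc j"] fv
        by (auto simp: X_def)
    qed (use False in \<open>simp add: X_def\<close>)
    thus ?thesis by (simp add: monoseq_Suc)
  qed
  moreover have "Bseq X"
  proof (rule BseqI')
    show "norm (X j) \<le> \<bar>f v\<bar> + \<bar>v\<bar>" for j using X[of j] by auto
  qed
  ultimately obtain l where l: "X \<longlonglongrightarrow> l"
    using Bseq_monoseq_convergent convergentD by blast
  \<comment> \<open>The bounded monotone sequence \<open>X\<close> has consecutive differences
    tending to 0, while \<open>lower\<close> bounds them below by a fixed multiple of the first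
    one.\<close>
  have "(\<lambda>j. 2 * C\<^sup>2 * \<bar>X j - X (Suc j)\<bar>) \<longlonglongrightarrow> 2 * C\<^sup>2 * \<bar>l - l\<bar>"
    by (intro tendsto_intros l LIMSEQ_Suc[OF l])
  hence "\<bar>X 0 - X 1\<bar> \<le> 2 * C\<^sup>2 * \<bar>l - l\<bar>"
    using lower by (intro LIMSEQ_le_const[of _ _ "\<bar>X 0 - X 1\<bar>"]) auto
  thus ?thesis by (simp add: X_def)
qed

text \<open>The iterate of \<open>v\<close> that bounds the fundamental domain of \<open>x\<close>
  is again fixed by \<open>g\<close>, so it can take the place of \<open>v\<close>.\<close>

lemma Kopell:
  assumes dist: "bounded_distortion K e L f" "bounded_distortion K e L g" and e: "v - u \<le> e" and L: "L \<ge> 0"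
    and g: "g ` K \<subseteq> K" "continuous_on K g" "strict_mono_on (K \<inter> {u..v}) g" "g v = v"
    and comm: "\<And>x. x \<in> K \<Longrightarrow> f (g x) = g (f x)"
    and x: "x \<in> K" "u < x" "x \<le> v"
  shows "g x = x"
proof -
  obtain j where j: "(f ^^ Suc j) v < x" "x \<le> (f ^^ j) v" using fundamental_domain[OF x] .
  note it = iterates_interval[OF vK uv order_refl, of j]
  interpret C: contraction K f u "(f ^^ j) v" by (rule contraction_iterate)
  show ?thesis
  proof (rule C.Kopell_fundamental_domain[OF dist _ L g(1,2)])
    show "strict_mono_on (K \<inter> {u..(f ^^ j) v}) g"
      using it by (intro monotone_on_subset[OF g(3)]) auto
    show "g ((f ^^ j) v) = (f ^^ j) v" using commute_funpow[of f K g v j, OF maps comm vK] g(4) by simp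
  qed (use it e comm x j in auto)
qed

end

section \<open>Commutators of germs at a common fixed point\<close>

text \<open>The maps act on all of \<open>K\<close> but are controlled only within distance
  \<open>r\<close> of \<open>p\<close>. The inverses are listed as germs of equal standing, so that
  the assumptions survive exchanging \<open>a\<close> with \<open>b\<close> and reflecting the
  line.\<close>

locale central_commutator =
  fixes K :: "real set" and p r L :: real and a a' b b' c c' :: "real \<Rightarrow> real"
  assumes closed: "closed K" and pK: "p \<in> K" and r: "0 < r" and L: "0 \<le> L"
    and germ_maps: "\<And>f. f \<in> {a, a', b, b', c, c'} \<Longrightarrow> f ` K \<subseteq> K"
    and germ_cont: "\<And>f. f \<in> {a, a', b, b', c, c'} \<Longrightarrow> continuous_on K f"
    and germ_fixpoint: "\<And>f. f \<in> {a, a', b, b', c, c'} \<Longrightarrow> f p = p"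
    and germ_mono: "\<And>f. f \<in> {a, a', b, b', c, c'} \<Longrightarrow> strict_mono_on (K \<inter> {p - r..p + r}) f"
    and germ_dist: "\<And>f. f \<in> {a, a', b, b', c, c'} \<Longrightarrow> bounded_distortion K r L f"
    and inv: "\<And>x. x \<in> K \<Longrightarrow> a (a' x) = x" "\<And>x. x \<in> K \<Longrightarrow> a' (a x) = x"
      "\<And>x. x \<in> K \<Longrightarrow> b (b' x) = x" "\<And>x. x \<in> K \<Longrightarrow> b' (b x) = x"
      "\<And>x. x \<in> K \<Longrightarrow> c (c' x) = x" "\<And>x. x \<in> K \<Longrightarrow> c' (c x) = x"
    and comm: "\<And>x. x \<in> K \<Longrightarrow> c (a x) = a (c x)" "\<And>x. x \<in> K \<Longrightarrow> c (b x) = b (c x)"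
    and ab: "\<And>x. x \<in> K \<Longrightarrow> a (b x) = c (b (a x))"
begin

definition germs :: "(real \<Rightarrow> real) set" where "germs = {a, a', b, b', c, c'}"

lemma germs [simp]: "a \<in> germs" "a' \<in> germs" "b \<in> germs" "b' \<in> germs" "c \<in> germs" "c' \<in> germs"
  and finite_germs [simp]: "finite germs"
  unfolding germs_def by auto

lemmas maps = germ_maps[folded germs_def] and cont = germ_cont[folded germs_def]
  and fixpoint = germ_fixpoint[folded germs_def] and mono = germ_mono[folded germs_def]
  and dist = germ_dist[folded germs_def]

lemma in_K: "f \<in> germs \<Longrightarrow> x \<in> K \<Longrightarrow> f x \<in> K"
  using maps by blast

lemma inv_comm: "x \<in> K \<Longrightarrow> c (a' x) = a' (c x)" "x \<in> K \<Longrightarrow> c (b' x) = b' (c x)"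
proof -
  show "c (a' x) = a' (c x)" if x: "x \<in> K"
    using inv(2)[of "c (a' x)"] comm(1)[of "a' x"] inv(1)[OF x] in_K[of c] in_K[of a'] x by simp
  show "c (b' x) = b' (c x)" if x: "x \<in> K"
    using inv(4)[of "c (b' x)"] comm(2)[of "b' x"] inv(3)[OF x] in_K[of c] in_K[of b'] x by simp
qed

text \<open>Reading the relation backwards replaces \<open>c\<close> by its inverse. This allows the
  assumption that \<open>c\<close> moves a given point to the left.\<close>

lemma swapped: "central_commutator K p r L b b' a a' c' c"
proof
  fix f assume f: "f \<in> {b, b', a, a', c', c}"
  hence f: "f \<in> germs" unfolding germs_def by auto
  show "f ` K \<subseteq> K" "continuous_on K f" "f p = p" "strict_mono_on (K \<inter> {p - r..p + r}) f"
    "bounded_distortion K r L f" by (fact maps[OF f] cont[OF f] fixpoint[OF f] mono[OF f] dist[OF f])+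
next
  fix x assume x: "x \<in> K"
  show "c' (b x) = b (c' x)"
    using inv(6)[of "b (c' x)"] comm(2)[of "c' x"] inv(5)[OF x] in_K[of b] in_K[of c'] x by simp
  show "c' (a x) = a (c' x)"
    using inv(6)[of "a (c' x)"] comm(1)[of "c' x"] inv(5)[OF x] in_K[of a] in_K[of c'] x by simp
  show "b (a x) = c' (a (b x))"
    using ab[OF x] inv(6)[of "b (a x)"] in_K[of a] in_K[of b] x by simp
qed (use closed pK r L inv in auto)

lemma mono_less:
  assumes "f \<in> germs" "x \<in> K" "y \<in> K" "p - r \<le> x" "x < y" "y \<le> p + r"
  shows "f x < f y"
  using strict_mono_onD[OF mono[OF assms(1)], of x y] assms by auto

lemma mono_le:
  assumes "f \<in> germs" "x \<in> K" "y \<in> K" "p - r \<le> x" "x \<le> y" "y \<le> p + r"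
  shows "f x \<le> f y"
  using mono_less[OF assms(1-4) _ assms(6)] assms(5) by (cases "x = y") auto

text \<open>Within distance \<open>d\<close> to the right of \<open>p\<close>, one germ may be
  applied and the monotonicity of a second one still holds at the image.\<close>

definition stays_near :: "real \<Rightarrow> bool" where
  "stays_near d \<longleftrightarrow> 0 < d \<and> d \<le> r \<and> (\<forall>f\<in>germs. \<forall>x\<in>K \<inter> {p..p + d}. f x \<in> {p..p + r})"

lemma stays_nearD:
  assumes "stays_near d" "f \<in> germs" "x \<in> K" "p \<le> x" "x \<le> p + d"
  shows "p \<le> f x" "f x \<le> p + r"
  using assms unfolding stays_near_def by (meson IntI atLeastAtMost_iff)+

lemma stays_near_exists: obtains d where "stays_near d"
proof -
  have "\<exists>d>0. \<forall>x\<in>K. \<bar>x - p\<bar> < d \<longrightarrow> \<bar>f x - p\<bar> < r" if "f \<in> germs" for f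
    using cont[OF that] pK r fixpoint[OF that] unfolding continuous_on_iff dist_real_def by metis
  then obtain d where d: "\<And>f. f \<in> germs \<Longrightarrow> d f > 0"
    "\<And>f x. f \<in> germs \<Longrightarrow> x \<in> K \<Longrightarrow> \<bar>x - p\<bar> < d f \<Longrightarrow> \<bar>f x - p\<bar> < r"
    by metis
  define d0 where "d0 = min r (Min (d ` germs) / 2)"
  have Min_pos: "Min (d ` germs) > 0"
  proof (subst Min_gr_iff)
    show "d ` germs \<noteq> {}" using germs(1) by blast
  qed (use d(1) in auto)
  have d0: "0 < d0" "d0 \<le> r" "d0 < Min (d ` germs)"
    unfolding d0_def using r Min_pos by linarith+
  have "f x \<in> {p..p + r}" if f: "f \<in> germs" and x: "x \<in> K" "p \<le> x" "x \<le> p + d0" for f x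
  proof -
    have "Min (d ` germs) \<le> d f" using f by (intro Min_le) auto
    hence "\<bar>f x - p\<bar> < r" using x d0 by (intro d(2)[OF f]) auto
    moreover have "f p \<le> f x" using x d0 pK r by (intro mono_le[OF f]) auto
    ultimately show ?thesis using fixpoint[OF f] by auto
  qed
  hence "stays_near d0" unfolding stays_near_def using d0 by auto
  thus ?thesis using that by blast
qed

text \<open>Without fixed points in between, \<open>c\<close> contracts \<open>K\<close> between
  \<open>u\<close> and \<open>x\<close> towards \<open>u\<close>, which \<open>a\<close> and
  \<open>b\<close> fix; the comparison of growth rates then excludes the commutator
  relation.\<close>

lemma no_free_contraction:
  assumes d: "stays_near d" and u: "u \<in> K" "p \<le> u" "a u = u" "b u = u" "c u = u"
    and x: "x \<in> K" "u < x" "x \<le> p + d" "c x < x"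
    and free: "\<And>y. y \<in> K \<Longrightarrow> u < y \<Longrightarrow> y \<le> x \<Longrightarrow> c y \<noteq> y"
  shows False
proof -
  have dr: "d \<le> r" using d by (simp add: stays_near_def)
  have less: "c y < y" if y: "y \<in> K" "u < y" "y \<le> x" for y
  proof (rule ccontr)
    assume *: "\<not> c y < y"
    \<comment> \<open>This replaces the intermediate value theorem. The largest point
      \<open>t\<close> of \<open>S\<close> is not fixed, so \<open>t < c t\<close>; monotonicity
      gives \<open>c t < c x < x\<close> and \<open>c t < c (c t)\<close>. Hence \<open>c t\<close>
      is a larger point of \<open>S\<close>.\<close>
    define S where "S = (K \<inter> {y..x}) \<inter> (\<lambda>z. c z - z) -` {0..}"
    have "continuous_on (K \<inter> {y..x}) c" by (rule continuous_on_subset[OF cont]) auto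
    hence "closed S" unfolding S_def
      by (intro continuous_closed_preimage continuous_intros closed_Int closed) auto
    moreover have "y \<in> S" using * y unfolding S_def by auto
    moreover have "bdd_above S" unfolding S_def by (rule bdd_aboveI[of _ x]) auto
    ultimately have "Sup S \<in> S" by (intro closed_contains_Sup) auto
    define t where "t = Sup S"
    have "t \<in> S" unfolding t_def by fact
    have t: "t \<in> K" "y \<le> t" "t \<le> x" "t \<le> c t" using \<open>t \<in> S\<close> unfolding S_def by auto
    have ct: "t < c t" using free[of t] t y by force
    have "t \<noteq> x" using ct x(4) by auto
    hence "t < x" using t by simp
    hence "c t < c x" using t x u y dr r by (intro mono_less[of c]) auto
    hence "c t \<in> K" "c t < x" using x in_K[of c] t by auto
    moreover from this have "c t < c (c t)" using t ct y x u dr r by (intro mono_less[of c]) auto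
    ultimately have "c t \<in> S" unfolding S_def using t ct by auto
    hence "c t \<le> t" unfolding t_def using \<open>bdd_above S\<close> by (intro cSup_upper)
    thus False using ct by simp
  qed
  have mono': "strict_mono_on (K \<inter> {u..w}) f" if "f \<in> germs" "w \<le> p + r" for f w
    using u r that by (intro monotone_on_subset[OF mono[OF that(1)]]) auto
  interpret C: contraction K c u x
    by unfold_locales (use closed maps cont u x less mono' dr in auto)
  show False
  proof (rule C.not_central_commutator[where a = a and b = b and w = "p + r"])
    show "a x \<le> p + r" "b x \<le> p + r" using stays_nearD[OF d] x u by auto
  qed (use maps cont u x comm ab mono' dr in auto)
qed

lemma no_free_action:
  assumes d: "stays_near d" and u: "u \<in> K" "p \<le> u" "a u = u" "b u = u" "c u = u"
    and x: "x \<in> K" "u < x" "x \<le> p + d"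
    and free: "\<And>y. y \<in> K \<Longrightarrow> u < y \<Longrightarrow> y \<le> x \<Longrightarrow> c y \<noteq> y"
  shows False
proof -
  interpret S: central_commutator K p r L b b' a a' c' c by (rule swapped)
  show False
  proof (cases "c x < x")
    case True
    thus ?thesis using no_free_contraction[OF d u x] free by blast
  next
    case False
    hence "x < c x" using free[of x] x by force
    hence "c' x < c' (c x)" using stays_nearD(2)[OF d, of c x] x u in_K[of c] r by (intro mono_less[of c']) auto
    hence "c' x < x" using inv x by simp
    moreover have "S.stays_near d" using d unfolding stays_near_def S.stays_near_def germs_def S.germs_def by auto
    moreover have "c' y \<noteq> y" if "y \<in> K" "u < y" "y \<le> x" for y
      using free[OF that] inv(5)[OF that(1)] by metis
    moreover have "c' u = u" using inv(6)[OF u(1)] u by simp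
    ultimately show False using S.no_free_contraction[of d u x] u x by blast
  qed
qed

text \<open>Here \<open>u\<close> and \<open>v\<close> bound an interval without fixed points of
  \<open>c\<close>. If \<open>g\<close> moved \<open>u\<close> to the left it would, since it
  commutes with \<open>c\<close>, move the whole interval past \<open>u\<close>, and would then
  contract from \<open>v\<close> down to a fixed point \<open>s\<close>. Kopell's lemma, with
  \<open>g\<close> as the contraction and \<open>c\<close> as the commuting map fixing
  \<open>v\<close>, makes \<open>c\<close> trivial there, contrary to
  \<open>c x \<noteq> x\<close>.\<close>

lemma no_move_of_gap_endpoint:
  assumes d: "stays_near d" and u: "u \<in> K" "p \<le> u" "c u = u"
    and v: "v \<in> K" "v \<le> p + d" "c v = v"
    and x: "x \<in> K" "u < x" "x < v" "c x \<noteq> x"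
    and free: "\<And>y. y \<in> K \<Longrightarrow> u < y \<Longrightarrow> y < v \<Longrightarrow> c y \<noteq> y"
    and g: "g \<in> {a, a', b, b'}" "g' \<in> {a, a', b, b'}"
    and inv: "\<And>x. x \<in> K \<Longrightarrow> g (g' x) = x" "\<And>x. x \<in> K \<Longrightarrow> g' (g x) = x"
  shows "\<not> g u < u"
proof
  assume gu: "g u < u"
  have dr: "d \<le> r" using d by (simp add: stays_near_def)
  have gF: "g \<in> germs" "g' \<in> germs" using g unfolding germs_def by auto
  have gc: "g (c y) = c (g y)" "g' (c y) = c (g' y)" if "y \<in> K" for y
    using g comm inv_comm that by auto
  note near = stays_nearD[OF d gF(1)]
  \<comment> \<open>Otherwise the preimage \<open>g' u\<close> would be a fixed point of
    \<open>c\<close> strictly between \<open>u\<close> and \<open>v\<close>.\<close>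
  have gv: "g v \<le> u"
  proof (rule ccontr)
    assume "\<not> g v \<le> u"
    hence "g' u < g' (g v)" using u v x near[of v] in_K[OF gF(1)] r by (intro mono_less[OF gF(2)]) auto
    moreover have "g' (g u) < g' u" using u v x near[of u] in_K[OF gF(1)] r gu dr by (intro mono_less[OF gF(2)]) auto
    moreover have "c (g' u) = g' u" using gc(2)[OF u(1)] u by simp
    ultimately show False using free[of "g' u"] inv u v in_K[OF gF(2)] by simp
  qed
  have it: "(g ^^ n) u \<in> K \<and> p \<le> (g ^^ n) u \<and> (g ^^ n) u \<le> u \<and> (g ^^ Suc n) u \<le> (g ^^ n) u" for n
  proof (induction n)
    case (Suc n)
    moreover have "g ((g ^^ Suc n) u) \<le> g ((g ^^ n) u)"
    proof (rule mono_le[OF gF(1)])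
      show "(g ^^ Suc n) u \<in> K" using Suc in_K[OF gF(1)] by auto
      show "p - r \<le> (g ^^ Suc n) u" using near[of "(g ^^ n) u"] Suc u v x r by simp
    qed (use Suc u v x dr in auto)
    ultimately show ?case using near[of "(g ^^ n) u"] u v x in_K[OF gF(1)] by simp
  qed (use u gu in simp)
  obtain s where s: "s \<in> K" "p \<le> s" "\<And>n. s \<le> (g ^^ n) u" "g s = s" "(\<lambda>n. (g ^^ n) u) \<longlonglongrightarrow> s"
  proof (rule iterates_limit[OF closed maps[OF gF(1)] cont[OF gF(1)] u(1), of p])
    show "p \<le> (g ^^ n) u" "(g ^^ Suc n) u \<le> (g ^^ n) u" for n using it by blast+
  qed blast
  have su: "s \<le> u" using s(3)[of 0] by simp
  \<comment> \<open>Beyond \<open>u\<close>, the inequality \<open>g v \<le> u\<close> suffices. Up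
    to \<open>u\<close>, a point not moved to the left would stay below all iterates of
    \<open>u\<close>, hence below their limit \<open>s\<close>.\<close>
  have less: "g y < y" if y: "y \<in> K" "s < y" "y \<le> v" for y
  proof (cases "u < y")
    case True
    have "g y \<le> g v" using y s v dr r by (intro mono_le[OF gF(1)]) auto
    thus ?thesis using True gv by linarith
  next
    case False
    show ?thesis
    proof (rule ccontr)
      assume *: "\<not> g y < y"
      have below: "y \<le> (g ^^ n) u" for n
      proof (induction n)
        case (Suc n)
        have "g y \<le> g ((g ^^ n) u)" using y s v dr r Suc it[of n] x by (intro mono_le[OF gF(1)]) auto
        thus ?case using * by simp
      qed (use False in simp)
      have "y \<le> s" using LIMSEQ_le_const[OF s(5)] below by blast
      thus False using y by simp
    qed
  qed
  have mono': "strict_mono_on (K \<inter> {s..v}) f" if "f \<in> germs" for f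
    using s v dr r that by (intro monotone_on_subset[OF mono[OF that(1)]]) auto
  interpret G: contraction K g s v
    by unfold_locales (use closed maps[OF gF(1)] cont[OF gF(1)] s v x su less mono'[OF gF(1)] in auto)
  have "c x = x"
  proof (rule G.Kopell[OF dist[OF gF(1)] dist])
    show "v - s \<le> r" using s v dr by simp
  qed (use L maps cont mono' v x su gc in auto)
  thus False using x by simp
qed

lemma fixes_gap_endpoint:
  assumes d: "stays_near d" and u: "u \<in> K" "p \<le> u" "c u = u"
    and v: "v \<in> K" "v \<le> p + d" "c v = v"
    and x: "x \<in> K" "u < x" "x < v" "c x \<noteq> x"
    and free: "\<And>y. y \<in> K \<Longrightarrow> u < y \<Longrightarrow> y < v \<Longrightarrow> c y \<noteq> y"
    and g: "(g, g') \<in> {(a, a'), (b, b')}"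
  shows "g u = u"
proof -
  have gF: "g \<in> germs" "g' \<in> germs" using g unfolding germs_def by auto
  have gg: "g (g' y) = y" "g' (g y) = y" if "y \<in> K" for y using g inv that by auto
  have g_in: "g \<in> {a, a', b, b'}" "g' \<in> {a, a', b, b'}" using g by auto
  have "\<not> g u < u"
    by (rule no_move_of_gap_endpoint[where g = g and g' = g', OF d u v x _ g_in gg]) (use free in auto)
  moreover have "\<not> g' u < u"
    by (rule no_move_of_gap_endpoint[where g = g' and g' = g, OF d u v x _ g_in(2,1) gg(2,1)]) (use free in auto)
  moreover have "g' u < g' (g u)" if "u < g u"
    using that u v x stays_nearD(2)[OF d gF(1) u(1,2)] in_K[OF gF(1)] r by (intro mono_less[OF gF(2)]) auto
  ultimately show ?thesis using gg u by force
qed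

text \<open>If \<open>c\<close> has no fixed point just to the right of \<open>p\<close>, then
  \<open>no_free_action\<close> at \<open>p\<close> itself leaves no points of \<open>K\<close>
  there. Otherwise let \<open>z\<close> be such a fixed point. Any \<open>x\<close> before
  \<open>z\<close> moved by \<open>c\<close> lies in a maximal interval free of fixed points of
  \<open>c\<close>, whose left end is fixed by \<open>a\<close> and \<open>b\<close>;
  \<open>no_free_action\<close> at that end excludes \<open>x\<close>.\<close>

lemma commutator_trivial_right: "\<exists>d>0. \<forall>x\<in>K. p \<le> x \<longrightarrow> x \<le> p + d \<longrightarrow> c x = x"
proof -
  obtain d where d: "stays_near d" by (rule stays_near_exists)
  have dr: "0 < d" "d \<le> r" using d by (auto simp: stays_near_def)
  show ?thesis
  proof (cases "\<exists>z\<in>K. p < z \<and> z \<le> p + d \<and> c z = z")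
    case False
    have "\<not> (p < x \<and> x \<le> p + d)" if "x \<in> K" for x
      using no_free_action[OF d pK _ _ _ _ that] fixpoint False by force
    thus ?thesis using dr fixpoint[of c] by (intro exI[of _ d]) force
  next
    case True
    then obtain z where z: "z \<in> K" "p < z" "z \<le> p + d" "c z = z" by blast
    have "c x = x" if x: "x \<in> K" "p \<le> x" "x \<le> z" for x
    proof (rule ccontr)
      assume cx: "c x \<noteq> x"
      have clos: "closed {y \<in> K \<inter> {lo..hi}. c y = y}" for lo hi
      proof -
        have "continuous_on (K \<inter> {lo..hi}) c" by (rule continuous_on_subset[OF cont]) auto
        hence "closed {y \<in> K \<inter> {lo..hi}. c y - y = 0}"
          by (intro continuous_closed_preimage_constant continuous_intros closed_Int closed) auto
        thus ?thesis by simp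
      qed
      define A B where "A = {y \<in> K \<inter> {p..x}. c y = y}" and "B = {y \<in> K \<inter> {x..z}. c y = y}"
      have bdd: "bdd_above A" "bdd_below B"
        unfolding A_def B_def by (auto intro!: bdd_aboveI[of _ x] bdd_belowI[of _ x])
      have "p \<in> A" "z \<in> B" unfolding A_def B_def using fixpoint pK x z by auto
      hence "Sup A \<in> A" "Inf B \<in> B"
        using bdd clos[of p x] clos[of x z] unfolding A_def[symmetric] B_def[symmetric]
        by (auto intro!: closed_contains_Sup closed_contains_Inf)
      then obtain u v where uv: "u = Sup A" "v = Inf B" and mem: "u \<in> A" "v \<in> B" by blast
      have u: "u \<in> K" "p \<le> u" "c u = u" "u \<le> x" and v: "v \<in> K" "v \<le> p + d" "c v = v" "x \<le> v"
        using mem z unfolding A_def B_def by auto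
      have ux: "u < x" "x < v" using u v cx by (auto simp: less_le)
      have free: "c y \<noteq> y" if y: "y \<in> K" "u < y" "y < v" for y
      proof
        assume cy: "c y = y"
        show False
        proof (cases "y \<le> x")
          case True
          hence "y \<in> A" using y u cy unfolding A_def by auto
          thus False using cSup_upper[OF _ bdd(1)] y unfolding uv by force
        next
          case False
          hence "y \<in> B" using y v(2) mem(2) cy unfolding B_def by auto
          thus False using cInf_lower[OF _ bdd(2)] y unfolding uv by force
        qed
      qed
      have "a u = u" "b u = u"
        using fixes_gap_endpoint[OF d u(1-3) v(1-3) x(1) ux cx free] by auto
      thus False
        using no_free_action[OF d u(1,2) _ _ u(3) x(1) ux(1)] free ux x z by force
    qed
    thus ?thesis using z by (intro exI[of _ "z - p"]) auto
  qed
qed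

end

section \<open>Reflection of the line, for the left side of the fixed point\<close>

lemma bounded_distortion_reflect:
  assumes "bounded_distortion K e L f"
  shows "bounded_distortion (uminus ` K) e L (\<lambda>x. - f (- x))"
  unfolding bounded_distortion_def
proof (intro allI impI ballI)
  fix s t x y u v assume st: "t - s \<le> e"
    and pts: "x \<in> uminus ` K \<inter> {s..t}" "y \<in> uminus ` K \<inter> {s..t}" "u \<in> uminus ` K \<inter> {s..t}" "v \<in> uminus ` K \<inter> {s..t}"
  have "\<bar>f (- x) - f (- y)\<bar> * \<bar>- u - - v\<bar> \<le> exp (L * (- s - - t)) * (\<bar>f (- u) - f (- v)\<bar> * \<bar>- x - - y\<bar>)"
    by (rule bounded_distortionD[OF assms]) (use st pts in auto)
  thus "\<bar>- f (- x) - - f (- y)\<bar> * \<bar>u - v\<bar> \<le> exp (L * (t - s)) * (\<bar>- f (- u) - - f (- v)\<bar> * \<bar>x - y\<bar>)"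
    by (simp add: abs_minus_commute)
qed

context central_commutator
begin

lemma reflected:
  "central_commutator (uminus ` K) (- p) r L (\<lambda>x. - a (- x)) (\<lambda>x. - a' (- x)) (\<lambda>x. - b (- x)) (\<lambda>x. - b' (- x))
     (\<lambda>x. - c (- x)) (\<lambda>x. - c' (- x))"
proof -
  let ?K = "uminus ` K"
  let ?R = "(\<lambda>f x. - f (- x)) ` germs"
  have R: "{\<lambda>x. - a (- x), \<lambda>x. - a' (- x), \<lambda>x. - b (- x), \<lambda>x. - b' (- x), \<lambda>x. - c (- x), \<lambda>x. - c' (- x)} = ?R"
    unfolding germs_def image_insert image_empty ..
  have maps': "h ` ?K \<subseteq> ?K" and cont': "continuous_on ?K h" and fix': "h (- p) = - p"
    and mono': "strict_mono_on (?K \<inter> {- p - r..- p + r}) h" and dist': "bounded_distortion ?K r L h"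
    if "h \<in> ?R" for h
  proof -
    from \<open>h \<in> ?R\<close> obtain f where h: "h = (\<lambda>x. - f (- x))" and f: "f \<in> germs" by (rule imageE)
    have fK: "f x \<in> K" if "x \<in> K" for x using in_K[OF f that] .
    show "h ` ?K \<subseteq> ?K" unfolding h using fK by auto
    show "continuous_on ?K h" unfolding h
      by (rule continuous_on_minus, rule continuous_on_compose2[OF cont[OF f]]) (auto intro: continuous_on_minus continuous_on_id)
    show "h (- p) = - p" unfolding h using fixpoint[OF f] by simp
    show "strict_mono_on (?K \<inter> {- p - r..- p + r}) h"
    proof (rule strict_mono_onI)
      fix x y assume xy: "x \<in> ?K \<inter> {- p - r..- p + r}" "y \<in> ?K \<inter> {- p - r..- p + r}" "x < y"
      have "- x \<in> K" "- y \<in> K" using xy by auto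
      hence "f (- y) < f (- x)" using xy by (intro mono_less[OF f]) simp_all
      thus "h x < h y" unfolding h by simp
    qed
    show "bounded_distortion ?K r L h"
      unfolding h by (rule bounded_distortion_reflect) (rule dist[OF f])
  qed
  have closed': "closed ?K" by (rule closed_negations[OF closed])
  have pK': "- p \<in> ?K" using pK by simp
  have inv': "- a (- (- a' (- x))) = x" "- a' (- (- a (- x))) = x" "- b (- (- b' (- x))) = x" "- b' (- (- b (- x))) = x"
    "- c (- (- c' (- x))) = x" "- c' (- (- c (- x))) = x"
    and comm': "- c (- (- a (- x))) = - a (- (- c (- x)))" "- c (- (- b (- x))) = - b (- (- c (- x)))"
    and ab': "- a (- (- b (- x))) = - c (- (- b (- (- a (- x)))))" if "x \<in> ?K" for x
  proof -
    obtain y where y: "y \<in> K" "x = - y" using \<open>x \<in> ?K\<close> by blast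
    show "- a (- (- a' (- x))) = x" "- a' (- (- a (- x))) = x" "- b (- (- b' (- x))) = x" "- b' (- (- b (- x))) = x"
      "- c (- (- c' (- x))) = x" "- c' (- (- c (- x))) = x"
      using inv[OF y(1)] unfolding y(2) by simp_all
    show "- c (- (- a (- x))) = - a (- (- c (- x)))" "- c (- (- b (- x))) = - b (- (- c (- x)))"
      "- a (- (- b (- x))) = - c (- (- b (- (- a (- x)))))"
      using comm[OF y(1)] ab[OF y(1)] unfolding y(2) by simp_all
  qed
  show ?thesis
    by (unfold_locales; (unfold R)?; fact closed' pK' r L maps' cont' fix' mono' dist' inv' comm' ab')
qed

theorem commutator_trivial: "\<exists>d>0. \<forall>x\<in>K. \<bar>x - p\<bar> \<le> d \<longrightarrow> c x = x"
proof -
  interpret R: central_commutator "uminus ` K" "- p" r L "\<lambda>x. - a (- x)" "\<lambda>x. - a' (- x)"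
    "\<lambda>x. - b (- x)" "\<lambda>x. - b' (- x)" "\<lambda>x. - c (- x)" "\<lambda>x. - c' (- x)"
    by (rule reflected)
  obtain d where d: "d > 0" "\<And>x. x \<in> K \<Longrightarrow> p \<le> x \<Longrightarrow> x \<le> p + d \<Longrightarrow> c x = x"
    using commutator_trivial_right by blast
  obtain d' where d': "d' > 0" "\<And>x. x \<in> uminus ` K \<Longrightarrow> - p \<le> x \<Longrightarrow> x \<le> - p + d' \<Longrightarrow> - c (- x) = x"
    using R.commutator_trivial_right by blast
  show ?thesis
  proof (intro exI[of _ "min d d'"] conjI ballI impI)
    fix x assume x: "x \<in> K" "\<bar>x - p\<bar> \<le> min d d'"
    show "c x = x"
    proof (cases "p \<le> x")
      case True thus ?thesis using d x by auto
    next
      case False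
      hence "- c (- (- x)) = - x" using x by (intro d') auto
      thus ?thesis by simp
    qed
  qed (use d d' in auto)
qed

end

section \<open>From germs to elements of the diffeomorphism group\<close>

lemma carrier_Diff_1Lip [simp]: "carrier (Diff_1Lip_group K) = Diff_1Lip K"
  by (simp add: Diff_1Lip_group_def)

lemma Diff_1Lip_maps: "f \<in> Diff_1Lip K \<Longrightarrow> f ` K \<subseteq> K"
  using Diff_1Lip_imp_Bij by (auto simp: Bij_def bij_betw_def)

lemma Diff_1Lip_in: "f \<in> Diff_1Lip K \<Longrightarrow> x \<in> K \<Longrightarrow> f x \<in> K"
  using Diff_1Lip_maps by blast

lemma Diff_1Lip_continuous: "f \<in> Diff_1Lip K \<Longrightarrow> continuous_on K f"
  using Diff_1Lip_homeomorphism by (metis homeomorphism_def)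

lemma mult_Diff_1Lip:
  assumes "f \<in> Diff_1Lip K" "g \<in> Diff_1Lip K" "x \<in> K"
  shows "(f \<otimes>\<^bsub>Diff_1Lip_group K\<^esub> g) x = f (g x)"
  using assms Diff_1Lip_imp_Bij by (simp add: Diff_1Lip_group_def BijGroup_def compose_def)

lemma one_Diff_1Lip: "x \<in> K \<Longrightarrow> \<one>\<^bsub>Diff_1Lip_group K\<^esub> x = x"
  by (simp add: Diff_1Lip_group_def BijGroup_def)

lemma Diff_1Lip_eqI:
  "f \<in> Diff_1Lip K \<Longrightarrow> g \<in> Diff_1Lip K \<Longrightarrow> (\<And>x. x \<in> K \<Longrightarrow> f x = g x) \<Longrightarrow> f = g"
  by (rule extensionalityI[of _ K]) (auto simp: Diff_1Lip_def)

lemma inv_Diff_1Lip: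
  assumes "f \<in> Diff_1Lip K" "x \<in> K"
  shows "(inv\<^bsub>Diff_1Lip_group K\<^esub> f) (f x) = x" "f ((inv\<^bsub>Diff_1Lip_group K\<^esub> f) x) = x"
proof -
  interpret group "Diff_1Lip_group K" by (rule group_Diff_1Lip)
  have f: "inv\<^bsub>Diff_1Lip_group K\<^esub> f \<in> Diff_1Lip K" using inv_closed[of f] assms by simp
  show "(inv\<^bsub>Diff_1Lip_group K\<^esub> f) (f x) = x" "f ((inv\<^bsub>Diff_1Lip_group K\<^esub> f) x) = x"
    using mult_Diff_1Lip[OF f assms(1,2)] mult_Diff_1Lip[OF assms(1) f assms(2)] l_inv[of f] r_inv[of f] assms
    by (auto simp: one_Diff_1Lip)
qed

lemma square_strict_mono:
  assumes K: "compact K" and f: "f \<in> Diff_1Lip K" "p \<in> K" "f p = p"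
  shows "\<exists>d>0. strict_mono_on (K \<inter> {p - d..p + d}) (f \<otimes>\<^bsub>Diff_1Lip_group K\<^esub> f)"
proof -
  obtain e0 L where e0: "e0 > 0" "locally_monotone K e0 f"
    using Diff_1Lip_bounded_distortion[OF K f(1)] by blast
  define e where "e = e0 / 2"
  have e: "e > 0" "p + e - (p - e) \<le> e0" unfolding e_def using e0 by auto
  obtain d where d: "d > 0" "\<And>x. x \<in> K \<Longrightarrow> \<bar>x - p\<bar> < d \<Longrightarrow> \<bar>f x - p\<bar> < e"
    using Diff_1Lip_continuous[OF f(1)] f(2,3) e(1) unfolding continuous_on_iff dist_real_def
    by metis
  define d' where "d' = min (d / 2) (e)"
  have d': "0 < d'" "d' < d" "d' \<le> e" unfolding d'_def using d(1) e(1) by auto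
  let ?I = "K \<inter> {p - e..p + e}"
  have *: "x \<in> ?I \<and> f x \<in> ?I" if "x \<in> K \<inter> {p - d'..p + d'}" for x
  proof -
    have "\<bar>x - p\<bar> \<le> d'" "x \<in> K" using that by auto
    hence "\<bar>x - p\<bar> < d" "\<bar>x - p\<bar> \<le> e" "x \<in> K" using d' by linarith+
    moreover from this have "\<bar>f x - p\<bar> < e" by (intro d(2))
    ultimately show ?thesis using Diff_1Lip_in[OF f(1), of x] by (auto simp: abs_le_iff abs_less_iff)
  qed
  have "strict_mono_on ?I f \<or> strict_antimono_on ?I f"
    using e0(2) e(2) unfolding locally_monotone_def by blast
  hence "strict_mono_on (K \<inter> {p - d'..p + d'}) (\<lambda>x. f (f x))"
    using * unfolding monotone_on_def by blast
  hence "strict_mono_on (K \<inter> {p - d'..p + d'}) (f \<otimes>\<^bsub>Diff_1Lip_group K\<^esub> f)"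
    using mult_Diff_1Lip[OF f(1) f(1)] by (simp add: monotone_on_def)
  thus ?thesis using d' by blast
qed

text \<open>Squares are used because the square of a germ fixing \<open>p\<close> preserves the order.\<close>

lemma commutator_of_squares_trivial:
  fixes K :: "real set"
  defines "G \<equiv> Diff_1Lip_group K"
  assumes K: "compact K" and p: "p \<in> K"
    and mem: "f \<in> Diff_1Lip K" "g \<in> Diff_1Lip K" "h \<in> Diff_1Lip K"
    and fix_p: "f p = p" "g p = p" "h p = p"
    and sq: "a = f \<otimes>\<^bsub>G\<^esub> f" "b = g \<otimes>\<^bsub>G\<^esub> g" "c = h \<otimes>\<^bsub>G\<^esub> h"
    and comm: "\<And>x. x \<in> K \<Longrightarrow> c (a x) = a (c x)" "\<And>x. x \<in> K \<Longrightarrow> c (b x) = b (c x)"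
    and ab: "\<And>x. x \<in> K \<Longrightarrow> a (b x) = c (b (a x))"
  shows "\<exists>d>0. \<forall>x\<in>K. \<bar>x - p\<bar> \<le> d \<longrightarrow> c x = x"
proof -
  interpret G: group G unfolding G_def by (rule group_Diff_1Lip)
  have carrier_G: "carrier G = Diff_1Lip K" by (simp add: G_def)
  have inv_mem: "inv\<^bsub>G\<^esub> k \<in> Diff_1Lip K" if "k \<in> Diff_1Lip K" for k
    using G.inv_closed[of k] that by (simp add: G_def)
  have mult_mem: "k \<otimes>\<^bsub>G\<^esub> l \<in> Diff_1Lip K" if "k \<in> Diff_1Lip K" "l \<in> Diff_1Lip K" for k l
    using G.m_closed[of k l] that by (simp add: G_def)
  \<comment> \<open>Inverses are added before squaring. The inverse of a square is the square of the
    inverse, so all six maps required by the locale are squares and preserve the order near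
    \<open>p\<close>.\<close>
  define R where "R = {f, inv\<^bsub>G\<^esub> f, g, inv\<^bsub>G\<^esub> g, h, inv\<^bsub>G\<^esub> h}"
  define S where "S = (\<lambda>k. k \<otimes>\<^bsub>G\<^esub> k) ` R"
  have R: "R \<subseteq> Diff_1Lip K" "\<And>k. k \<in> R \<Longrightarrow> k p = p"
  proof -
    show "R \<subseteq> Diff_1Lip K" unfolding R_def using mem inv_mem by auto
    have "(inv\<^bsub>G\<^esub> k) p = p" if "k \<in> Diff_1Lip K" "k p = p" for k
      using inv_Diff_1Lip(1)[OF that(1) p] that(2) unfolding G_def by simp
    thus "k p = p" if "k \<in> R" for k using that mem fix_p unfolding R_def by auto
  qed
  have S: "finite S" "S \<subseteq> Diff_1Lip K"
    unfolding S_def using R mult_mem by (auto simp: R_def)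
  have S_eq: "S = {a, inv\<^bsub>G\<^esub> a, b, inv\<^bsub>G\<^esub> b, c, inv\<^bsub>G\<^esub> c}"
  proof -
    have *: "inv\<^bsub>G\<^esub> (k \<otimes>\<^bsub>G\<^esub> k) = inv\<^bsub>G\<^esub> k \<otimes>\<^bsub>G\<^esub> inv\<^bsub>G\<^esub> k" if "k \<in> Diff_1Lip K" for k
      using G.inv_mult_group[of k k] that by (simp add: carrier_G)
    show ?thesis
      unfolding S_def R_def sq image_insert image_empty *[OF mem(1)] *[OF mem(2)] *[OF mem(3)] ..
  qed
  have abc: "a \<in> Diff_1Lip K" "b \<in> Diff_1Lip K" "c \<in> Diff_1Lip K" using S(2) unfolding S_eq by simp_all
  obtain e L where e: "e > 0" "L \<ge> 0" "\<forall>k\<in>S. bounded_distortion K e L k \<and> locally_monotone K e k"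
    using Diff_1Lip_uniform_bounded_distortion[OF K S] by blast
  have "\<forall>k\<in>S. \<exists>d>0. strict_mono_on (K \<inter> {p - d..p + d}) k"
  proof
    fix k assume "k \<in> S"
    then obtain l where l: "l \<in> R" "k = l \<otimes>\<^bsub>G\<^esub> l" unfolding S_def by blast
    hence "l \<in> Diff_1Lip K" "l p = p" using R by auto
    thus "\<exists>d>0. strict_mono_on (K \<inter> {p - d..p + d}) k"
      unfolding l(2) G_def using square_strict_mono[OF K _ p] by blast
  qed
  from bchoice[OF this] obtain d
    where d: "\<forall>k\<in>S. d k > 0 \<and> strict_mono_on (K \<inter> {p - d k..p + d k}) k" ..
  define r where "r = Min (insert e (d ` S))"
  have r: "r > 0" "r \<le> e" "\<And>k. k \<in> S \<Longrightarrow> r \<le> d k"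
  proof -
    show "r > 0" unfolding r_def using e d S by (subst Min_gr_iff) auto
    show "r \<le> e" "\<And>k. k \<in> S \<Longrightarrow> r \<le> d k" unfolding r_def using S by (auto intro!: Min_le)
  qed
  have loc: "k ` K \<subseteq> K" "continuous_on K k" "k p = p" "strict_mono_on (K \<inter> {p - r..p + r}) k"
    "bounded_distortion K r L k" if k: "k \<in> S" for k
  proof -
    have kD: "k \<in> Diff_1Lip K" using S k by auto
    show "k ` K \<subseteq> K" by (rule Diff_1Lip_maps[OF kD])
    show "continuous_on K k" by (rule Diff_1Lip_continuous[OF kD])
    obtain l where l: "l \<in> R" "k = l \<otimes>\<^bsub>G\<^esub> l" using k unfolding S_def by blast
    hence "l \<in> Diff_1Lip K" "l p = p" using R by auto
    thus "k p = p" unfolding l(2) G_def using mult_Diff_1Lip[of l K l p] p by simp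
    show "strict_mono_on (K \<inter> {p - r..p + r}) k"
      using r(3)[OF k] by (intro monotone_on_subset[OF conjunct2[OF bspec[OF d k]]]) auto
    show "bounded_distortion K r L k"
      using r by (intro bounded_distortion_mono[OF conjunct1[OF bspec[OF e(3) k]]]) auto
  qed
  note inverses = inv_Diff_1Lip[OF abc(1), folded G_def] inv_Diff_1Lip[OF abc(2), folded G_def]
    inv_Diff_1Lip[OF abc(3), folded G_def]
  have closed: "closed K" by (rule compact_imp_closed[OF K])
  interpret central_commutator K p r L a "inv\<^bsub>G\<^esub> a" b "inv\<^bsub>G\<^esub> b" c "inv\<^bsub>G\<^esub> c"
    by (unfold_locales; (unfold S_eq[symmetric])?; fact closed p r(1) e(2) loc inverses comm ab)
  show ?thesis by (rule commutator_trivial)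
qed

section \<open>Gaps and contracting words\<close>

definition gap :: "real set \<Rightarrow> real \<times> real \<Rightarrow> bool" where
  "gap M J \<longleftrightarrow> fst J \<in> M \<and> snd J \<in> M \<and> fst J < snd J \<and> M \<inter> {fst J<..<snd J} = {}"

definition len :: "real \<times> real \<Rightarrow> real" where "len J = snd J - fst J"

lemma len_pos: "gap M J \<Longrightarrow> 0 < len J"
  by (simp add: gap_def len_def)

lemma gap_unique:
  assumes J: "gap M J" "gap M J'" and z: "z \<in> {fst J<..<snd J}" "z \<in> {fst J'<..<snd J'}"
  shows "J = J'"
proof (rule prod_eqI)
  have no: "x \<in> M \<Longrightarrow> x \<le> fst J \<or> snd J \<le> x" "x \<in> M \<Longrightarrow> x \<le> fst J' \<or> snd J' \<le> x" for x
    using J unfolding gap_def by force+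
  show "fst J = fst J'" "snd J = snd J'"
    using no(1)[of "fst J'"] no(2)[of "fst J"] no(1)[of "snd J'"] no(2)[of "snd J"] J z
    unfolding gap_def by auto
qed

text \<open>Distinct gaps are disjoint open intervals, so their total length is the Lebesgue measure
  of a subset of \<open>{lo..hi}\<close>.\<close>

lemma sum_len_gaps_le:
  assumes fin: "finite \<J>" and gaps: "\<And>J. J \<in> \<J> \<Longrightarrow> gap M J" and M: "M \<subseteq> {lo..hi}" and "lo \<le> hi"
  shows "sum len \<J> \<le> hi - lo"
proof -
  have disj: "disjoint_family_on (\<lambda>J. {fst J<..<snd J}) \<J>"
    unfolding disjoint_family_on_def
  proof (intro ballI impI)
    fix J J' assume J: "J \<in> \<J>" "J' \<in> \<J>" "J \<noteq> J'"
    show "{fst J<..<snd J} \<inter> {fst J'<..<snd J'} = {}"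
      using gap_unique[OF gaps[OF J(1)] gaps[OF J(2)]] J(3) by blast
  qed
  have "sum len \<J> = (\<Sum>J\<in>\<J>. measure lborel {fst J<..<snd J})"
    using gaps unfolding gap_def len_def by (intro sum.cong) (auto simp: less_imp_le)
  also have "\<dots> = measure lborel (\<Union>J\<in>\<J>. {fst J<..<snd J})"
    by (rule measure_finite_Union[symmetric, OF fin _ disj]) (use gaps in \<open>auto simp: gap_def less_imp_le\<close>)
  also have "\<dots> \<le> measure lborel {lo..hi}"
  proof (rule measure_mono_fmeasurable)
    have "{fst J<..<snd J} \<subseteq> {lo..hi}" if "J \<in> \<J>" for J
      using gaps[OF that] M unfolding gap_def by force
    thus "(\<Union>J\<in>\<J>. {fst J<..<snd J}) \<subseteq> {lo..hi}" by blast
    show "{lo..hi} \<in> fmeasurable lborel" by (rule fmeasurable_compact) simp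
    show "(\<Union>J\<in>\<J>. {fst J<..<snd J}) \<in> sets lborel" using fin by (intro sets.finite_UN) auto
  qed
  finally show ?thesis using \<open>lo \<le> hi\<close> by simp
qed

lemma finite_large_gaps:
  assumes M: "bounded M" and "0 < \<eta>"
  shows "finite {J. gap M J \<and> \<eta> \<le> len J}"
proof -
  obtain B where B: "\<And>x. x \<in> M \<Longrightarrow> \<bar>x\<bar> \<le> B" using M unfolding bounded_iff by auto
  define B' where "B' = \<bar>B\<bar>"
  have sub: "M \<subseteq> {- B'..B'}" unfolding B'_def using B by fastforce
  have "finite {J. gap M J \<and> \<eta> \<le> len J} \<and> card {J. gap M J \<and> \<eta> \<le> len J} \<le> nat \<lceil>2 * B' / \<eta>\<rceil>"
  proof (rule finite_if_finite_subsets_card_bdd)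
    fix G assume G: "G \<subseteq> {J. gap M J \<and> \<eta> \<le> len J}" "finite G"
    have "real (card G) * \<eta> = (\<Sum>J\<in>G. \<eta>)" by simp
    also have "\<dots> \<le> sum len G" using G by (intro sum_mono) auto
    also have "\<dots> \<le> B' - - B'" by (rule sum_len_gaps_le[OF G(2) _ sub]) (use G in \<open>auto simp: B'_def\<close>)
    finally have "real (card G) \<le> 2 * B' / \<eta>" using \<open>0 < \<eta>\<close> by (simp add: field_simps)
    thus "card G \<le> nat \<lceil>2 * B' / \<eta>\<rceil>" by linarith
  qed
  thus ?thesis by simp
qed

text \<open>An accumulation point provides two points of \<open>M\<close> closer than
  \<open>\<eta>\<close>, and a missing point between them lies in a gap bounded by points of
  \<open>M\<close> within that range.\<close>

lemma small_gap_exists: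
  assumes M: "compact M" "infinite M" and between: "\<And>x y. x \<in> M \<Longrightarrow> y \<in> M \<Longrightarrow> x < y \<Longrightarrow> \<exists>t. x < t \<and> t < y \<and> t \<notin> M"
    and "0 < \<eta>"
  obtains J where "gap M J" "len J < \<eta>"
proof -
  obtain z where z: "z \<in> M" "z islimpt M"
    using Heine_Borel_imp_Bolzano_Weierstrass[OF M(1) M(2)] by blast
  then obtain y where y: "y \<in> M" "y \<noteq> z" "dist y z < \<eta>" using \<open>0 < \<eta>\<close> unfolding islimpt_approachable by blast
  obtain a b where ab: "a \<in> M" "b \<in> M" "a < b" "b - a < \<eta>"
  proof (cases "y < z")
    case True thus ?thesis using that[of y z] y z by (simp add: dist_real_def)
  next
    case False thus ?thesis using that[of z y] y z by (simp add: dist_real_def)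
  qed
  obtain t where t: "a < t" "t < b" "t \<notin> M" using between ab by blast
  have cl: "closed M" using M compact_imp_closed by blast
  define u v where "u = Sup (M \<inter> {a..t})" and "v = Inf (M \<inter> {t..b})"
  have bdd: "bdd_above (M \<inter> {a..t})" "bdd_below (M \<inter> {t..b})" by (auto intro: bdd_above_mono bdd_below_mono)
  have u: "u \<in> M \<inter> {a..t}" unfolding u_def using bdd ab t cl by (intro closed_contains_Sup) auto
  have v: "v \<in> M \<inter> {t..b}" unfolding v_def using bdd ab t cl by (intro closed_contains_Inf) auto
  have "M \<inter> {u<..<v} = {}"
  proof (rule ccontr)
    assume "M \<inter> {u<..<v} \<noteq> {}"
    then obtain w where w: "w \<in> M" "u < w" "w < v" by auto
    show False
    proof (cases "w \<le> t")
      case True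
      hence "w \<in> M \<inter> {a..t}" using w u by auto
      thus False using cSup_upper[OF _ bdd(1)] w unfolding u_def by force
    next
      case False
      hence "w \<in> M \<inter> {t..b}" using w v by auto
      thus False using cInf_lower[OF _ bdd(2)] w unfolding v_def by force
    qed
  qed
  moreover have "u < v"
  proof -
    have "u \<noteq> t" using u t by auto
    thus ?thesis using u v by auto
  qed
  ultimately have "gap M (u, v)" using u v unfolding gap_def by simp
  moreover have "len (u, v) < \<eta>" using u v ab unfolding len_def by auto
  ultimately show ?thesis using that by blast
qed

section \<open>Walks through small gaps and the words that follow them\<close>

text \<open>Letters are added on the right, where they act first: this matches the induction on a
  walk, which splits off its initial step.\<close>

inductive_set words :: "('a \<Rightarrow> 'a) set \<Rightarrow> ('a \<Rightarrow> 'a) set" for S where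
  words_id: "id \<in> words S"
| words_comp: "w \<in> words S \<Longrightarrow> s \<in> S \<Longrightarrow> w \<circ> s \<in> words S"

text \<open>\<open>M\<close> plays the role of an infinite minimal set and \<open>S\<close> that of
  a generating set closed under inversion. Minimality enters only through \<open>no_finite\<close>,
  the absence of finite invariant subsets.\<close>

locale gap_walk =
  fixes M :: "real set" and S :: "(real \<Rightarrow> real) set" and e L :: real
  assumes compact: "compact M" and infinite: "infinite M"
    and between: "\<And>x y. x \<in> M \<Longrightarrow> y \<in> M \<Longrightarrow> x < y \<Longrightarrow> \<exists>t. x < t \<and> t < y \<and> t \<notin> M"
    and S: "finite S" and e: "0 < e" and L: "0 \<le> L"
    and maps: "\<And>s x. s \<in> S \<Longrightarrow> x \<in> M \<Longrightarrow> s x \<in> M" and cont: "\<And>s. s \<in> S \<Longrightarrow> continuous_on M s"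
    and dist: "\<And>s. s \<in> S \<Longrightarrow> bounded_distortion M e L s" and mono: "\<And>s. s \<in> S \<Longrightarrow> locally_monotone M e s"
    and inverses: "\<And>s. s \<in> S \<Longrightarrow> \<exists>s'\<in>S. \<forall>x\<in>M. s' (s x) = x \<and> s (s' x) = x"
    and no_finite: "\<And>F. F \<subseteq> M \<Longrightarrow> finite F \<Longrightarrow> F \<noteq> {} \<Longrightarrow> \<exists>s\<in>S. \<not> s ` F \<subseteq> F"
begin

text \<open>The factor 3 allows a small gap to be enlarged by its own length on both sides and still
  fit below \<open>e\<close>. The continuity condition keeps the image of a small gap shorter than
  \<open>e\<close>, where the inverse generator is monotone.\<close>

definition scale :: real where
  "scale = (SOME d. 0 < d \<and> 3 * d \<le> e \<and> (\<forall>s\<in>S. \<forall>x\<in>M. \<forall>y\<in>M. \<bar>x - y\<bar> < d \<longrightarrow> \<bar>s x - s y\<bar> < e))"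

lemma scale: "0 < scale" "3 * scale \<le> e"
  "s \<in> S \<Longrightarrow> x \<in> M \<Longrightarrow> y \<in> M \<Longrightarrow> \<bar>x - y\<bar> < scale \<Longrightarrow> \<bar>s x - s y\<bar> < e"
proof -
  have "\<forall>s\<in>S. \<exists>d>0. \<forall>x\<in>M. \<forall>y\<in>M. \<bar>x - y\<bar> < d \<longrightarrow> \<bar>s x - s y\<bar> < e"
  proof
    fix s assume "s \<in> S"
    hence "uniformly_continuous_on M s" using compact_uniformly_continuous cont compact by blast
    thus "\<exists>d>0. \<forall>x\<in>M. \<forall>y\<in>M. \<bar>x - y\<bar> < d \<longrightarrow> \<bar>s x - s y\<bar> < e"
      using e unfolding uniformly_continuous_on_def dist_real_def by metis
  qed
  from bchoice[OF this] obtain d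
    where d: "\<forall>s\<in>S. d s > 0 \<and> (\<forall>x\<in>M. \<forall>y\<in>M. \<bar>x - y\<bar> < d s \<longrightarrow> \<bar>s x - s y\<bar> < e)" ..
  define d0 where "d0 = Min (insert (e / 3) (d ` S))"
  have "0 < d0" unfolding d0_def using d S e by (subst Min_gr_iff) auto
  moreover have "d0 \<le> e / 3" unfolding d0_def by (rule Min_le) (use S in auto)
  moreover have "d0 \<le> d s" if "s \<in> S" for s unfolding d0_def by (rule Min_le) (use S that in auto)
  ultimately have "\<exists>d. 0 < d \<and> 3 * d \<le> e \<and> (\<forall>s\<in>S. \<forall>x\<in>M. \<forall>y\<in>M. \<bar>x - y\<bar> < d \<longrightarrow> \<bar>s x - s y\<bar> < e)"
    using d by (intro exI[of _ d0] conjI ballI impI) (auto, force)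
  from someI_ex[OF this, folded scale_def]
  show "0 < scale" "3 * scale \<le> e"
    "s \<in> S \<Longrightarrow> x \<in> M \<Longrightarrow> y \<in> M \<Longrightarrow> \<bar>x - y\<bar> < scale \<Longrightarrow> \<bar>s x - s y\<bar> < e"
    by blast+
qed

text \<open>The minimum and maximum account for generators that reverse the order on the
  gap.\<close>

definition img :: "(real \<Rightarrow> real) \<Rightarrow> real \<times> real \<Rightarrow> real \<times> real" where
  "img s J = (min (s (fst J)) (s (snd J)), max (s (fst J)) (s (snd J)))"

definition small :: "real \<times> real \<Rightarrow> bool" where "small J \<longleftrightarrow> gap M J \<and> len J < scale"

lemma small_len: "small J \<Longrightarrow> 0 < len J"
  unfolding small_def using len_pos by blast

definition walk :: "real \<times> real \<Rightarrow> real \<times> real \<Rightarrow> bool" where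
  "walk J J' \<longleftrightarrow> small J \<and> small J' \<and> (\<exists>s\<in>S. J' = img s J)"

lemma img_ends: "{fst (img s J), snd (img s J)} = s ` {fst J, snd J}"
  unfolding img_def by (auto simp: min_def max_def)

lemma len_img: "len (img s J) = \<bar>s (fst J) - s (snd J)\<bar>"
  unfolding img_def len_def by auto

lemma img_inverse:
  assumes J: "gap M J" and s': "\<forall>x\<in>M. s' (s x) = x"
  shows "img s' (img s J) = J"
proof -
  have "fst J \<in> M" "snd J \<in> M" "fst J < snd J" using J by (auto simp: gap_def)
  thus ?thesis using s' unfolding img_def by (auto simp: min_def max_def prod_eq_iff)
qed

text \<open>A point of \<open>M\<close> inside the image would be sent into \<open>J\<close> by the
  inverse generator, which is monotone on the image because its length is below
  \<open>e\<close>.\<close>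

lemma img_gap:
  assumes J: "small J" and s: "s \<in> S"
  shows "gap M (img s J)" "len (img s J) < e"
proof -
  have ends: "fst J \<in> M" "snd J \<in> M" "fst J < snd J" "snd J - fst J < scale" "M \<inter> {fst J<..<snd J} = {}"
    using J by (auto simp: gap_def small_def len_def)
  show le: "len (img s J) < e" unfolding len_img using ends by (intro scale(3) s) auto
  obtain s' where s': "s' \<in> S" "\<forall>x\<in>M. s' (s x) = x \<and> s (s' x) = x" using inverses s by blast
  let ?a = "fst (img s J)" and ?b = "snd (img s J)"
  have ab: "?a \<in> M" "?b \<in> M" unfolding img_def using maps s ends by (auto simp: min_def max_def)
  have "s (fst J) \<noteq> s (snd J)" using s' ends by (metis less_irrefl)
  hence lt: "?a < ?b" unfolding img_def by (auto simp: min_def max_def)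
  have "M \<inter> {?a<..<?b} = {}"
  proof (rule ccontr)
    assume "M \<inter> {?a<..<?b} \<noteq> {}"
    then obtain w where w: "w \<in> M" "?a < w" "w < ?b" by auto
    have "?b - ?a \<le> e" using le unfolding len_def by simp
    hence "strict_mono_on (M \<inter> {?a..?b}) s' \<or> strict_antimono_on (M \<inter> {?a..?b}) s'"
      using mono[OF s'(1)] unfolding locally_monotone_def by blast
    hence "s' ?a < s' w \<and> s' w < s' ?b \<or> s' ?b < s' w \<and> s' w < s' ?a"
      unfolding monotone_on_def using ab w by force
    moreover have "{s' ?a, s' ?b} = {fst J, snd J}"
      using s' ends unfolding img_def by (auto simp: min_def max_def)
    hence "s' ?a = fst J \<and> s' ?b = snd J \<or> s' ?a = snd J \<and> s' ?b = fst J" by (simp add: doubleton_eq_iff)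
    ultimately have "fst J < s' w \<and> s' w < snd J" using ends by auto
    thus False using ends maps[OF s'(1) w(1)] by auto
  qed
  thus "gap M (img s J)" unfolding gap_def using ab lt by simp
qed

lemma walk_sym: "walk J J' \<Longrightarrow> walk J' J"
proof -
  assume w: "walk J J'"
  then obtain s where s: "s \<in> S" "J' = img s J" "small J" "small J'" unfolding walk_def by blast
  obtain s' where s': "s' \<in> S" "\<forall>x\<in>M. s' (s x) = x \<and> s (s' x) = x" using inverses s by blast
  have "img s' J' = J" unfolding s(2) using s s' by (intro img_inverse) (auto simp: small_def)
  thus "walk J' J" unfolding walk_def using s s' by metis
qed

lemma infinite_small: "infinite {J. small J}"
proof
  assume fin: "finite {J. small J}"
  define \<eta> where "\<eta> = Min (insert scale (len ` {J. small J}))"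
  have "0 < \<eta>" unfolding \<eta>_def using finite_imageI[OF fin, of len] scale(1) small_len
    by (subst Min_gr_iff) auto
  then obtain J where J: "gap M J" "len J < \<eta>" using small_gap_exists[OF compact infinite between] by blast
  have "\<eta> \<le> scale" unfolding \<eta>_def using fin by (intro Min_le) auto
  hence "small J" using J by (simp add: small_def)
  hence "\<eta> \<le> len J" unfolding \<eta>_def using fin by (intro Min_le) auto
  thus False using J by simp
qed

text \<open>A finite component of the walk that no generator leaves would give a finite invariant
  set of endpoints. So, were all components finite, each would contain the image of a large gap
  under some generator. Large gaps and generators are finite in number, which would leave only
  finitely many small gaps.\<close>

lemma infinite_walk: obtains J where "small J" "infinite {J'. walk\<^sup>*\<^sup>* J J'}"
proof (rule ccontr)
  assume "\<not> thesis"
  hence fin: "finite {J'. walk\<^sup>*\<^sup>* J J'}" if "small J" for J using that \<open>\<And>J. small J \<Longrightarrow> infinite {J'. walk\<^sup>*\<^sup>* J J'} \<Longrightarrow> thesis\<close> by blast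
  define B where "B = {J. gap M J \<and> scale \<le> len J}"
  define C where "C = (\<Union>s\<in>S. img s ` B)"
  have "finite C" unfolding C_def B_def
    using S finite_large_gaps[OF compact_imp_bounded[OF compact] scale(1)] by blast
  have reach: "\<exists>J'\<in>C. small J' \<and> walk\<^sup>*\<^sup>* J' J" if J: "small J" for J
  proof (rule ccontr)
    assume *: "\<not> ?thesis"
    have small_reach: "small J'" if "walk\<^sup>*\<^sup>* J J'" for J'
      using that by (induction rule: rtranclp_induct) (use J in \<open>auto simp: walk_def\<close>)
    have sym: "walk\<^sup>*\<^sup>* J' J" if "walk\<^sup>*\<^sup>* J J'" for J'
      using that by (induction rule: rtranclp_induct) (blast intro: converse_rtranclp_into_rtranclp walk_sym)+
    have next_small: "walk J' (img s J')" if J': "walk\<^sup>*\<^sup>* J J'" and s: "s \<in> S" for J' s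
    proof -
      have "small (img s J')"
      proof (rule ccontr)
        assume "\<not> small (img s J')"
        hence "img s J' \<in> B" using img_gap[OF small_reach[OF J'] s] by (auto simp: B_def small_def)
        moreover obtain s' where s': "s' \<in> S" "\<forall>x\<in>M. s' (s x) = x \<and> s (s' x) = x" using inverses s by blast
        moreover have "img s' (img s J') = J'"
          using s' small_reach[OF J'] by (intro img_inverse) (auto simp: small_def)
        ultimately have "J' \<in> C" unfolding C_def by (metis UN_I imageI)
        thus False using * small_reach[OF J'] sym[OF J'] by blast
      qed
      thus ?thesis using small_reach[OF J'] s unfolding walk_def by blast
    qed
    define F where "F = (\<Union>J'\<in>{J'. walk\<^sup>*\<^sup>* J J'}. {fst J', snd J'})"
    have "F \<subseteq> M" unfolding F_def using small_reach by (auto simp: small_def gap_def)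
    moreover have "finite F" unfolding F_def using fin[OF J] by blast
    moreover have "F \<noteq> {}" unfolding F_def by blast
    moreover have "s ` F \<subseteq> F" if "s \<in> S" for s
    proof (rule image_subsetI)
      fix x assume "x \<in> F"
      then obtain J' where J': "walk\<^sup>*\<^sup>* J J'" "x \<in> {fst J', snd J'}" unfolding F_def by blast
      have "walk\<^sup>*\<^sup>* J (img s J')" using next_small[OF J'(1) that] J'(1) by simp
      moreover have "s x \<in> {fst (img s J'), snd (img s J')}" unfolding img_ends using J'(2) by blast
      ultimately show "s x \<in> F" unfolding F_def by blast
    qed
    ultimately show False using no_finite by blast
  qed
  have "{J. small J} \<subseteq> (\<Union>J'\<in>{J'\<in>C. small J'}. {J. walk\<^sup>*\<^sup>* J' J})"
  proof (rule subsetI)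
    fix I assume "I \<in> {J. small J}"
    hence "\<exists>J'\<in>C. small J' \<and> walk\<^sup>*\<^sup>* J' I" using reach[of I] by simp
    then obtain J' where "J' \<in> C" "small J'" "walk\<^sup>*\<^sup>* J' I" by (elim bexE conjE)
    thus "I \<in> (\<Union>J'\<in>{J'\<in>C. small J'}. {J. walk\<^sup>*\<^sup>* J' J})" by (intro UN_I[of J']) simp_all
  qed
  moreover have "finite (\<Union>J'\<in>{J'\<in>C. small J'}. {J. walk\<^sup>*\<^sup>* J' J})"
    by (intro finite_UN_I) (use \<open>finite C\<close> fin in auto)
  ultimately show False using infinite_small finite_subset by blast
qed

text \<open>Along the walk the ratio of \<open>\<bar>y - u\<bar>\<close> to the length of the
  current gap grows by a factor of at most \<open>exp (3 * L * len J)\<close> per step. The premise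
  reserves the whole product in advance: the ratio then never exceeds 1, the image of
  \<open>y\<close> stays within one gap length of the image of \<open>u\<close>, and the distortion
  estimate applies at every step.\<close>

lemma walk_contraction:
  assumes "rtrancl_path walk J xs J'" "small J" "u \<in> {fst J, snd J}"
  shows "\<exists>w\<in>words S. \<forall>y\<in>M. \<bar>y - u\<bar> * exp (3 * L * sum_list (map len (J # xs))) \<le> len J \<longrightarrow>
           \<bar>w y - w u\<bar> * len J \<le> exp (3 * L * sum_list (map len (J # xs))) * (len J' * \<bar>y - u\<bar>)"
  using assms
proof (induction arbitrary: u rule: rtrancl_path.induct)
  case (base J)
  have "1 \<le> exp (3 * L * len J)" using base L len_pos[of M J] by (auto simp: small_def)
  hence "len J * \<bar>y - u\<bar> \<le> exp (3 * L * len J) * (len J * \<bar>y - u\<bar>)" for y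
    using base len_pos[of M J] mult_right_mono[of 1 "exp (3 * L * len J)" "len J * \<bar>y - u\<bar>"]
    by (simp add: small_def)
  thus ?case by (intro bexI[of _ id] words_id) (auto simp: mult.commute)
next
  case (step J J1 xs J')
  obtain s where s: "s \<in> S" "J1 = img s J" "small J" "small J1" using step.hyps(1) unfolding walk_def by blast
  have u1: "s u \<in> {fst J1, snd J1}" unfolding s(2) img_ends using step.prems by blast
  define T where "T = sum_list (map len (J1 # xs))"
  obtain w where w: "w \<in> words S" "\<forall>y\<in>M. \<bar>y - s u\<bar> * exp (3 * L * T) \<le> len J1 \<longrightarrow>
           \<bar>w y - w (s u)\<bar> * len J1 \<le> exp (3 * L * T) * (len J' * \<bar>y - s u\<bar>)"
    using step.IH[OF s(4) u1] unfolding T_def by blast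
  have all_small: "\<forall>I\<in>set xs. small I" using step.hyps(2)
    by (induction rule: rtrancl_path.induct) (auto simp: walk_def)
  have pos: "0 < len J" "0 < len J1" using s small_len by auto
  have "0 \<le> sum_list (map len xs)"
    using all_small small_len by (intro sum_list_nonneg) (auto intro: less_imp_le)
  hence T: "0 \<le> T" unfolding T_def using pos by simp
  have J: "fst J \<in> M" "snd J \<in> M" "len J < scale" using s(3) by (auto simp: small_def gap_def)
  have uM: "u \<in> M" using step.prems J by auto
  have "\<bar>(w \<circ> s) y - (w \<circ> s) u\<bar> * len J \<le> exp (3 * L * (len J + T)) * (len J' * \<bar>y - u\<bar>)"
    if y: "y \<in> M" "\<bar>y - u\<bar> * exp (3 * L * (len J + T)) \<le> len J" for y
  proof -
    define q where "q = \<bar>s y - s u\<bar>"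
    have "1 \<le> exp (3 * L * (len J + T))" using L T pos by simp
    hence "\<bar>y - u\<bar> * 1 \<le> \<bar>y - u\<bar> * exp (3 * L * (len J + T))" by (intro mult_left_mono) auto
    hence yu: "\<bar>y - u\<bar> \<le> len J" using y by simp
    \<comment> \<open>The interval is \<open>J\<close> enlarged by \<open>len J\<close> on both
      sides, which contains \<open>y\<close>; its length \<open>3 * len J\<close> is the source of
      the 3 in the exponents.\<close>
    have "q * \<bar>fst J - snd J\<bar> \<le> exp (L * ((snd J + len J) - (fst J - len J))) * (\<bar>s (fst J) - s (snd J)\<bar> * \<bar>y - u\<bar>)"
      unfolding q_def
      by (rule bounded_distortionD[OF dist[OF s(1)]])
         (use J uM y yu pos scale step.prems in \<open>auto simp: len_def abs_le_iff\<close>)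
    hence q: "q * len J \<le> exp (3 * L * len J) * (len J1 * \<bar>y - u\<bar>)"
      unfolding s(2) len_img using pos by (simp add: len_def algebra_simps)
    have exp_T: "exp (3 * L * (len J + T)) = exp (3 * L * len J) * exp (3 * L * T)"
      by (simp add: distrib_left exp_add)
    have "(q * exp (3 * L * T)) * len J = (q * len J) * exp (3 * L * T)" by simp
    also have "\<dots> \<le> exp (3 * L * len J) * (len J1 * \<bar>y - u\<bar>) * exp (3 * L * T)"
      by (intro mult_right_mono q) simp
    also have "\<dots> = (\<bar>y - u\<bar> * exp (3 * L * (len J + T))) * len J1" unfolding exp_T by simp
    also have "\<dots> \<le> len J * len J1" using y pos by (intro mult_right_mono) auto
    finally have "q * exp (3 * L * T) \<le> len J1" using pos by (simp add: mult.commute)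
    hence IH: "\<bar>w (s y) - w (s u)\<bar> * len J1 \<le> exp (3 * L * T) * (len J' * q)"
      using w(2) maps[OF s(1) y(1)] unfolding q_def by blast
    have J': "0 < len J'" using step.hyps(2) s(4) small_len
      by (induction rule: rtrancl_path.induct) (auto simp: walk_def)
    have "(\<bar>w (s y) - w (s u)\<bar> * len J) * len J1 = (\<bar>w (s y) - w (s u)\<bar> * len J1) * len J" by simp
    also have "\<dots> \<le> exp (3 * L * T) * (len J' * q) * len J" using IH pos by (intro mult_right_mono) auto
    also have "\<dots> = exp (3 * L * T) * len J' * (q * len J)" by simp
    also have "\<dots> \<le> exp (3 * L * T) * len J' * (exp (3 * L * len J) * (len J1 * \<bar>y - u\<bar>))"
      using q J' by (intro mult_left_mono) auto
    also have "\<dots> = exp (3 * L * (len J + T)) * (len J' * \<bar>y - u\<bar>) * len J1" unfolding exp_T by simp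
    finally show ?thesis using pos by simp
  qed
  moreover have "w \<circ> s \<in> words S" using w s by (intro words_comp)
  ultimately show ?case unfolding T_def by (intro bexI[of _ "w \<circ> s"]) auto
qed

text \<open>Only finitely many gaps have length at least \<open>\<eta>\<close>, so the infinite
  component of \<open>J\<close> reaches a gap shorter than \<open>\<eta>\<close>. The neighbourhood
  radius \<delta> depends only on \<open>J\<close> and on \<open>D\<close>, which bounds the total
  length of the gaps on any walk without repetitions, so it serves for every
  \<open>\<eta>\<close>.\<close>

theorem contracting_words:
  obtains u \<delta> where "u \<in> M" "0 < \<delta>"
    "\<And>\<eta>. 0 < \<eta> \<Longrightarrow> \<exists>w\<in>words S. \<forall>y\<in>M. \<bar>y - u\<bar> \<le> \<delta> \<longrightarrow> \<bar>w y - w u\<bar> \<le> \<eta>"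
proof -
  obtain J where J: "small J" "infinite {J'. walk\<^sup>*\<^sup>* J J'}" by (rule infinite_walk)
  obtain B where B: "\<And>x. x \<in> M \<Longrightarrow> \<bar>x\<bar> \<le> B" using compact_imp_bounded[OF compact] unfolding bounded_iff by auto
  define D where "D = 2 * \<bar>B\<bar>"
  have sub: "M \<subseteq> {- \<bar>B\<bar>..\<bar>B\<bar>}" using B by fastforce
  define u where "u = fst J"
  define \<delta> where "\<delta> = len J / exp (3 * L * D)"
  have "gap M J" using J by (simp add: small_def)
  hence pos: "0 < len J" "u \<in> M" using len_pos by (simp_all add: gap_def u_def)
  have "\<exists>w\<in>words S. \<forall>y\<in>M. \<bar>y - u\<bar> \<le> \<delta> \<longrightarrow> \<bar>w y - w u\<bar> \<le> \<eta>" if "0 < \<eta>" for \<eta>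
  proof -
    have "\<not> {J'. walk\<^sup>*\<^sup>* J J'} \<subseteq> {J. gap M J \<and> \<eta> \<le> len J}"
      using J(2) finite_large_gaps[OF compact_imp_bounded[OF compact] that] finite_subset by blast
    then obtain J' where J': "walk\<^sup>*\<^sup>* J J'" "\<not> (gap M J' \<and> \<eta> \<le> len J')" by blast
    have "small J'" using J'(1) by (induction rule: rtranclp_induct) (use J in \<open>auto simp: walk_def\<close>)
    hence len: "len J' < \<eta>" "0 < len J'" using J'(2) small_len by (auto simp: small_def)
    obtain xs0 where "rtrancl_path walk J xs0 J'" using J'(1) unfolding rtranclp_eq_rtrancl_path by blast
    \<comment> \<open>Removing loops makes the gaps distinct, hence disjoint, so that their lengths
      add up to at most \<open>D\<close> however long the walk is.\<close>
    then obtain xs where xs: "rtrancl_path walk J xs J'" "distinct (J # xs)" by (rule rtrancl_path_distinct)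
    have "\<forall>I\<in>set xs. small I" using xs(1) by (induction rule: rtrancl_path.induct) (auto simp: walk_def)
    hence "sum len (set (J # xs)) \<le> \<bar>B\<bar> - - \<bar>B\<bar>"
      using J(1) by (intro sum_len_gaps_le[OF _ _ sub]) (auto simp: small_def)
    hence T: "sum_list (map len (J # xs)) \<le> D"
      using xs(2) by (subst sum_list_distinct_conv_sum_set) (auto simp: D_def)
    define E where "E = exp (3 * L * sum_list (map len (J # xs)))"
    have E: "0 < E" "E \<le> exp (3 * L * D)" unfolding E_def using T L by (auto intro!: mult_left_mono)
    obtain w where w: "w \<in> words S" "\<forall>y\<in>M. \<bar>y - u\<bar> * E \<le> len J \<longrightarrow> \<bar>w y - w u\<bar> * len J \<le> E * (len J' * \<bar>y - u\<bar>)"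
      using walk_contraction[OF xs(1) J(1), of u] unfolding u_def E_def by blast
    have "\<bar>w y - w u\<bar> \<le> \<eta>" if y: "y \<in> M" "\<bar>y - u\<bar> \<le> \<delta>" for y
    proof -
      have "\<bar>y - u\<bar> * E \<le> \<delta> * exp (3 * L * D)" using y E by (intro mult_mono) auto
      hence yE: "\<bar>y - u\<bar> * E \<le> len J" unfolding \<delta>_def by simp
      hence "\<bar>w y - w u\<bar> * len J \<le> E * (len J' * \<bar>y - u\<bar>)" using w y by blast
      also have "\<dots> = len J' * (\<bar>y - u\<bar> * E)" by simp
      also have "\<dots> \<le> len J' * len J" using yE len by (intro mult_left_mono) auto
      finally show ?thesis using len pos by simp
    qed
    thus ?thesis using w(1) by blast
  qed
  moreover have "0 < \<delta>" unfolding \<delta>_def using pos by simp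
  ultimately show ?thesis using that pos by blast
qed

end

section \<open>Finitely generated nilpotent groups\<close>

definition commutator :: "('a, 'b) monoid_scheme \<Rightarrow> 'a \<Rightarrow> 'a \<Rightarrow> 'a" where
  "commutator G x y = x \<otimes>\<^bsub>G\<^esub> y \<otimes>\<^bsub>G\<^esub> inv\<^bsub>G\<^esub> x \<otimes>\<^bsub>G\<^esub> inv\<^bsub>G\<^esub> y"

lemma lower_central_series_Suc:
  "lower_central_series G (Suc n) =
     generate G {commutator G a b | a b. a \<in> lower_central_series G n \<and> b \<in> carrier G}"
  by (simp add: commutator_def)

context group
begin

lemma inv_cancel_left:
  assumes "x \<in> carrier G" "y \<in> carrier G"
  shows "x \<otimes> (inv x \<otimes> y) = y" "inv x \<otimes> (x \<otimes> y) = y"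
  using assms by (simp_all add: m_assoc[symmetric])

lemma mult_inv_eq_one_iff: "x \<in> carrier G \<Longrightarrow> y \<in> carrier G \<Longrightarrow> x \<otimes> inv y = \<one> \<longleftrightarrow> x = y"
  using inv_solve_right[of \<one> x y] by auto

lemma commute_inv:
  assumes "x \<in> carrier G" "y \<in> carrier G" "x \<otimes> y = y \<otimes> x"
  shows "inv x \<otimes> y = y \<otimes> inv x"
proof -
  have "inv x \<otimes> y = inv x \<otimes> (y \<otimes> x) \<otimes> inv x" using assms(1,2) by (simp add: m_assoc)
  also have "\<dots> = inv x \<otimes> (x \<otimes> y) \<otimes> inv x" by (simp only: assms(3))
  also have "\<dots> = y \<otimes> inv x" using assms(1,2) by (simp add: inv_cancel_left)
  finally show ?thesis .
qed

lemma commute_mult: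
  assumes "x \<in> carrier G" "y \<in> carrier G" "z \<in> carrier G" "x \<otimes> y = y \<otimes> x" "z \<otimes> y = y \<otimes> z"
  shows "x \<otimes> z \<otimes> y = y \<otimes> (x \<otimes> z)"
proof -
  have "x \<otimes> z \<otimes> y = x \<otimes> (y \<otimes> z)" using assms(1-3) by (simp only: m_assoc assms(5))
  also have "\<dots> = y \<otimes> x \<otimes> z" using assms(1-3) by (simp only: m_assoc[symmetric] assms(4))
  finally show ?thesis using assms(1-3) by (simp only: m_assoc)
qed

lemma commutator_closed [simp, intro]: "x \<in> carrier G \<Longrightarrow> y \<in> carrier G \<Longrightarrow> commutator G x y \<in> carrier G"
  by (simp add: commutator_def)

lemma commutator_eq: "x \<in> carrier G \<Longrightarrow> y \<in> carrier G \<Longrightarrow> x \<otimes> y = commutator G x y \<otimes> (y \<otimes> x)"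
  unfolding commutator_def by (simp add: m_assoc inv_cancel_left)

lemma commutator_eq_one_iff:
  assumes "x \<in> carrier G" "y \<in> carrier G"
  shows "commutator G x y = \<one> \<longleftrightarrow> x \<otimes> y = y \<otimes> x"
  using commutator_eq[OF assms] r_cancel_one[of "y \<otimes> x" "commutator G x y"] assms by auto

lemma lower_central_series_subgroup: "subgroup (lower_central_series G n) G"
proof (induction n)
  case (Suc n)
  show ?case unfolding lower_central_series_Suc
    by (rule generate_is_subgroup) (use subgroup.mem_carrier[OF Suc] in auto)
qed (simp add: subgroup_self)

lemma lower_central_series_commutator:
  "a \<in> lower_central_series G n \<Longrightarrow> b \<in> carrier G \<Longrightarrow> commutator G a b \<in> lower_central_series G (Suc n)"
  unfolding lower_central_series_Suc by (rule generate.incl) blast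

text \<open>In a group of nilpotency class \<open>n\<close> the two words \<open>thue_morse x y n\<close> are equal (Malcev), so that
  there is no free subsemigroup on two generators.\<close>

primrec thue_morse :: "'a \<Rightarrow> 'a \<Rightarrow> nat \<Rightarrow> 'a \<times> 'a" where
  "thue_morse x y 0 = (x, y)"
| "thue_morse x y (Suc n) =
     (fst (thue_morse x y n) \<otimes> snd (thue_morse x y n), snd (thue_morse x y n) \<otimes> fst (thue_morse x y n))"

text \<open>If \<open>X = Y \<otimes> c\<close>, then \<open>X \<otimes> Y\<close> and
  \<open>Y \<otimes> X\<close> differ by the commutator of \<open>inv c\<close> and
  \<open>inv Y\<close>, which lies one term further down the lower central series than
  \<open>c\<close>.\<close>

lemma thue_morse_quotient:
  assumes "x \<in> carrier G" "y \<in> carrier G"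
  shows "fst (thue_morse x y n) \<in> carrier G \<and> snd (thue_morse x y n) \<in> carrier G \<and>
    (\<exists>c\<in>lower_central_series G n. fst (thue_morse x y n) = snd (thue_morse x y n) \<otimes> c)"
proof (induction n)
  case 0
  thus ?case using assms by (auto intro!: bexI[of _ "inv y \<otimes> x"] simp: m_assoc[symmetric])
next
  case (Suc n)
  define X Y where "X = fst (thue_morse x y n)" and "Y = snd (thue_morse x y n)"
  obtain c where XY: "X \<in> carrier G" "Y \<in> carrier G" and c: "c \<in> lower_central_series G n" "X = Y \<otimes> c"
    using Suc unfolding X_def Y_def by blast
  note sub = lower_central_series_subgroup[of n]
  have cG: "c \<in> carrier G" by (rule subgroup.mem_carrier[OF sub c(1)])
  have "commutator G (inv c) (inv Y) \<in> lower_central_series G (Suc n)"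
    using subgroup.m_inv_closed[OF sub c(1)] XY by (intro lower_central_series_commutator) auto
  moreover have "X \<otimes> Y = Y \<otimes> X \<otimes> commutator G (inv c) (inv Y)"
    unfolding commutator_def c(2) using XY cG by (simp add: m_assoc inv_cancel_left)
  ultimately show ?case using XY unfolding thue_morse.simps X_def Y_def fst_conv snd_conv by blast
qed

lemma thue_morse_eq:
  assumes "lower_central_series G n = {\<one>}" "x \<in> carrier G" "y \<in> carrier G"
  shows "fst (thue_morse x y n) = snd (thue_morse x y n)"
  using thue_morse_quotient[OF assms(2,3), of n] assms(1) by auto

section \<open>The upper central series and quotients by its terms\<close>

primrec upper_central_series :: "nat \<Rightarrow> 'a set" where
  "upper_central_series 0 = {\<one>}"
| "upper_central_series (Suc n) =
     {x \<in> carrier G. \<forall>y\<in>carrier G. commutator G x y \<in> upper_central_series n}"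

lemma upper_central_series_top:
  assumes "lower_central_series G n = {\<one>}"
  shows "upper_central_series n = carrier G"
proof -
  have "lower_central_series G (n - i) \<subseteq> upper_central_series i" if "i \<le> n" for i
    using that
  proof (induction i)
    case (Suc i)
    show ?case
    proof
      fix x assume x: "x \<in> lower_central_series G (n - Suc i)"
      have "commutator G x y \<in> upper_central_series i" if "y \<in> carrier G" for y
        using lower_central_series_commutator[OF x that] Suc by (auto simp: Suc_diff_Suc)
      thus "x \<in> upper_central_series (Suc i)"
        using subgroup.mem_carrier[OF lower_central_series_subgroup x] by simp
    qed
  qed (use assms in simp)
  from this[of n] have "carrier G \<subseteq> upper_central_series n" by simp
  moreover have "upper_central_series n \<subseteq> carrier G" by (cases n) auto
  ultimately show ?thesis by blast
qed

end

context group_hom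
begin

lemma hom_eq_iff:
  assumes "x \<in> carrier G" "y \<in> carrier G"
  shows "h x = h y \<longleftrightarrow> x \<otimes> inv y \<in> kernel G H h"
proof -
  have "h (x \<otimes> inv y) = h x \<otimes>\<^bsub>H\<^esub> inv\<^bsub>H\<^esub> h y" using assms by simp
  moreover have "h x \<otimes>\<^bsub>H\<^esub> inv\<^bsub>H\<^esub> h y = \<one>\<^bsub>H\<^esub> \<longleftrightarrow> h x = h y"
    using assms by (intro H.mult_inv_eq_one_iff) auto
  ultimately show ?thesis using assms by (simp add: kernel_def)
qed

lemma hom_commutator:
  assumes "x \<in> carrier G" "y \<in> carrier G"
  shows "h (commutator G x y) = commutator H (h x) (h y)"
  using assms by (simp add: commutator_def)

lemma commutator_in_kernel_iff:
  assumes "x \<in> carrier G" "y \<in> carrier G"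
  shows "commutator G x y \<in> kernel G H h \<longleftrightarrow> h x \<otimes>\<^bsub>H\<^esub> h y = h y \<otimes>\<^bsub>H\<^esub> h x"
  using H.commutator_eq_one_iff[of "h x" "h y"] assms by (simp add: kernel_def hom_commutator)

text \<open>These are the elements whose image commutes with the image of \<open>G\<close>, and
  conjugation does not change that image. For the projection modulo one term of the upper central
  series this gives the normality of the next.\<close>

lemma central_mod_kernel_normal:
  "normal {x \<in> carrier G. \<forall>y\<in>carrier G. commutator G x y \<in> kernel G H h} G"
proof -
  let ?Z = "{x \<in> carrier G. \<forall>y\<in>carrier G. commutator G x y \<in> kernel G H h}"
  have Z: "x \<in> ?Z \<longleftrightarrow> x \<in> carrier G \<and> (\<forall>y\<in>carrier G. h x \<otimes>\<^bsub>H\<^esub> h y = h y \<otimes>\<^bsub>H\<^esub> h x)" for x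
    using commutator_in_kernel_iff by auto
  have "subgroup ?Z G"
  proof (rule G.subgroupI)
    show "?Z \<noteq> {}" using Z[of \<one>] by auto
    fix x assume x: "x \<in> ?Z"
    have "h (inv x) \<otimes>\<^bsub>H\<^esub> h y = h y \<otimes>\<^bsub>H\<^esub> h (inv x)" if "y \<in> carrier G" for y
    proof -
      have "h x \<otimes>\<^bsub>H\<^esub> h y = h y \<otimes>\<^bsub>H\<^esub> h x" using x that Z by blast
      thus ?thesis using x that H.commute_inv[of "h x" "h y"] by simp
    qed
    thus "inv x \<in> ?Z" using x Z[of "inv x"] by simp
    fix z assume z: "z \<in> ?Z"
    have "h (x \<otimes> z) \<otimes>\<^bsub>H\<^esub> h y = h y \<otimes>\<^bsub>H\<^esub> h (x \<otimes> z)" if "y \<in> carrier G" for y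
    proof -
      have "h x \<otimes>\<^bsub>H\<^esub> h y = h y \<otimes>\<^bsub>H\<^esub> h x" "h z \<otimes>\<^bsub>H\<^esub> h y = h y \<otimes>\<^bsub>H\<^esub> h z" using x z that Z by blast+
      thus ?thesis using x z that H.commute_mult[of "h x" "h y" "h z"] by simp
    qed
    thus "x \<otimes> z \<in> ?Z" using x z Z[of "x \<otimes> z"] by simp
  qed auto
  moreover have "g \<otimes> x \<otimes> inv g \<in> ?Z" if g: "g \<in> carrier G" and x: "x \<in> ?Z" for g x
  proof -
    have "h (g \<otimes> x \<otimes> inv g) = h x"
    proof -
      have "h g \<otimes>\<^bsub>H\<^esub> h x = h x \<otimes>\<^bsub>H\<^esub> h g" using x g Z[of x] by metis
      thus ?thesis using g x by (simp add: H.m_assoc H.inv_cancel_left)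
    qed
    thus ?thesis using x g Z[of x] Z[of "g \<otimes> x \<otimes> inv g"] by simp
  qed
  ultimately show ?thesis using G.normal_inv_iff by blast
qed

end

context normal
begin

lemma proj_hom: "group_hom G (G Mod H) ((#>) H)"
  by (intro group_hom.intro group_hom_axioms.intro r_coset_hom_Mod factorgroup_is_group is_group)

lemma proj_kernel: "kernel G (G Mod H) ((#>) H) = H"
proof -
  have *: "H #> x = H \<longleftrightarrow> x \<in> H" if "x \<in> carrier G" for x
    using coset_join1[OF _ that is_subgroup] coset_join2[OF that is_subgroup] by blast
  show ?thesis unfolding kernel_def FactGroup_def monoid.select_convs
    using * mem_carrier by blast
qed

end

context group
begin

lemma upper_central_series_normal: "normal (upper_central_series n) G"
proof (induction n)
  case 0
  show ?case using one_is_normal by simp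
next
  case (Suc n)
  interpret N: normal "upper_central_series n" G by (rule Suc)
  interpret proj: group_hom G "G Mod upper_central_series n" "(#>) (upper_central_series n)" by (rule N.proj_hom)
  show ?case using proj.central_mod_kernel_normal unfolding N.proj_kernel by simp
qed

lemma upper_central_series_subgroup: "subgroup (upper_central_series n) G"
  using upper_central_series_normal by (rule normal_imp_subgroup)

lemma upper_central_series_mono: "upper_central_series n \<subseteq> upper_central_series (Suc n)"
proof
  fix x assume x: "x \<in> upper_central_series n"
  interpret N: normal "upper_central_series n" G by (rule upper_central_series_normal)
  have xG: "x \<in> carrier G" by (rule N.mem_carrier[OF x])
  have "commutator G x y \<in> upper_central_series n" if y: "y \<in> carrier G" for y
  proof -
    have "commutator G x y = x \<otimes> (y \<otimes> inv x \<otimes> inv y)" unfolding commutator_def using xG y by (simp add: m_assoc)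
    thus ?thesis using N.inv_op_closed2[OF y N.m_inv_closed[OF x]] x by simp
  qed
  thus "x \<in> upper_central_series (Suc n)" using xG by simp
qed

section \<open>Torsion of the quotients of the upper central series\<close>

lemma pow_commutator_central:
  assumes G: "x \<in> carrier G" "s \<in> carrier G" "c \<in> carrier G"
    and c: "x \<otimes> s = c \<otimes> (s \<otimes> x)" "c \<otimes> x = x \<otimes> c"
  shows "x [^] (m::nat) \<otimes> s = c [^] m \<otimes> (s \<otimes> x [^] m)"
proof (induction m)
  case (Suc m)
  have "x [^] Suc m \<otimes> s = x [^] m \<otimes> (x \<otimes> s)" using G by (simp add: m_assoc)
  also have "\<dots> = (x [^] m \<otimes> c) \<otimes> (s \<otimes> x)" unfolding c(1) using G by (simp add: m_assoc)
  also have "x [^] m \<otimes> c = c \<otimes> x [^] m" using G c(2) by (intro group_commutes_pow) auto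
  also have "c \<otimes> x [^] m \<otimes> (s \<otimes> x) = c \<otimes> (x [^] m \<otimes> s) \<otimes> x" using G by (simp add: m_assoc)
  also have "\<dots> = (c \<otimes> c [^] m) \<otimes> (s \<otimes> (x [^] m \<otimes> x))" unfolding Suc using G by (simp add: m_assoc)
  also have "c \<otimes> c [^] m = c [^] Suc m" using G nat_pow_Suc2 by simp
  also have "x [^] m \<otimes> x = x [^] Suc m" by simp
  finally show ?case .
qed (use G in simp)

lemma commute_generate:
  assumes S: "S \<subseteq> carrier G" and x: "x \<in> carrier G" and comm: "\<And>s. s \<in> S \<Longrightarrow> x \<otimes> s = s \<otimes> x"
    and y: "y \<in> generate G S"
  shows "x \<otimes> y = y \<otimes> x"
  using y
proof (induction rule: generate.induct)
  case (inv s)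
  hence "s \<in> carrier G" "s \<otimes> x = x \<otimes> s" using S comm by auto
  thus ?case using commute_inv[of s x] x by simp
next
  case (eng a b)
  hence "a \<in> carrier G" "b \<in> carrier G" using generate_in_carrier[OF S] by auto
  thus ?case using commute_mult[of a x b] eng x by simp
qed (use x comm in auto)

lemma common_exponent:
  assumes "finite S" "\<And>s. s \<in> S \<Longrightarrow> f s \<in> carrier G" "subgroup N G"
    and "\<And>s. s \<in> S \<Longrightarrow> \<exists>m>0. f s [^] (m::nat) \<in> N"
  shows "\<exists>m>0. \<forall>s\<in>S. f s [^] (m::nat) \<in> N"
  using assms
proof (induction S rule: finite_induct)
  case (insert s S)
  interpret N: subgroup N G by (rule insert.prems)
  have pow: "x [^] (k * l) \<in> N" if "x \<in> carrier G" "x [^] k \<in> N" for x and k l :: nat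
  proof -
    have "(x [^] k) [^] l \<in> N" using that(2) by (induction l) auto
    thus ?thesis using that(1) by (simp add: nat_pow_pow)
  qed
  obtain m where m: "m > 0" "\<forall>s\<in>S. f s [^] (m::nat) \<in> N" using insert by auto
  obtain k where k: "k > 0" "f s [^] (k::nat) \<in> N" using insert.prems(3) by blast
  have "f s [^] (m * k) \<in> N" using pow[of "f s" k m] k insert.prems(1) by (simp add: mult.commute)
  moreover have "f t [^] (m * k) \<in> N" if "t \<in> S" for t using pow[of "f t" m k] m insert.prems(1) that by simp
  ultimately show ?case using m k by (intro exI[of _ "m * k"]) auto
qed auto

end

text \<open>Modulo the kernel, \<open>commutator G x s\<close> commutes with \<open>x\<close>, so
  the commutator of \<open>x [^] m\<close> with a generator \<open>s\<close> is the
  \<open>m\<close>-th power of that of \<open>x\<close>, hence trivial. Commuting with the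
  generators is enough.\<close>

lemma (in group_hom) power_central_mod_kernel:
  assumes S: "S \<subseteq> carrier G" "generate G S = carrier G" and x: "x \<in> carrier G"
    and comm: "\<And>s. s \<in> S \<Longrightarrow> h (commutator G x s) \<otimes>\<^bsub>H\<^esub> h x = h x \<otimes>\<^bsub>H\<^esub> h (commutator G x s)"
    and pow: "\<And>s. s \<in> S \<Longrightarrow> commutator G x s [^] (m::nat) \<in> kernel G H h"
    and y: "y \<in> carrier G"
  shows "commutator G (x [^] m) y \<in> kernel G H h"
proof -
  have xm: "h (x [^] m) = h x [^]\<^bsub>H\<^esub> m" using x by (rule hom_nat_pow)
  have gens: "h x [^]\<^bsub>H\<^esub> m \<otimes>\<^bsub>H\<^esub> h s = h s \<otimes>\<^bsub>H\<^esub> h x [^]\<^bsub>H\<^esub> m" if s: "s \<in> S" for s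
  proof -
    have sG: "s \<in> carrier G" using s S by auto
    define c where "c = commutator G x s"
    have c: "c \<in> carrier G" using x sG unfolding c_def by auto
    have "h (x \<otimes> s) = h (c \<otimes> (s \<otimes> x))" unfolding c_def using G.commutator_eq[OF x sG] by simp
    hence "h x \<otimes>\<^bsub>H\<^esub> h s = h c \<otimes>\<^bsub>H\<^esub> (h s \<otimes>\<^bsub>H\<^esub> h x)" using x sG c by simp
    hence "h x [^]\<^bsub>H\<^esub> m \<otimes>\<^bsub>H\<^esub> h s = h c [^]\<^bsub>H\<^esub> m \<otimes>\<^bsub>H\<^esub> (h s \<otimes>\<^bsub>H\<^esub> h x [^]\<^bsub>H\<^esub> m)"
      using x sG c comm[OF s] unfolding c_def[symmetric] by (intro H.pow_commutator_central) auto
    moreover have "h c [^]\<^bsub>H\<^esub> m = \<one>\<^bsub>H\<^esub>"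
      using pow[OF s] hom_nat_pow[OF c, of m] unfolding kernel_def c_def by simp
    ultimately show ?thesis using x sG by simp
  qed
  have "h y \<in> generate H (h ` S)" unfolding generate_img[OF S(1)] S(2) using y by (rule imageI)
  moreover have "h ` S \<subseteq> carrier H" using S(1) by auto
  ultimately have "h x [^]\<^bsub>H\<^esub> m \<otimes>\<^bsub>H\<^esub> h y = h y \<otimes>\<^bsub>H\<^esub> h x [^]\<^bsub>H\<^esub> m"
  proof (rule H.commute_generate[rotated 3])
    show "h x [^]\<^bsub>H\<^esub> m \<in> carrier H" using x by simp
    fix t assume "t \<in> h ` S"
    then obtain s where "s \<in> S" "t = h s" by blast
    thus "h x [^]\<^bsub>H\<^esub> m \<otimes>\<^bsub>H\<^esub> t = t \<otimes>\<^bsub>H\<^esub> h x [^]\<^bsub>H\<^esub> m" using gens by simp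
  qed
  thus ?thesis using x y xm by (simp add: commutator_in_kernel_iff)
qed

context group
begin

lemma power_in_next_center:
  assumes S: "finite S" "S \<subseteq> carrier G" "generate G S = carrier G"
    and x: "x \<in> upper_central_series (Suc (Suc n))"
    and pow: "\<And>s. s \<in> S \<Longrightarrow> \<exists>m>0. commutator G x s [^] (m::nat) \<in> upper_central_series n"
  shows "\<exists>m>0. x [^] (m::nat) \<in> upper_central_series (Suc n)"
proof -
  interpret N: normal "upper_central_series n" G by (rule upper_central_series_normal)
  note proj = N.proj_hom
  have xG: "x \<in> carrier G" using x by simp
  have xs: "commutator G x s \<in> carrier G" if "s \<in> S" for s using commutator_closed[OF xG] S(2) that by (simp add: subset_iff)
  have "\<exists>m>0. \<forall>s\<in>S. commutator G x s [^] (m::nat) \<in> upper_central_series n"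
    by (rule common_exponent[where f = "commutator G x", OF S(1) xs N.is_subgroup pow])
  then obtain m where m: "m > 0" "\<And>s. s \<in> S \<Longrightarrow> commutator G x s [^] (m::nat) \<in> upper_central_series n"
    by blast
  have "commutator G (x [^] m) y \<in> upper_central_series n" if y: "y \<in> carrier G" for y
  proof (rule group_hom.power_central_mod_kernel[OF proj S(2,3) xG _ _ y, unfolded N.proj_kernel])
    fix s assume s: "s \<in> S"
    show "commutator G x s [^] m \<in> upper_central_series n" by (rule m(2)[OF s])
    have "commutator G x s \<in> upper_central_series (Suc n)"
      using x s S(2) unfolding upper_central_series.simps(2)[of "Suc n"] by blast
    hence "commutator G (commutator G x s) x \<in> upper_central_series n" using xG by simp
    thus "(upper_central_series n #> commutator G x s) \<otimes>\<^bsub>G Mod upper_central_series n\<^esub> (upper_central_series n #> x)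
        = (upper_central_series n #> x) \<otimes>\<^bsub>G Mod upper_central_series n\<^esub> (upper_central_series n #> commutator G x s)"
      using group_hom.commutator_in_kernel_iff[OF proj xs[OF s] xG] unfolding N.proj_kernel by blast
  qed
  hence "x [^] m \<in> upper_central_series (Suc n)" using xG by simp
  thus ?thesis using m by blast
qed

text \<open>Torsion spreads upwards: an element of one quotient has finite order because its
  commutators with the finitely many generators have finite order one quotient below. The hypothesis
  on central commutators starts the induction.\<close>

lemma power_in_center_series:
  assumes S: "finite S" "S \<subseteq> carrier G" "generate G S = carrier G"
    and torsion: "\<And>a b. a \<in> carrier G \<Longrightarrow> b \<in> carrier G \<Longrightarrow> commutator G a b \<in> upper_central_series (Suc 0) \<Longrightarrow>
        \<exists>m>0. commutator G a b [^] (m::nat) = \<one>"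
  shows "x \<in> upper_central_series (Suc (Suc n)) \<Longrightarrow> \<exists>m>0. x [^] (m::nat) \<in> upper_central_series (Suc n)"
proof (induction n arbitrary: x)
  case 0
  show ?case
  proof (rule power_in_next_center[OF S 0])
    fix s assume "s \<in> S"
    hence s: "s \<in> carrier G" using S by auto
    have "x \<in> carrier G" "commutator G x s \<in> upper_central_series (Suc 0)"
      using 0 s unfolding upper_central_series.simps(2)[of "Suc 0"] by blast+
    from torsion[OF this(1) s this(2)]
    show "\<exists>m>0. commutator G x s [^] (m::nat) \<in> upper_central_series 0" by simp
  qed
next
  case (Suc n)
  show ?case
  proof (rule power_in_next_center[OF S Suc.prems])
    fix s assume "s \<in> S"
    hence "s \<in> carrier G" using S by auto
    hence "commutator G x s \<in> upper_central_series (Suc (Suc n))"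
      using Suc.prems unfolding upper_central_series.simps(2)[of "Suc (Suc n)"] by blast
    thus "\<exists>m>0. commutator G x s [^] (m::nat) \<in> upper_central_series (Suc n)" by (rule Suc.IH)
  qed
qed

end

text \<open>The first conclusion is Schreier's lemma; \<open>N\<close> has finite index in \<open>A\<close> because \<open>A / N\<close> is
  abelian, torsion and finitely generated.\<close>

lemma (in group_hom) finite_index_step:
  fixes S A
  defines "N \<equiv> kernel G H h"
  assumes A: "A = generate G S" "finite S" "S \<subseteq> carrier G" and NA: "N \<subseteq> A"
    and comm: "\<And>x y. x \<in> A \<Longrightarrow> y \<in> A \<Longrightarrow> commutator G x y \<in> N"
    and pow: "\<And>x. x \<in> A \<Longrightarrow> \<exists>m>0. x [^] (m::nat) \<in> N"
  shows "\<exists>U. finite U \<and> U \<subseteq> carrier G \<and> N = generate G U"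
    and "\<exists>T. finite T \<and> T \<subseteq> carrier G \<and> (\<forall>x\<in>A. \<exists>n\<in>N. \<exists>t\<in>T. x = n \<otimes> t)"
proof -
  interpret N: subgroup N G unfolding N_def by (rule subgroup_kernel)
  have sub: "subgroup A G" unfolding A(1) by (rule G.generate_is_subgroup[OF A(3)])
  interpret A: subgroup A G by (rule sub)
  have AG: "x \<in> A \<Longrightarrow> x \<in> carrier G" for x by (rule A.mem_carrier)
  have h_comm: "h x \<otimes>\<^bsub>H\<^esub> h y = h y \<otimes>\<^bsub>H\<^esub> h x" if "x \<in> A" "y \<in> A" for x y
    using commutator_in_kernel_iff[of x y] comm[OF that] that AG unfolding N_def by blast
  have h_eq: "h x = h y \<longleftrightarrow> x \<otimes> inv y \<in> N" if "x \<in> A" "y \<in> A" for x y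
    using hom_eq_iff[of x y] that AG unfolding N_def by blast
  have h_one: "h x = \<one>\<^bsub>H\<^esub>" if "x \<in> N" for x using that unfolding N_def kernel_def by blast
  \<comment> \<open>A finite set closed, modulo \<open>N\<close>, under right multiplication by
    \<open>R\<close>. A new element \<open>r\<close> is accommodated by multiplying with its powers
    below an exponent \<open>m\<close> for which \<open>r [^] m\<close> lies in \<open>N\<close>;
    commutativity modulo \<open>N\<close> keeps the earlier closure.\<close>
  have finite_reps: "\<exists>T. finite T \<and> T \<subseteq> A \<and> \<one> \<in> T \<and> (\<forall>t\<in>T. \<forall>s\<in>R. \<exists>t'\<in>T. h (t \<otimes> s) = h t')"
    if "finite R" "R \<subseteq> A" for R
    using that
  proof (induction R rule: finite_induct)
    case empty
    show ?case by (intro exI[of _ "{\<one>}"]) auto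
  next
    case (insert r R)
    then obtain T where T: "finite T" "T \<subseteq> A" "\<one> \<in> T" "\<forall>t\<in>T. \<forall>s\<in>R. \<exists>t'\<in>T. h (t \<otimes> s) = h t'" by auto
    have r: "r \<in> A" using insert by auto
    obtain m where m: "m > 0" "r [^] (m::nat) \<in> N" using pow[OF r] by blast
    have rA: "r [^] (i::nat) \<in> A" for i using r by (induction i) auto
    define T' where "T' = (\<lambda>(t, i). t \<otimes> r [^] (i::nat)) ` (T \<times> {..<m})"
    have mem: "t \<otimes> r [^] i \<in> T'" if "t \<in> T" "i < m" for t i unfolding T'_def using that by force
    have "finite T'" unfolding T'_def using T by auto
    moreover have "T' \<subseteq> A" unfolding T'_def using T rA by auto
    moreover have "\<one> \<in> T'" using mem[OF T(3) m(1)] by simp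
    moreover have "\<forall>t\<in>T'. \<forall>s\<in>insert r R. \<exists>t'\<in>T'. h (t \<otimes> s) = h t'"
    proof (intro ballI)
      fix t s assume t: "t \<in> T'" and s: "s \<in> insert r R"
      obtain t0 i where t0: "t0 \<in> T" "i < m" "t = t0 \<otimes> r [^] i" using t unfolding T'_def by auto
      have t0A: "t0 \<in> A" using t0 T by auto
      show "\<exists>t'\<in>T'. h (t \<otimes> s) = h t'"
      proof (cases "s \<in> R")
        case True
        hence sA: "s \<in> A" using insert.prems by auto
        obtain t1 where t1: "t1 \<in> T" "h (t0 \<otimes> s) = h t1" using T(4) t0 True by blast
        have G: "t0 \<in> carrier G" "s \<in> carrier G" "t1 \<in> carrier G" "r [^] i \<in> carrier G"
          using t0A sA t1(1) T(2) rA AG by auto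
        have "h (t \<otimes> s) = h t0 \<otimes>\<^bsub>H\<^esub> (h (r [^] i) \<otimes>\<^bsub>H\<^esub> h s)"
          unfolding t0(3) using G by (simp only: hom_mult G.m_closed H.m_assoc hom_closed)
        also have "h (r [^] i) \<otimes>\<^bsub>H\<^esub> h s = h s \<otimes>\<^bsub>H\<^esub> h (r [^] i)" by (rule h_comm[OF rA sA])
        also have "h t0 \<otimes>\<^bsub>H\<^esub> (h s \<otimes>\<^bsub>H\<^esub> h (r [^] i)) = h (t0 \<otimes> s) \<otimes>\<^bsub>H\<^esub> h (r [^] i)"
          using G by (simp only: hom_mult G.m_closed H.m_assoc hom_closed)
        also have "\<dots> = h (t1 \<otimes> r [^] i)" unfolding t1(2) using G by (simp only: hom_mult)
        finally show ?thesis using mem[OF t1(1) t0(2)] by blast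
      next
        case False
        hence sr: "s = r" using s by simp
        have tr: "t \<otimes> s = t0 \<otimes> r [^] Suc i" unfolding t0(3) sr using t0A r AG by (simp add: G.m_assoc)
        show ?thesis
        proof (cases "Suc i < m")
          case True
          thus ?thesis using mem[OF t0(1) True] unfolding tr by blast
        next
          case False
          hence "Suc i = m" using t0(2) by simp
          hence "h (t \<otimes> s) = h (t0 \<otimes> r [^] m)" unfolding tr by (simp only:)
          also have "\<dots> = h t0 \<otimes>\<^bsub>H\<^esub> h (r [^] m)" by (rule hom_mult[OF AG[OF t0A] AG[OF rA]])
          also have "\<dots> = h t0" unfolding h_one[OF m(2)] using t0A AG by simp
          finally have "h (t \<otimes> s) = h (t0 \<otimes> r [^] (0::nat))" using AG[OF t0A] by simp
          thus ?thesis using mem[OF t0(1) m(1)] by (rule bexI)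
        qed
      qed
    qed
    ultimately show ?case by (intro exI[of _ T'] conjI)
  qed
  define R where "R = S \<union> (\<lambda>s. inv s) ` S"
  have SA: "s \<in> A" if "s \<in> S" for s unfolding A(1) by (rule generate.incl[OF that])
  have R: "finite R" "R \<subseteq> A"
  proof -
    show "finite R" unfolding R_def using A(2) by simp
    have "inv s \<in> A" if "s \<in> S" for s by (rule A.m_inv_closed[OF SA[OF that]])
    thus "R \<subseteq> A" unfolding R_def using SA by blast
  qed
  obtain T where T: "finite T" "T \<subseteq> A" "\<one> \<in> T" "\<forall>t\<in>T. \<forall>s\<in>R. \<exists>t'\<in>T. h (t \<otimes> s) = h t'"
    using finite_reps[OF R] by (elim exE conjE)
  define rep where "rep t s = (SOME t'. t' \<in> T \<and> h (t \<otimes> s) = h t')" for t s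
  have rep: "rep t s \<in> T" "h (t \<otimes> s) = h (rep t s)" if "t \<in> T" "s \<in> R" for t s
  proof -
    have "\<exists>t'. t' \<in> T \<and> h (t \<otimes> s) = h t'" using T(4) that by blast
    from someI_ex[OF this] show "rep t s \<in> T" "h (t \<otimes> s) = h (rep t s)" unfolding rep_def by simp_all
  qed
  \<comment> \<open>The first part consists of Schreier generators. As \<open>T\<close> may contain
    several representatives of one coset, its elements lying in \<open>N\<close> are added, so that
    the remainder \<open>t\<close> of an element of \<open>N\<close> is itself generated.\<close>
  define U where "U = (\<lambda>(t, s). t \<otimes> s \<otimes> inv (rep t s)) ` (T \<times> R) \<union> (T \<inter> N)"
  have "finite U" unfolding U_def using T R by auto
  have UN: "U \<subseteq> N"
  proof -
    have "t \<otimes> s \<otimes> inv (rep t s) \<in> N" if "t \<in> T" "s \<in> R" for t s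
    proof -
      have "t \<otimes> s \<in> A" "rep t s \<in> A" using rep(1)[OF that] that T(2) R(2) by auto
      from h_eq[OF this] rep(2)[OF that] show ?thesis by simp
    qed
    thus ?thesis unfolding U_def by auto
  qed
  have UG: "U \<subseteq> carrier G" using UN N.subset by blast
  have genN: "generate G U \<subseteq> N" using UN by (rule G.generate_subgroup_incl) (rule N.is_subgroup)
  \<comment> \<open>Reading \<open>x\<close> letter by letter from \<open>t\<close>, each letter
    replaces the representative and leaves a Schreier generator on its left. For
    \<open>t = \<one>\<close> this decomposes \<open>x\<close>.\<close>
  have key: "\<forall>t\<in>T. \<exists>n\<in>generate G U. \<exists>t'\<in>T. t \<otimes> x = n \<otimes> t'" if "x \<in> A" for x
    using that unfolding A(1)
  proof (induction rule: generate.induct)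
    case one
    show ?case
    proof
      fix t assume "t \<in> T"
      thus "\<exists>n\<in>generate G U. \<exists>t'\<in>T. t \<otimes> \<one> = n \<otimes> t'"
        using T AG by (intro bexI[of _ \<one>] bexI[of _ t] generate.one) auto
    qed
  next
    have gen: "\<exists>n\<in>generate G U. \<exists>t'\<in>T. t \<otimes> s = n \<otimes> t'" if "t \<in> T" "s \<in> R" for t s
    proof (intro bexI)
      show "t \<otimes> s = t \<otimes> s \<otimes> inv (rep t s) \<otimes> rep t s"
      proof -
        have "t \<in> carrier G" "s \<in> carrier G" "rep t s \<in> carrier G" using that rep(1)[OF that] T(2) R(2) AG by auto
        thus ?thesis by (simp add: G.m_assoc)
      qed
      show "t \<otimes> s \<otimes> inv (rep t s) \<in> generate G U" unfolding U_def using that by (intro generate.incl) auto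
    qed (rule rep[OF that])
    {
      case (incl s) thus ?case using gen unfolding R_def by blast
    next
      case (inv s) thus ?case using gen unfolding R_def by blast
    }
  next
    case (eng x y)
    have xy: "x \<in> carrier G" "y \<in> carrier G" using eng(1,2) G.generate_in_carrier[OF A(3)] by auto
    show ?case
    proof
      fix t assume t: "t \<in> T"
      obtain n1 t1 where 1: "n1 \<in> generate G U" "t1 \<in> T" "t \<otimes> x = n1 \<otimes> t1" using eng.IH(1) t by blast
      obtain n2 t2 where 2: "n2 \<in> generate G U" "t2 \<in> T" "t1 \<otimes> y = n2 \<otimes> t2" using eng.IH(2) 1 by blast
      have car: "t \<in> carrier G" "t1 \<in> carrier G" "t2 \<in> carrier G" "n1 \<in> carrier G" "n2 \<in> carrier G"
        using t 1 2 T(2) AG G.generate_in_carrier[OF UG] by auto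
      have "t \<otimes> (x \<otimes> y) = (t \<otimes> x) \<otimes> y" using car xy by (simp add: G.m_assoc)
      also have "\<dots> = n1 \<otimes> (t1 \<otimes> y)" unfolding 1(3) using car xy by (simp add: G.m_assoc)
      also have "\<dots> = (n1 \<otimes> n2) \<otimes> t2" unfolding 2(3) using car by (simp add: G.m_assoc)
      finally show "\<exists>n\<in>generate G U. \<exists>t'\<in>T. t \<otimes> (x \<otimes> y) = n \<otimes> t'"
        using generate.eng[OF 1(1) 2(1)] 2(2) by blast
    qed
  qed
  have decomp: "\<exists>n\<in>generate G U. \<exists>t\<in>T. x = n \<otimes> t" if "x \<in> A" for x
    using key[OF that] T(3) AG[OF that] by (metis G.l_one)
  have "N \<subseteq> generate G U"
  proof
    fix x assume x: "x \<in> N"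
    obtain n t where nt: "n \<in> generate G U" "t \<in> T" "x = n \<otimes> t" using decomp x NA by blast
    have car: "n \<in> carrier G" "t \<in> carrier G" using nt T(2) AG G.generate_in_carrier[OF UG] by auto
    have "t = inv n \<otimes> x" unfolding nt(3) using car by (simp add: G.inv_cancel_left)
    moreover have "inv n \<otimes> x \<in> N" using nt(1) genN x by auto
    ultimately have "t \<in> U" unfolding U_def using nt(2) by simp
    thus "x \<in> generate G U" unfolding nt(3) using nt(1) generate.incl generate.eng by metis
  qed
  hence "N = generate G U" using genN by blast
  thus "\<exists>U. finite U \<and> U \<subseteq> carrier G \<and> N = generate G U" using \<open>finite U\<close> UG by blast
  show "\<exists>T. finite T \<and> T \<subseteq> carrier G \<and> (\<forall>x\<in>A. \<exists>n\<in>N. \<exists>t\<in>T. x = n \<otimes> t)"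
  proof (intro exI[of _ T] conjI ballI)
    show "\<exists>n\<in>N. \<exists>t\<in>T. x = n \<otimes> t" if "x \<in> A" for x using decomp[OF that] genN by blast
  qed (use T AG in auto)
qed

context group
begin

theorem virtually_abelian_if_central_commutators_torsion:
  assumes fg: "finitely_generated_group G" and nil: "nilpotent_group G"
    and torsion: "\<And>a b. a \<in> carrier G \<Longrightarrow> b \<in> carrier G \<Longrightarrow>
        (\<And>x. x \<in> carrier G \<Longrightarrow> commutator G a b \<otimes> x = x \<otimes> commutator G a b) \<Longrightarrow>
        \<exists>m>0. commutator G a b [^] (m::nat) = \<one>"
  shows "virtually_abelian_group G"
proof -
  obtain S where S: "finite S" "S \<subseteq> carrier G" "generate G S = carrier G"
    using fg unfolding finitely_generated_group_def by blast
  obtain n0 where "lower_central_series G n0 = {\<one>}" using nil unfolding nilpotent_group_def by blast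
  hence top: "upper_central_series n0 = carrier G" by (rule upper_central_series_top)
  \<comment> \<open>One more than a class bound, so that \<open>n0\<close> descending steps end at
    the centre, also when \<open>n0 = 0\<close>.\<close>
  define n where "n = Suc n0"
  have top: "upper_central_series n = carrier G"
    using upper_central_series_mono[of n0] top unfolding n_def by auto
  define Z where "Z = upper_central_series (Suc 0)"
  have Z_iff: "x \<in> Z \<longleftrightarrow> x \<in> carrier G \<and> (\<forall>y\<in>carrier G. x \<otimes> y = y \<otimes> x)" for x
    unfolding Z_def using commutator_eq_one_iff by auto
  have torsion': "\<exists>m>0. commutator G a b [^] (m::nat) = \<one>"
    if "a \<in> carrier G" "b \<in> carrier G" "commutator G a b \<in> upper_central_series (Suc 0)" for a b
    using torsion[OF that(1,2)] that(3) Z_iff unfolding Z_def by blast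
  note pow = power_in_center_series[OF S torsion']
  \<comment> \<open>Both properties must descend together: the next index is shown to be finite by
    using generators of the current term.\<close>
  have "(\<exists>U. finite U \<and> U \<subseteq> carrier G \<and> upper_central_series (n - i) = generate G U) \<and>
      (\<exists>T. finite T \<and> T \<subseteq> carrier G \<and> (\<forall>x\<in>carrier G. \<exists>z\<in>upper_central_series (n - i). \<exists>t\<in>T. x = z \<otimes> t))"
    if "i < n" for i
    using that
  proof (induction i)
    case 0
    have "\<exists>z\<in>upper_central_series n. \<exists>t\<in>{\<one>}. x = z \<otimes> t" if "x \<in> carrier G" for x using that top by simp
    thus ?case using S top by (intro conjI exI[of _ S] exI[of _ "{\<one>}"]) auto
  next
    case (Suc i)
    define j where "j = n - Suc i - 1"
    have j: "n - i = Suc (Suc j)" "n - Suc i = Suc j" using Suc.prems unfolding j_def by auto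
    obtain U T where U: "finite U" "U \<subseteq> carrier G" "upper_central_series (Suc (Suc j)) = generate G U"
      and T: "finite T" "T \<subseteq> carrier G" "\<And>x. x \<in> carrier G \<Longrightarrow> \<exists>z\<in>upper_central_series (Suc (Suc j)). \<exists>t\<in>T. x = z \<otimes> t"
      using Suc.IH[OF Suc_lessD[OF Suc.prems]] unfolding j by blast
    have comm: "commutator G x y \<in> upper_central_series (Suc j)"
      if "x \<in> upper_central_series (Suc (Suc j))" "y \<in> upper_central_series (Suc (Suc j))" for x y
      using that unfolding upper_central_series.simps(2)[of "Suc j"] by blast
    interpret N: normal "upper_central_series (Suc j)" G by (rule upper_central_series_normal)
    note step = group_hom.finite_index_step[OF N.proj_hom U(3,1,2), unfolded N.proj_kernel,
        OF upper_central_series_mono comm pow]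
    obtain T' where T': "finite T'" "T' \<subseteq> carrier G"
      "\<And>x. x \<in> upper_central_series (Suc (Suc j)) \<Longrightarrow> \<exists>z\<in>upper_central_series (Suc j). \<exists>t\<in>T'. x = z \<otimes> t"
      using step(2) by blast
    define T2 where "T2 = (\<lambda>z. fst z \<otimes> snd z) ` (T' \<times> T)"
    have "\<forall>x\<in>carrier G. \<exists>z\<in>upper_central_series (Suc j). \<exists>t\<in>T2. x = z \<otimes> t"
    proof
      fix x assume x: "x \<in> carrier G"
      obtain y t where y: "y \<in> upper_central_series (Suc (Suc j))" "t \<in> T" "x = y \<otimes> t" using T(3)[OF x] by blast
      obtain z t' where z: "z \<in> upper_central_series (Suc j)" "t' \<in> T'" "y = z \<otimes> t'" using T'(3)[OF y(1)] by blast
      have "z \<in> carrier G" by (rule N.mem_carrier[OF z(1)])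
      moreover have "t \<in> carrier G" "t' \<in> carrier G" using y(2) z(2) T(2) T'(2) by blast+
      ultimately have "x = z \<otimes> (t' \<otimes> t)" unfolding y(3) z(3) by (simp only: m_assoc)
      moreover have "t' \<otimes> t \<in> T2" unfolding T2_def using y(2) z(2) by (intro image_eqI[of _ _ "(t', t)"]) simp_all
      ultimately show "\<exists>z\<in>upper_central_series (Suc j). \<exists>t\<in>T2. x = z \<otimes> t"
        using z(1) by (intro bexI[of _ "t' \<otimes> t"] bexI[of _ z])
    qed
    moreover have "finite T2" unfolding T2_def using T(1) T'(1) by simp
    moreover have "T2 \<subseteq> carrier G"
    proof
      fix y assume "y \<in> T2"
      then obtain z where z: "y = fst z \<otimes> snd z" "z \<in> T' \<times> T" unfolding T2_def by (rule imageE)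
      have "fst z \<in> T'" "snd z \<in> T" using z(2) by (simp_all add: mem_Times_iff)
      thus "y \<in> carrier G" unfolding z(1) by (intro m_closed subsetD[OF T(2)] subsetD[OF T'(2)])
    qed
    ultimately have fin: "\<exists>T. finite T \<and> T \<subseteq> carrier G \<and>
        (\<forall>x\<in>carrier G. \<exists>z\<in>upper_central_series (Suc j). \<exists>t\<in>T. x = z \<otimes> t)" by (intro exI[of _ T2] conjI)
    have "\<exists>U. finite U \<and> U \<subseteq> carrier G \<and> upper_central_series (Suc j) = generate G U" by (rule step(1))
    thus ?case unfolding j(2) using fin by (rule conjI)
  qed
  moreover have "n0 < n" "n - n0 = Suc 0" unfolding n_def by simp_all
  ultimately have "\<exists>T. finite T \<and> T \<subseteq> carrier G \<and> (\<forall>x\<in>carrier G. \<exists>z\<in>Z. \<exists>t\<in>T. x = z \<otimes> t)"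
    unfolding Z_def by metis
  then obtain T where T: "finite T" "T \<subseteq> carrier G" "\<And>x. x \<in> carrier G \<Longrightarrow> \<exists>z\<in>Z. \<exists>t\<in>T. x = z \<otimes> t"
    by blast
  have Z: "subgroup Z G" unfolding Z_def by (rule upper_central_series_subgroup)
  interpret Z: group "G\<lparr>carrier := Z\<rparr>" by (rule subgroup_imp_group[OF Z])
  have "comm_group (G\<lparr>carrier := Z\<rparr>)"
  proof (rule Z.group_comm_groupI)
    fix x y assume "x \<in> carrier (G\<lparr>carrier := Z\<rparr>)" "y \<in> carrier (G\<lparr>carrier := Z\<rparr>)"
    hence "x \<in> Z" "y \<in> Z" by simp_all
    hence "x \<otimes> y = y \<otimes> x" using Z_iff by blast
    thus "x \<otimes>\<^bsub>G\<lparr>carrier := Z\<rparr>\<^esub> y = y \<otimes>\<^bsub>G\<lparr>carrier := Z\<rparr>\<^esub> x" by simp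
  qed
  moreover have "rcosets Z \<subseteq> (\<lambda>t. Z #> t) ` T"
  proof
    fix C assume "C \<in> rcosets Z"
    then obtain x where x: "x \<in> carrier G" "C = Z #> x" unfolding RCOSETS_def by blast
    obtain z t where z: "z \<in> Z" "t \<in> T" "x = z \<otimes> t" using T(3)[OF x(1)] by blast
    have car: "z \<in> carrier G" "t \<in> carrier G" using z(1,2) T(2) Z_iff by blast+
    have "C = (Z #> z) #> t" unfolding x(2) z(3) by (rule coset_mult_assoc[OF subgroup.subset[OF Z] car, symmetric])
    also have "Z #> z = Z" by (rule coset_join2[OF car(1) Z z(1)])
    finally show "C \<in> (\<lambda>t. Z #> t) ` T" using z(2) by blast
  qed
  hence "finite (rcosets Z)" using T(1) finite_subset by blast
  ultimately show ?thesis unfolding virtually_abelian_group_def using Z by blast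
qed

end

section \<open>Minimal sets and central commutators\<close>

lemma minimal_compact_invariant:
  fixes C :: "real set"
  assumes C: "compact C" "C \<noteq> {}" "\<forall>g\<in>H. \<forall>x\<in>C. g x \<in> C"
  shows "\<exists>M\<subseteq>C. compact M \<and> M \<noteq> {} \<and> (\<forall>g\<in>H. \<forall>x\<in>M. g x \<in> M) \<and>
    (\<forall>M'\<subseteq>M. compact M' \<longrightarrow> M' \<noteq> {} \<longrightarrow> (\<forall>g\<in>H. \<forall>x\<in>M'. g x \<in> M') \<longrightarrow> M' = M)"
proof -
  define good where "good M \<longleftrightarrow> M \<subseteq> C \<and> compact M \<and> M \<noteq> {} \<and> (\<forall>g\<in>H. \<forall>x\<in>M. g x \<in> M)" for M
  \<comment> \<open>Complements turn the search for a minimal set into one for a maximal element;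
    the intersection of a chain of nonempty compact sets is nonempty.\<close>
  have "\<exists>W\<in>uminus ` {M. good M}. \<forall>X\<in>uminus ` {M. good M}. W \<subseteq> X \<longrightarrow> X = W"
  proof (rule subset_Zorn_nonempty)
    show "uminus ` {M. good M} \<noteq> {}" using C unfolding good_def by blast
    fix \<C> assume ne: "\<C> \<noteq> {}" and chain: "subset.chain (uminus ` {M. good M}) \<C>"
    define \<F> where "\<F> = uminus ` \<C>"
    have good: "good M" if "M \<in> \<F>" for M
      using that chain unfolding \<F>_def subset_chain_def by force
    have ne': "\<F> \<noteq> {}" using ne unfolding \<F>_def by blast
    have cl: "closed M" if "M \<in> \<F>" for M using good[OF that] compact_imp_closed unfolding good_def by blast
    have "\<Inter>\<F> \<noteq> {}"
    proof (rule compact_chain)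
      show "\<And>S. S \<in> \<F> \<Longrightarrow> compact S" "{} \<notin> \<F>" using good unfolding good_def by blast+
      show "S \<subseteq> T \<or> T \<subseteq> S" if "S \<in> \<F> \<and> T \<in> \<F>" for S T
        using that chain unfolding \<F>_def subset_chain_def by (metis Compl_subset_Compl_iff imageE)
    qed
    moreover obtain M0 where M0: "M0 \<in> \<F>" using ne' by blast
    have "compact (\<Inter>\<F>)"
    proof -
      have "compact (M0 \<inter> \<Inter>\<F>)" using good[OF M0] cl unfolding good_def by (intro compact_Int_closed closed_Inter) auto
      moreover have "M0 \<inter> \<Inter>\<F> = \<Inter>\<F>" using M0 by blast
      ultimately show ?thesis by simp
    qed
    ultimately have "good (\<Inter>\<F>)" using good M0 unfolding good_def by blast
    moreover have "\<Union>\<C> = - \<Inter>\<F>" unfolding \<F>_def by auto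
    ultimately show "\<Union>\<C> \<in> uminus ` {M. good M}" by blast
  qed
  then obtain M where M: "good M" "\<And>M'. good M' \<Longrightarrow> - M \<subseteq> - M' \<Longrightarrow> - M' = - M" by auto
  have "M' = M" if "M' \<subseteq> M" "compact M'" "M' \<noteq> {}" "\<forall>g\<in>H. \<forall>x\<in>M'. g x \<in> M'" for M'
  proof -
    have "good M'" using that M(1) unfolding good_def by blast
    hence "- M' = - M" using M(2) \<open>M' \<subseteq> M\<close> by blast
    thus ?thesis by (simp only: compl_eq_compl_iff)
  qed
  thus ?thesis using M(1) unfolding good_def by blast
qed

lemma Cantor_set_between:
  fixes K :: "real set"
  assumes K: "Cantor_set K" and xy: "x \<in> K" "y \<in> K" "x < y"
  shows "\<exists>t. x < t \<and> t < y \<and> t \<notin> K"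
proof (rule ccontr)
  assume *: "\<not> ?thesis"
  have "{x..y} \<subseteq> K"
  proof
    fix t assume "t \<in> {x..y}"
    thus "t \<in> K" using * xy by (cases "t = x \<or> t = y") auto
  qed
  hence "{x..y} \<subseteq> connected_component_set K x"
    using xy by (intro connected_component_maximal) auto
  moreover have "connected_component_set K x = {x}" using K xy unfolding Cantor_set_def by blast
  moreover have "y \<in> {x..y}" using xy by simp
  ultimately have "y \<in> {x}" by blast
  thus False using xy by simp
qed

locale Diff_subgroup =
  fixes K :: "real set" and H :: "(real \<Rightarrow> real) set" and G
  defines "G \<equiv> (Diff_1Lip_group K)\<lparr>carrier := H\<rparr>"
  assumes Cantor: "Cantor_set K" and sub: "subgroup H (Diff_1Lip_group K)"
begin

sublocale group G
  unfolding G_def by (rule group.subgroup_imp_group[OF group_Diff_1Lip sub])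

lemma carrier_H: "carrier G = H" by (simp add: G_def)

lemma compact_K: "compact K"
  using Cantor by (simp add: Cantor_set_def)

lemma H_Diff: "f \<in> H \<Longrightarrow> f \<in> Diff_1Lip K"
  using subgroup.subset[OF sub] by auto

lemma in_K: "f \<in> H \<Longrightarrow> x \<in> K \<Longrightarrow> f x \<in> K"
  using Diff_1Lip_in H_Diff by blast

lemma maps_K: "f \<in> H \<Longrightarrow> f ` K \<subseteq> K"
  using in_K by blast

lemma cont_K: "f \<in> H \<Longrightarrow> continuous_on K f"
  using Diff_1Lip_continuous H_Diff by blast

lemma mult_apply: "f \<in> H \<Longrightarrow> g \<in> H \<Longrightarrow> x \<in> K \<Longrightarrow> (f \<otimes>\<^bsub>G\<^esub> g) x = f (g x)"
  using mult_Diff_1Lip[of f K g x] H_Diff by (simp add: G_def)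

lemma one_apply: "x \<in> K \<Longrightarrow> \<one>\<^bsub>G\<^esub> x = x"
  by (simp add: G_def one_Diff_1Lip)

lemma inv_apply:
  assumes "f \<in> H" "x \<in> K"
  shows "(inv\<^bsub>G\<^esub> f) (f x) = x" "f ((inv\<^bsub>G\<^esub> f) x) = x"
proof -
  have f: "f \<in> carrier G" using assms carrier_H by simp
  hence f': "inv\<^bsub>G\<^esub> f \<in> H" using inv_closed carrier_H by blast
  show "(inv\<^bsub>G\<^esub> f) (f x) = x" using mult_apply[OF f' assms] l_inv[OF f] one_apply[OF assms(2)] by simp
  show "f ((inv\<^bsub>G\<^esub> f) x) = x" using mult_apply[OF assms(1) f' assms(2)] r_inv[OF f] one_apply[OF assms(2)] by simp
qed

lemma pow_apply:
  assumes "f \<in> H" "x \<in> K"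
  shows "(f [^]\<^bsub>G\<^esub> (n::nat)) x = (f ^^ n) x"
  using assms(2)
proof (induction n arbitrary: x)
  case (Suc n)
  have "f [^]\<^bsub>G\<^esub> n \<in> H" using nat_pow_closed[of f n] assms carrier_H by simp
  thus ?case using mult_apply Suc assms(1) in_K by (simp add: funpow_swap1)
qed (simp add: one_apply)

lemma closed_H: "f \<in> H \<Longrightarrow> g \<in> H \<Longrightarrow> f \<otimes>\<^bsub>G\<^esub> g \<in> H" "f \<in> H \<Longrightarrow> inv\<^bsub>G\<^esub> f \<in> H"
  "\<one>\<^bsub>G\<^esub> \<in> H" "f \<in> H \<Longrightarrow> f [^]\<^bsub>G\<^esub> (n::nat) \<in> H"
  using m_closed[of f g] inv_closed[of f] one_closed nat_pow_closed[of f n] carrier_H by auto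

lemma eqI: "f \<in> H \<Longrightarrow> g \<in> H \<Longrightarrow> (\<And>x. x \<in> K \<Longrightarrow> f x = g x) \<Longrightarrow> f = g"
  using Diff_1Lip_eqI H_Diff by blast

section \<open>Minimal sets and transport inside them\<close>

definition minimal :: "real set \<Rightarrow> bool" where
  "minimal M \<longleftrightarrow> M \<subseteq> K \<and> compact M \<and> M \<noteq> {} \<and> (\<forall>g\<in>H. \<forall>x\<in>M. g x \<in> M) \<and>
     (\<forall>M'. M' \<subseteq> M \<longrightarrow> compact M' \<longrightarrow> M' \<noteq> {} \<longrightarrow> (\<forall>g\<in>H. \<forall>x\<in>M'. g x \<in> M') \<longrightarrow> M' = M)"

lemma minimalD:
  assumes "minimal M"
  shows "M \<subseteq> K" "compact M" "M \<noteq> {}" "\<And>g x. g \<in> H \<Longrightarrow> x \<in> M \<Longrightarrow> g x \<in> M"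
  using assms unfolding minimal_def by simp_all

lemma minimal_eq:
  assumes "minimal M" "M' \<subseteq> M" "compact M'" "M' \<noteq> {}" "\<And>g. g \<in> H \<Longrightarrow> g ` M' \<subseteq> M'"
  shows "M' = M"
  using assms unfolding minimal_def by (simp add: image_subset_iff)

lemma minimal_exists:
  assumes "C \<subseteq> K" "compact C" "C \<noteq> {}" "\<And>g x. g \<in> H \<Longrightarrow> x \<in> C \<Longrightarrow> g x \<in> C"
  obtains M where "minimal M" "M \<subseteq> C"
proof -
  obtain M where M: "M \<subseteq> C" "compact M" "M \<noteq> {}" "\<forall>g\<in>H. \<forall>x\<in>M. g x \<in> M"
    "\<forall>M'\<subseteq>M. compact M' \<longrightarrow> M' \<noteq> {} \<longrightarrow> (\<forall>g\<in>H. \<forall>x\<in>M'. g x \<in> M') \<longrightarrow> M' = M"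
    using minimal_compact_invariant[of C H] assms(2-4) by blast
  have "minimal M" unfolding minimal_def using assms(1) M by blast
  thus thesis using that M(1) by blast
qed

lemma minimal_orbit_dense:
  assumes M: "minimal M" and z: "z \<in> M" and p: "p \<in> M" and \<rho>: "0 < \<rho>"
  shows "\<exists>g\<in>H. \<bar>g z - p\<bar> < \<rho>"
proof -
  define R where "R = (\<lambda>g. g z) ` H"
  have M': "M \<subseteq> K" "compact M" "\<And>g x. g \<in> H \<Longrightarrow> x \<in> M \<Longrightarrow> g x \<in> M" by (fact minimalD[OF M])+
  have "R \<subseteq> M" unfolding R_def using M' z by blast
  hence RM: "closure R \<subseteq> M" using M'(2) compact_imp_closed closure_minimal by blast
  have inv: "g ` closure R \<subseteq> closure R" if g: "g \<in> H" for g
  proof (rule image_closure_subset)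
    show "continuous_on (closure R) g" using cont_K[OF g] RM M'(1) by (blast intro: continuous_on_subset)
    have "g (f z) \<in> R" if f: "f \<in> H" for f
    proof -
      have "g (f z) = (g \<otimes>\<^bsub>G\<^esub> f) z" using mult_apply[OF g f, of z] z M'(1) by auto
      thus ?thesis unfolding R_def using closed_H(1)[OF g f] by (rule image_eqI)
    qed
    thus "g ` R \<subseteq> closure R" using closure_subset[of R] unfolding R_def by blast
  qed simp
  have "closure R = M"
  proof -
    have "compact (closure R)" using RM M'(2) bounded_subset unfolding compact_eq_bounded_closed by blast
    moreover have "closure R \<noteq> {}" using closed_H(3) closure_subset[of R] unfolding R_def by blast
    ultimately show ?thesis using minimal_eq[OF M RM] inv by simp
  qed
  hence "p \<in> closure R" using p by simp
  then obtain q where "q \<in> R" "dist q p < \<rho>" using \<rho> unfolding closure_approachable by blast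
  thus ?thesis unfolding R_def dist_real_def by blast
qed

text \<open>The number \<open>\<eta>\<close> is a Lebesgue number of a cover given by dense orbits.
  Its independence of \<open>x\<close> matters because contracting words bring a neighbourhood to a
  place that is not known beforehand.\<close>

lemma minimal_uniform_transport:
  assumes M: "minimal M" and p: "p \<in> M" and \<rho>: "0 < \<rho>"
  obtains \<eta> where "0 < \<eta>" "\<And>x. x \<in> M \<Longrightarrow> \<exists>g\<in>H. \<forall>y\<in>M. \<bar>y - x\<bar> < \<eta> \<longrightarrow> \<bar>g y - p\<bar> < \<rho>"
proof -
  have M': "M \<subseteq> K" "compact M" by (fact minimalD[OF M])+
  define \<V> where "\<V> = {V. open V \<and> (\<exists>g\<in>H. \<forall>y\<in>V \<inter> M. \<bar>g y - p\<bar> < \<rho>)}"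
  have "M \<subseteq> \<Union>\<V>"
  proof
    fix z assume z: "z \<in> M"
    obtain g where g: "g \<in> H" "\<bar>g z - p\<bar> < \<rho>" using minimal_orbit_dense[OF M z p \<rho>] by blast
    define \<sigma> where "\<sigma> = \<rho> - \<bar>g z - p\<bar>"
    have "0 < \<sigma>" unfolding \<sigma>_def using g by simp
    then obtain d where d: "0 < d" "\<And>y. y \<in> K \<Longrightarrow> dist y z < d \<Longrightarrow> dist (g y) (g z) < \<sigma>"
      using cont_K[OF g(1)] z M'(1) unfolding continuous_on_iff by (meson subsetD)
    have "\<bar>g y - p\<bar> < \<rho>" if "y \<in> ball z d \<inter> M" for y
    proof -
      have "dist (g y) (g z) < \<sigma>" using that M'(1) by (intro d(2)) (auto simp: dist_commute)
      thus ?thesis unfolding \<sigma>_def dist_real_def by linarith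
    qed
    hence "ball z d \<in> \<V>" unfolding \<V>_def using g(1) by blast
    thus "z \<in> \<Union>\<V>" using d(1) by (intro UnionI[of "ball z d"]) auto
  qed
  then obtain \<eta> where \<eta>: "0 < \<eta>" "\<And>x. x \<in> M \<Longrightarrow> \<exists>V\<in>\<V>. ball x \<eta> \<subseteq> V"
    using Heine_Borel_lemma[OF M'(2), of \<V>] unfolding \<V>_def by blast
  have "\<exists>g\<in>H. \<forall>y\<in>M. \<bar>y - x\<bar> < \<eta> \<longrightarrow> \<bar>g y - p\<bar> < \<rho>" if x: "x \<in> M" for x
  proof -
    obtain V where V: "V \<in> \<V>" "ball x \<eta> \<subseteq> V" using \<eta>(2)[OF x] by blast
    then obtain g where g: "g \<in> H" "\<forall>y\<in>V \<inter> M. \<bar>g y - p\<bar> < \<rho>" unfolding \<V>_def by blast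
    have "y \<in> V" if "\<bar>y - x\<bar> < \<eta>" for y using V(2) that by (auto simp: dist_real_def)
    thus ?thesis using g by blast
  qed
  thus ?thesis using that \<eta>(1) by blast
qed

text \<open>Two nearby points are found at an accumulation point of \<open>M\<close> and carried
  close to \<open>u\<close> by an element of \<open>H\<close>, which is injective.\<close>

lemma minimal_two_points:
  assumes M: "minimal M" "infinite M" and u: "u \<in> M" and \<delta>: "0 < \<delta>"
  obtains p q where "p \<in> M" "q \<in> M" "p \<noteq> q" "\<bar>p - u\<bar> < \<delta>" "\<bar>q - u\<bar> < \<delta>"
proof -
  have M': "M \<subseteq> K" "compact M" "\<And>g x. g \<in> H \<Longrightarrow> x \<in> M \<Longrightarrow> g x \<in> M" by (fact minimalD[OF M(1)])+
  obtain z where z: "z \<in> M" "z islimpt M"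
    using Heine_Borel_imp_Bolzano_Weierstrass[OF M'(2) M(2)] by blast
  obtain \<eta> where \<eta>: "0 < \<eta>" "\<And>x. x \<in> M \<Longrightarrow> \<exists>g\<in>H. \<forall>y\<in>M. \<bar>y - x\<bar> < \<eta> \<longrightarrow> \<bar>g y - u\<bar> < \<delta>"
    using minimal_uniform_transport[OF M(1) u \<delta>] by blast
  obtain g where g: "g \<in> H" "\<forall>y\<in>M. \<bar>y - z\<bar> < \<eta> \<longrightarrow> \<bar>g y - u\<bar> < \<delta>" using \<eta>(2)[OF z(1)] by blast
  obtain y where y: "y \<in> M" "y \<noteq> z" "dist y z < \<eta>" using z(2) \<eta>(1) unfolding islimpt_approachable by blast
  have "g y \<noteq> g z" using inv_apply(1)[OF g(1)] y z M'(1) by (metis subsetD)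
  thus ?thesis using that[of "g y" "g z"] M'(3) g y z \<eta>(1) by (simp add: dist_real_def)
qed

section \<open>Finiteness of minimal sets\<close>

text \<open>The outermost letters of the two Thue-Morse words are \<open>\<alpha>\<close> and
  \<open>\<beta>\<close>, so the words map \<open>B\<close> into disjoint sets. Nilpotency makes
  them equal at some stage.\<close>

lemma ping_pong:
  assumes nil: "nilpotent_group G" and mem: "\<alpha> \<in> H" "\<beta> \<in> H"
    and B: "B \<subseteq> K" "B \<noteq> {}" "\<alpha> ` B \<subseteq> B" "\<beta> ` B \<subseteq> B" "\<alpha> ` B \<inter> \<beta> ` B = {}"
  shows False
proof -
  obtain n where n: "lower_central_series G n = {\<one>\<^bsub>G\<^esub>}" using nil unfolding nilpotent_group_def by blast
  define X Y where "X n = fst (thue_morse \<alpha> \<beta> n)" and "Y n = snd (thue_morse \<alpha> \<beta> n)" for n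
  have XY: "X n \<in> H" "Y n \<in> H" for n
    using thue_morse_quotient[of \<alpha> \<beta> n] mem unfolding X_def Y_def carrier_H by auto
  have step: "X 0 = \<alpha>" "Y 0 = \<beta>" "X (Suc n) = X n \<otimes>\<^bsub>G\<^esub> Y n" "Y (Suc n) = Y n \<otimes>\<^bsub>G\<^esub> X n" for n
    unfolding X_def Y_def by simp_all
  have images: "\<forall>y\<in>B. X n y \<in> \<alpha> ` B \<and> Y n y \<in> \<beta> ` B" for n
  proof (induction n)
    case (Suc n)
    show ?case
    proof
      fix y assume y: "y \<in> B"
      have "X n y \<in> B" "Y n y \<in> B" using Suc y B by blast+
      moreover have "X (Suc n) y = X n (Y n y)" "Y (Suc n) y = Y n (X n y)"
        unfolding step using mult_apply XY y B(1) by auto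
      ultimately show "X (Suc n) y \<in> \<alpha> ` B \<and> Y (Suc n) y \<in> \<beta> ` B" using Suc by simp
    qed
  qed (auto simp: step)
  have "X n = Y n" unfolding X_def Y_def using thue_morse_eq[OF n] mem carrier_H by blast
  thus False using images[of n] B by (metis disjoint_iff ex_in_conv)
qed

lemma words_in_H:
  assumes "w \<in> words S" "S \<subseteq> H"
  shows "\<exists>g\<in>H. \<forall>x\<in>K. g x = w x"
  using assms(1)
proof induction
  case words_id
  show ?case using closed_H(3) one_apply by auto
next
  case (words_comp w s)
  then obtain g where g: "g \<in> H" "\<forall>x\<in>K. g x = w x" by blast
  have s: "s \<in> H" using words_comp assms by blast
  thus ?case using g closed_H(1)[OF g(1) s] mult_apply[OF g(1) s] in_K[OF s]
    by (intro bexI[of _ "g \<otimes>\<^bsub>G\<^esub> s"]) auto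
qed

theorem minimal_finite:
  assumes fg: "finitely_generated_group G" and nil: "nilpotent_group G" and M: "minimal M"
  shows "finite M"
proof (rule ccontr)
  assume inf: "infinite M"
  have M': "M \<subseteq> K" "compact M" "\<And>g x. g \<in> H \<Longrightarrow> x \<in> M \<Longrightarrow> g x \<in> M" by (fact minimalD[OF M])+
  obtain S where S: "finite S" "S \<subseteq> H" "generate G S = H"
    using fg unfolding finitely_generated_group_def carrier_H by blast
  define S' where "S' = S \<union> (\<lambda>s. inv\<^bsub>G\<^esub> s) ` S"
  have S': "finite S'" "S' \<subseteq> H" unfolding S'_def using S closed_H(2) by auto
  have "S' \<subseteq> Diff_1Lip K" using S'(2) H_Diff by blast
  then obtain e L where e: "e > 0" "L \<ge> 0" "\<forall>f\<in>S'. bounded_distortion K e L f \<and> locally_monotone K e f"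
    using Diff_1Lip_uniform_bounded_distortion[OF compact_K S'(1)] by blast
  interpret gap_walk M S' e L
  proof
    show "\<exists>t. x < t \<and> t < y \<and> t \<notin> M" if "x \<in> M" "y \<in> M" "x < y" for x y
      using Cantor_set_between[OF Cantor, of x y] that M'(1) by blast
    show "s x \<in> M" if "s \<in> S'" "x \<in> M" for s x using that S' M' by blast
    show "continuous_on M s" if "s \<in> S'" for s using cont_K[of s] that S' M'(1) by (blast intro: continuous_on_subset)
    show "bounded_distortion M e L s" if "s \<in> S'" for s
      by (rule bounded_distortion_mono[of K e L]) (use e that M'(1) in auto)
    show "locally_monotone M e s" if "s \<in> S'" for s
      by (rule locally_monotone_mono[of K e]) (use e that M'(1) in auto)
    show "\<exists>s'\<in>S'. \<forall>x\<in>M. s' (s x) = x \<and> s (s' x) = x" if s: "s \<in> S'" for s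
    proof -
      have "inv\<^bsub>G\<^esub> s \<in> S'"
      proof (cases "s \<in> S")
        case False
        then obtain t where "t \<in> S" "s = inv\<^bsub>G\<^esub> t" using s unfolding S'_def by blast
        moreover from this have "inv\<^bsub>G\<^esub> s = t" using S(2) carrier_H by (simp add: subset_iff)
        ultimately show ?thesis unfolding S'_def by simp
      qed (simp add: S'_def)
      moreover have "s \<in> H" using s S' by blast
      ultimately show ?thesis using inv_apply[of s] M'(1) by blast
    qed
    show "\<exists>s\<in>S'. \<not> s ` F \<subseteq> F" if F: "F \<subseteq> M" "finite F" "F \<noteq> {}" for F
    proof (rule ccontr)
      assume "\<not> ?thesis"
      hence inv: "s x \<in> F" if "s \<in> S'" "x \<in> F" for s x using that by blast
      have "\<forall>x\<in>F. g x \<in> F" if "g \<in> generate G S" for g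
        using that
      proof (induction rule: generate.induct)
        case one
        show ?case using one_apply F M'(1) by (metis subsetD)
      next
        case (incl s) thus ?case using inv unfolding S'_def by blast
      next
        case (inv s) thus ?case using \<open>\<And>s x. s \<in> S' \<Longrightarrow> x \<in> F \<Longrightarrow> s x \<in> F\<close> unfolding S'_def by blast
      next
        case (eng g h)
        hence "g \<in> H" "h \<in> H" using S(3) by auto
        thus ?case using mult_apply[of g h] eng.IH F(1) M'(1) by auto
      qed
      hence "F = M" using S(3) F by (intro minimal_eq[OF M]) (auto simp: finite_imp_compact)
      thus False using F inf by simp
    qed
  qed (use M' inf S' e in auto)
  obtain u \<delta> where u: "u \<in> M" "0 < \<delta>"
    and contr: "\<And>\<eta>. 0 < \<eta> \<Longrightarrow> \<exists>w\<in>words S'. \<forall>y\<in>M. \<bar>y - u\<bar> \<le> \<delta> \<longrightarrow> \<bar>w y - w u\<bar> \<le> \<eta>"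
    using contracting_words by blast
  obtain p q where pq: "p \<in> M" "q \<in> M" "p \<noteq> q" "\<bar>p - u\<bar> < \<delta>" "\<bar>q - u\<bar> < \<delta>"
    using minimal_two_points[OF M inf u] by blast
  define B where "B = {y \<in> M. \<bar>y - u\<bar> \<le> \<delta>}"
  \<comment> \<open>Half the distance of \<open>p\<close> and \<open>q\<close> makes the two images
    disjoint; the other two bounds keep them inside \<open>B\<close>.\<close>
  define \<rho> where "\<rho> = min (\<bar>p - q\<bar> / 2) (min (\<delta> - \<bar>p - u\<bar>) (\<delta> - \<bar>q - u\<bar>))"
  have \<rho>: "0 < \<rho>" "\<rho> \<le> \<bar>p - q\<bar> / 2" "\<rho> \<le> \<delta> - \<bar>p - u\<bar>" "\<rho> \<le> \<delta> - \<bar>q - u\<bar>"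
  proof -
    show "0 < \<rho>" unfolding \<rho>_def using pq by auto
    show "\<rho> \<le> \<bar>p - q\<bar> / 2" "\<rho> \<le> \<delta> - \<bar>p - u\<bar>" "\<rho> \<le> \<delta> - \<bar>q - u\<bar>" unfolding \<rho>_def by linarith+
  qed
  \<comment> \<open>The radius \<open>\<eta>\<close> of uniform transport to \<open>r\<close> is
    fixed first; then a word shrinks \<open>B\<close> to within \<open>\<eta> / 2\<close> of the
    image of \<open>u\<close>, and a transporting element moves that image near
    \<open>r\<close>.\<close>
  have into: "\<exists>\<alpha>\<in>H. \<forall>y\<in>B. \<bar>\<alpha> y - r\<bar> < \<rho>" if r: "r \<in> M" for r
  proof -
    obtain \<eta> where \<eta>: "0 < \<eta>" "\<And>x. x \<in> M \<Longrightarrow> \<exists>g\<in>H. \<forall>y\<in>M. \<bar>y - x\<bar> < \<eta> \<longrightarrow> \<bar>g y - r\<bar> < \<rho>"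
      using minimal_uniform_transport[OF M r \<rho>(1)] by blast
    have "0 < \<eta> / 2" using \<eta>(1) by simp
    then obtain w where w: "w \<in> words S'" "\<forall>y\<in>M. \<bar>y - u\<bar> \<le> \<delta> \<longrightarrow> \<bar>w y - w u\<bar> \<le> \<eta> / 2" using contr by blast
    obtain h where h: "h \<in> H" "\<forall>x\<in>K. h x = w x" using words_in_H[OF w(1) S'(2)] by blast
    obtain g where g: "g \<in> H" "\<forall>y\<in>M. \<bar>y - h u\<bar> < \<eta> \<longrightarrow> \<bar>g y - r\<bar> < \<rho>" using \<eta>(2)[of "h u"] M'(3)[OF h(1) u(1)] by blast
    have "\<bar>(g \<otimes>\<^bsub>G\<^esub> h) y - r\<bar> < \<rho>" if "y \<in> B" for y
    proof -
      have y: "y \<in> M" "\<bar>y - u\<bar> \<le> \<delta>" using that unfolding B_def by auto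
      have "\<bar>h y - h u\<bar> \<le> \<eta> / 2" using w(2) y h(2) M'(1) u(1) by (metis subsetD)
      hence "\<bar>h y - h u\<bar> < \<eta>" using \<eta>(1) by linarith
      hence "\<bar>g (h y) - r\<bar> < \<rho>" using g(2) M'(3)[OF h(1) y(1)] by blast
      thus ?thesis using mult_apply[OF g(1) h(1), of y] y(1) M'(1) by auto
    qed
    thus ?thesis using closed_H(1)[OF g(1) h(1)] by blast
  qed
  obtain \<alpha> where \<alpha>: "\<alpha> \<in> H" "\<forall>y\<in>B. \<bar>\<alpha> y - p\<bar> < \<rho>" using into[OF pq(1)] by blast
  obtain \<beta> where \<beta>: "\<beta> \<in> H" "\<forall>y\<in>B. \<bar>\<beta> y - q\<bar> < \<rho>" using into[OF pq(2)] by blast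
  have BM: "B \<subseteq> M" unfolding B_def by blast
  show False
  proof (rule ping_pong[OF nil \<alpha>(1) \<beta>(1)])
    show "B \<subseteq> K" using BM M'(1) by blast
    show "B \<noteq> {}" unfolding B_def using u by auto
    have "\<bar>\<alpha> y - u\<bar> \<le> \<delta>" "\<bar>\<beta> y - u\<bar> \<le> \<delta>" if "y \<in> B" for y
      using bspec[OF \<alpha>(2) that] bspec[OF \<beta>(2) that] \<rho>(3,4) by linarith+
    moreover have "\<alpha> y \<in> M" "\<beta> y \<in> M" if "y \<in> B" for y using that BM M'(3) \<alpha>(1) \<beta>(1) by blast+
    ultimately show "\<alpha> ` B \<subseteq> B" "\<beta> ` B \<subseteq> B" unfolding B_def by auto
    have "\<alpha> y \<noteq> \<beta> z" if "y \<in> B" "z \<in> B" for y z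
    proof
      assume "\<alpha> y = \<beta> z"
      hence "\<bar>p - q\<bar> \<le> \<bar>\<beta> z - q\<bar> + \<bar>\<alpha> y - p\<bar>"
        using abs_triangle_ineq4[of "\<beta> z - q" "\<alpha> y - p"] by simp
      moreover have "\<bar>\<alpha> y - p\<bar> < \<rho>" "\<bar>\<beta> z - q\<bar> < \<rho>" using \<alpha>(2) \<beta>(2) that by blast+
      ultimately show False using \<rho>(2) by simp
    qed
    thus "\<alpha> ` B \<inter> \<beta> ` B = {}" by blast
  qed
qed

section \<open>Torsion of central commutators\<close>

lemma funpow_periodic:
  assumes M: "finite M" "p \<in> M" "\<And>x. x \<in> M \<Longrightarrow> f x \<in> M" and f: "f \<in> H" "M \<subseteq> K"
  shows "\<exists>k>0. (f ^^ k) p = p"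
proof -
  have mem: "(f ^^ n) p \<in> M" for n using M by (induction n) auto
  have "\<not> inj (\<lambda>n. (f ^^ n) p)"
  proof
    assume "inj (\<lambda>n. (f ^^ n) p)"
    moreover have "finite (range (\<lambda>n. (f ^^ n) p))" using mem M(1) by (auto intro: finite_subset)
    ultimately show False using finite_imageD infinite_UNIV_nat by blast
  qed
  then obtain i j where ij: "i \<noteq> j" "(f ^^ i) p = (f ^^ j) p" unfolding inj_def by blast
  have cancel: "(f ^^ k) p = p" if "(f ^^ (i + k)) p = (f ^^ i) p" for i k
    using that
  proof (induction i)
    case (Suc i)
    have "(inv\<^bsub>G\<^esub> f) (f ((f ^^ (i + k)) p)) = (inv\<^bsub>G\<^esub> f) (f ((f ^^ i) p))" using Suc.prems by simp
    hence "(f ^^ (i + k)) p = (f ^^ i) p" using inv_apply(1)[OF f(1)] mem f(2) by (metis subsetD)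
    thus ?case by (rule Suc.IH)
  qed simp
  show ?thesis
  proof (cases "i < j")
    case True
    thus ?thesis using cancel[of i "j - i"] ij by (intro exI[of _ "j - i"]) auto
  next
    case False
    thus ?thesis using cancel[of j "i - j"] ij by (intro exI[of _ "i - j"]) auto
  qed
qed

lemma funpow_fixed_mult: "(f ^^ k) x = x \<Longrightarrow> (f ^^ (k * l)) x = x"
  by (induction l) (auto simp: funpow_add)

theorem central_commutator_torsion:
  assumes fg: "finitely_generated_group G" and nil: "nilpotent_group G"
    and ab: "a \<in> H" "b \<in> H" and central: "\<And>x. x \<in> H \<Longrightarrow> commutator G a b \<otimes>\<^bsub>G\<^esub> x = x \<otimes>\<^bsub>G\<^esub> commutator G a b"
  shows "\<exists>m>0. commutator G a b [^]\<^bsub>G\<^esub> (m::nat) = \<one>\<^bsub>G\<^esub>"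
proof -
  define c where "c = commutator G a b"
  have c: "c \<in> H" unfolding c_def using commutator_closed ab carrier_H by blast
  have cx: "c (g x) = g (c x)" if "g \<in> H" "x \<in> K" for g x
    using central[OF that(1)] mult_apply[OF c that] mult_apply[OF that(1) c that(2)] unfolding c_def by simp
  have abc: "a (b x) = c (b (a x))" if x: "x \<in> K" for x
  proof -
    have "a \<otimes>\<^bsub>G\<^esub> b = c \<otimes>\<^bsub>G\<^esub> (b \<otimes>\<^bsub>G\<^esub> a)" unfolding c_def using commutator_eq ab carrier_H by blast
    moreover have "(a \<otimes>\<^bsub>G\<^esub> b) x = a (b x)" by (rule mult_apply[OF ab x])
    moreover have "(c \<otimes>\<^bsub>G\<^esub> (b \<otimes>\<^bsub>G\<^esub> a)) x = c (b (a x))"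
      using mult_apply[OF c closed_H(1)[OF ab(2,1)] x] mult_apply[OF ab(2,1) x] by simp
    ultimately show ?thesis by simp
  qed
  define good where "good x d m \<longleftrightarrow> 0 < d \<and> 0 < m \<and> (\<forall>y\<in>K. \<bar>y - x\<bar> < d \<longrightarrow> (c ^^ m) y = y)"
    for x d :: real and m :: nat
  define V where "V = \<Union>{ball x d | x d. x \<in> K \<and> (\<exists>m. good x d m)}"
  have "open V" unfolding V_def by auto
  have V_good: "\<exists>d m. good x d m" if xV: "x \<in> V" for x
  proof -
    obtain z d m where z: "x \<in> ball z d" "good z d m" using xV unfolding V_def by blast
    have "good x (d - dist z x) m" unfolding good_def
    proof (intro conjI ballI impI)
      fix y assume "y \<in> K" "\<bar>y - x\<bar> < d - dist z x"
      thus "(c ^^ m) y = y" using z(2) unfolding good_def dist_real_def by auto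
    qed (use z in \<open>auto simp: good_def\<close>)
    thus ?thesis by blast
  qed
  define C where "C = K - V"
  have "C = {}"
  proof (rule ccontr)
    assume ne: "C \<noteq> {}"
    have "compact C" unfolding C_def by (rule compact_diff[OF compact_K \<open>open V\<close>])
    \<comment> \<open>Centrality makes \<open>c ^^ m\<close> trivial near \<open>x\<close> as soon
      as it is trivial near \<open>g x\<close>.\<close>
    have inv: "g x \<in> C" if g: "g \<in> H" and x: "x \<in> C" for g x
    proof (rule ccontr)
      have xK: "x \<in> K" "x \<notin> V" using x unfolding C_def by auto
      assume "g x \<notin> C"
      hence "g x \<in> V" unfolding C_def using in_K[OF g xK(1)] by blast
      then obtain d m where d: "good (g x) d m" using V_good by blast
      obtain d' where d': "0 < d'" "\<And>y. y \<in> K \<Longrightarrow> dist y x < d' \<Longrightarrow> dist (g y) (g x) < d"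
        using cont_K[OF g] xK d unfolding continuous_on_iff good_def by metis
      have "(c ^^ m) y = y" if y: "y \<in> K" "\<bar>y - x\<bar> < d'" for y
      proof -
        have "\<bar>g y - g x\<bar> < d" using d'(2) y unfolding dist_real_def by blast
        hence "(c ^^ m) (g y) = g y" using d in_K[OF g y(1)] unfolding good_def by blast
        moreover have "(c ^^ m) (g y) = g ((c ^^ m) y)" by (rule commute_funpow[of c K g y m, OF maps_K[OF c] cx[OF g] y(1)])
        ultimately have "(inv\<^bsub>G\<^esub> g) (g ((c ^^ m) y)) = (inv\<^bsub>G\<^esub> g) (g y)" by simp
        thus ?thesis using inv_apply(1)[OF g] y(1) funpow_in_carrier[OF maps_K[OF c] y(1)] by simp
      qed
      hence "good x d' m" using d d' unfolding good_def by blast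
      hence "x \<in> V" unfolding V_def using xK d' by (intro UnionI[of "ball x d'"]) auto
      thus False using xK by simp
    qed
    obtain M where M: "minimal M" "M \<subseteq> C"
      using minimal_exists[of C] \<open>compact C\<close> ne inv unfolding C_def by blast
    have fin: "finite M" by (rule minimal_finite[OF fg nil M(1)])
    have M': "M \<noteq> {}" "\<And>g x. g \<in> H \<Longrightarrow> x \<in> M \<Longrightarrow> g x \<in> M" "M \<subseteq> K" by (fact minimalD[OF M(1)])+
    then obtain p where p: "p \<in> M" "p \<in> K" by blast
    obtain k1 k2 where k12: "k1 > 0" "(a ^^ k1) p = p" "k2 > 0" "(b ^^ k2) p = p"
      using funpow_periodic[OF fin p(1) M'(2) _ M'(3)] ab by meson
    define k where "k = k1 * k2"
    have k: "k > 0" "(a ^^ k) p = p" "(b ^^ k) p = p"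
      unfolding k_def using k12 funpow_fixed_mult[of k1 a p k2] funpow_fixed_mult[of k2 b p k1]
      by (auto simp: mult.commute)
    have comm_pow: "(a ^^ n) ((b ^^ m) x) = (c ^^ (n * m)) ((b ^^ m) ((a ^^ n) x))" if x: "x \<in> K" for x n m
      by (rule commutator_funpow[of a K b c, OF maps_K[OF ab(1)] maps_K[OF ab(2)] maps_K[OF c]
            cx[OF ab(1)] cx[OF ab(2)] abc x])
    \<comment> \<open>Since \<open>a ^^ k\<close> and \<open>b ^^ (k * 2)\<close> fix
      \<open>p\<close>, so does their commutator \<open>c ^^ l\<close>. The commutator of the
      squares \<open>a ^^ (k * 2)\<close> and \<open>b ^^ (k * 2)\<close> is then
      \<open>c ^^ (l * 2)\<close>, the square of a map fixing \<open>p\<close>, as the local result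
      requires.\<close>
    define l where "l = k * (k * 2)"
    have bk: "(b ^^ (k * 2)) p = p" by (rule funpow_fixed_mult[OF k(3)])
    have cl: "(c ^^ l) p = p"
      using comm_pow[OF p(2), of k "k * 2"] k(2) bk unfolding l_def by simp
    let ?f = "a [^]\<^bsub>G\<^esub> k" and ?g = "b [^]\<^bsub>G\<^esub> k" and ?h = "c [^]\<^bsub>G\<^esub> l"
    have sq: "f [^]\<^bsub>G\<^esub> n \<otimes>\<^bsub>Diff_1Lip_group K\<^esub> f [^]\<^bsub>G\<^esub> n = f [^]\<^bsub>G\<^esub> (n * 2)" if "f \<in> H" for f and n :: nat
      using nat_pow_mult[of f n n] that carrier_H by (simp add: G_def mult_2_right)
    have app: "(f [^]\<^bsub>G\<^esub> (n::nat)) x = (f ^^ n) x" if "f \<in> H" "x \<in> K" for f n x by (rule pow_apply[OF that])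
    have powK: "(f ^^ n) x \<in> K" if "f \<in> H" "x \<in> K" for f n x by (rule funpow_in_carrier[OF maps_K[OF that(1)] that(2)])
    have "\<exists>d>0. \<forall>x\<in>K. \<bar>x - p\<bar> \<le> d \<longrightarrow> (c [^]\<^bsub>G\<^esub> (l * 2)) x = x"
    proof (rule commutator_of_squares_trivial[OF compact_K p(2), of ?f ?g ?h "a [^]\<^bsub>G\<^esub> (k * 2)" "b [^]\<^bsub>G\<^esub> (k * 2)"])
      show "?f \<in> Diff_1Lip K" "?g \<in> Diff_1Lip K" "?h \<in> Diff_1Lip K" using H_Diff closed_H(4) ab c by blast+
      show "?f p = p" "?g p = p" "?h p = p" using app ab c p(2) k cl by simp_all
      show "a [^]\<^bsub>G\<^esub> (k * 2) = ?f \<otimes>\<^bsub>Diff_1Lip_group K\<^esub> ?f" "b [^]\<^bsub>G\<^esub> (k * 2) = ?g \<otimes>\<^bsub>Diff_1Lip_group K\<^esub> ?g"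
        "c [^]\<^bsub>G\<^esub> (l * 2) = ?h \<otimes>\<^bsub>Diff_1Lip_group K\<^esub> ?h" using sq ab c by simp_all
      fix x assume x: "x \<in> K"
      have cg: "(c [^]\<^bsub>G\<^esub> (l * 2)) ((g [^]\<^bsub>G\<^esub> (k * 2)) x) = (g [^]\<^bsub>G\<^esub> (k * 2)) ((c [^]\<^bsub>G\<^esub> (l * 2)) x)" if g: "g \<in> H" for g
        using commute_funpow_funpow[of c K g x "l * 2" "k * 2", OF maps_K[OF c] maps_K[OF g] cx[OF g] x]
        by (simp only: app[OF c x] app[OF g x] app[OF c powK[OF g x]] app[OF g powK[OF c x]])
      show "(c [^]\<^bsub>G\<^esub> (l * 2)) ((a [^]\<^bsub>G\<^esub> (k * 2)) x) = (a [^]\<^bsub>G\<^esub> (k * 2)) ((c [^]\<^bsub>G\<^esub> (l * 2)) x)"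
        "(c [^]\<^bsub>G\<^esub> (l * 2)) ((b [^]\<^bsub>G\<^esub> (k * 2)) x) = (b [^]\<^bsub>G\<^esub> (k * 2)) ((c [^]\<^bsub>G\<^esub> (l * 2)) x)"
        using cg ab by blast+
      have l2: "k * 2 * (k * 2) = l * 2" unfolding l_def by simp
      show "(a [^]\<^bsub>G\<^esub> (k * 2)) ((b [^]\<^bsub>G\<^esub> (k * 2)) x) = (c [^]\<^bsub>G\<^esub> (l * 2)) ((b [^]\<^bsub>G\<^esub> (k * 2)) ((a [^]\<^bsub>G\<^esub> (k * 2)) x))"
        using comm_pow[OF x, of "k * 2" "k * 2"] unfolding l2
        by (simp only: app[OF ab(1) x] app[OF ab(2) x] app[OF ab(1) powK[OF ab(2) x]]
              app[OF ab(2) powK[OF ab(1) x]] app[OF c powK[OF ab(2) powK[OF ab(1) x]]])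
    qed
    then obtain d where d: "d > 0" "\<forall>x\<in>K. \<bar>x - p\<bar> \<le> d \<longrightarrow> (c [^]\<^bsub>G\<^esub> (l * 2)) x = x" by blast
    have "good p d (l * 2)" unfolding good_def
    proof (intro conjI ballI impI)
      show "0 < l * 2" unfolding l_def using k by simp
      fix y assume y: "y \<in> K" "\<bar>y - p\<bar> < d"
      thus "(c ^^ (l * 2)) y = y" using d(2) app[OF c y(1), of "l * 2"] by simp
    qed (rule d(1))
    hence "p \<in> V" unfolding V_def using p(2) d(1) by (intro UnionI[of "ball p d"]) auto
    thus False using p(1) M(2) unfolding C_def by blast
  qed
  hence KV: "K \<subseteq> V" unfolding C_def by blast
  have "\<forall>x\<in>K. \<exists>d m. good x d m" using V_good KV by blast
  then obtain d m where dm: "\<And>x. x \<in> K \<Longrightarrow> good x (d x) (m x)" by metis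
  obtain F where F: "F \<subseteq> K" "finite F" "K \<subseteq> (\<Union>x\<in>F. ball x (d x))"
  proof (rule compactE_image[OF compact_K, of K "\<lambda>x. ball x (d x)"])
    show "K \<subseteq> (\<Union>x\<in>K. ball x (d x))" using dm unfolding good_def by force
  qed auto
  \<comment> \<open>A common multiple of the local exponents over a finite subcover.\<close>
  define m0 where "m0 = prod m F"
  have "m0 > 0" unfolding m0_def using dm F by (intro prod_pos) (auto simp: good_def)
  moreover have "c [^]\<^bsub>G\<^esub> m0 = \<one>\<^bsub>G\<^esub>"
  proof (rule eqI)
    fix y assume y: "y \<in> K"
    then obtain x where x: "x \<in> F" "\<bar>y - x\<bar> < d x" using F(3) by (auto simp: dist_real_def abs_minus_commute)
    hence "(c ^^ m x) y = y" using dm[of x] F(1) y unfolding good_def by blast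
    moreover obtain l where "m0 = m x * l" unfolding m0_def using F(2) x(1) dvd_prod_eqI[of F x "m x" m] by auto
    ultimately have "(c ^^ m0) y = y" using funpow_fixed_mult by metis
    thus "(c [^]\<^bsub>G\<^esub> m0) y = \<one>\<^bsub>G\<^esub> y" using pow_apply[OF c y] one_apply[OF y] by simp
  qed (use closed_H c in auto)
  ultimately show ?thesis unfolding c_def by blast
qed

end

theorem corollary1p13:
  fixes K :: "real set" and H :: "(real \<Rightarrow> real) set"
  assumes "Cantor_set K"
    and "subgroup H (Diff_1Lip_group K)"
    and "finitely_generated_group ((Diff_1Lip_group K)\<lparr>carrier := H\<rparr>)"
    and "nilpotent_group ((Diff_1Lip_group K)\<lparr>carrier := H\<rparr>)"
  shows "virtually_abelian_group ((Diff_1Lip_group K)\<lparr>carrier := H\<rparr>)"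
proof -
  interpret Diff_subgroup K H "(Diff_1Lip_group K)\<lparr>carrier := H\<rparr>"
    by (intro Diff_subgroup.intro assms)
  show ?thesis
    using assms(3,4) central_commutator_torsion[OF assms(3,4)]
    by (intro virtually_abelian_if_central_commutators_torsion) auto
qed

end
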